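(* Suppose the Basic Assumption, the Variance Assumption and the Moment Assumption (stated in the context) hold. Choose an initial iterate $(y^0,u^0,x^0)$ with $$\mathbb{E}\big[\|y^0-y^*(x^0)\|^2\big]\le\min\Big\{\frac{\mu^2}{20rL_{g,2}^2},\frac{1}{4L_1}\Big\},\qquad \mathbb{E}\big[\|u^0-u^*(x^0)\|^2\big]\le\min\Big\{\frac{4L_1^2}{5rL_{g,2}^2},\frac{L_1}{\mu^2}\Big\}.$$ Then, for any constant inner step size $\gamma_k=\gamma\in(0,1/L_{g,1}]$, there exist a constant outer step size $\alpha_k=\alpha=\Theta(\kappa^{-3})$ and an integer $T\ge\Theta(\kappa)$ such that the algorithm NSBO-SGD (defined in the context) has the following properties. (a) Fix $K\ge1$. For samples with batch sizes $|B_1^{t,k}|\ge\Theta(\kappa^2)$, $|B_1^k|\ge\Theta(\kappa K+\kappa^2)$, $|B_2^k|\ge\Theta(\kappa^3K+\kappa^4)$, $|B_3^k|\ge\Theta(\kappa^{-1}K)$, $|B_4^k|\ge\Theta(\kappa^{-1}K)$, it holds that $$\min_{0\le k\le K-1}\mathbb{E}\big[\|\nabla\Phi(x^k)\|^2\big]=O\Big(\frac{\kappa^3}{K}\Big).$$ That is, NSBO-SGD finds an $\epsilon$-optimal solution (an iterate with $\mathbb{E}[\|\nabla\Phi(x^k)\|^2]\le\epsilon$) in $K=O(\kappa^3\epsilon^{-1})$ steps. (b) The computational complexity of NSBO-SGD for finding an $\epsilon$-optimal solution is: $O(\kappa^5\epsilon^{-2})$ gradient complexity for $F$, $O(\kappa^9\epsilon^{-2})$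 gradient complexity for $G$, $O(\kappa^5\epsilon^{-2})$ Jacobian-vector product complexity, and $O(\kappa^7\epsilon^{-2})$ Hessian-vector product complexity.
   Context: Setting. $f,g:\mathbb{R}^m\times\mathbb{R}^n\to\mathbb{R}$ are given by $f(x,y)=\mathbb{E}_\xi[F(x,y;\xi)]$, $g(x,y)=\mathbb{E}_\zeta[G(x,y;\zeta)]$, $f$ differentiable and $g$ twice differentiable. $\nabla_1,\nabla_2$ denote gradients with respect to $x\in\mathbb{R}^m$ and $y\in\mathbb{R}^n$; $\nabla^2_{22}g$ is the Hessian of $g$ in $y$ and $\nabla^2_{12}g\in\mathbb{R}^{m\times n}$ is the Jacobian of $\nabla_1 g$ with respect to $y$ (similarly for $G$). $\|\cdot\|$ is the Euclidean norm for vectors and the Frobenius norm for matrices. The bilevel problem is $\min_x\Phi(x):=f(x,y^*(x))$ with $y^*(x)=\arg\min_y g(x,y)$; $\Phi^*$ is its optimal value. Put $u^*(x):=[\nabla^2_{22}g(x,y^*(x))]^{-1}\nabla_2 f(x,y^*(x))$. Basic Assumption (with positive constants): (a) for every $x$, $g(x,\cdot)$ is strongly convex with parameter $\mu>0$; (b) $\nabla g$ is Lipschitz with constant $L_{g,1}$, and $\nabla^2_{22}g$, $\nabla^2_{12}g$ are Lipschitz with constant $L_{g,2}$; (c) $\nabla f$ is Lipschitz with constant $L_{f,1}$, and $\|\nabla_2 f(x,y^*(x))\|\le L_{f,0}$ for all $x$; (d) $\|\nabla_1 f(x,y)\|\le C_{f,0}$ for all $x,y$. Variance Assumption: there are positive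 constants $\sigma_{f,1},\sigma_{g,1},\sigma_{g,2}$ with $\mathbb{E}\|\nabla F(x,y;\xi)-\nabla f(x,y)\|^2\le\sigma_{f,1}^2$, $\mathbb{E}\|\nabla G(x,y;\zeta)-\nabla g(x,y)\|^2\le\sigma_{g,1}^2$, $\mathbb{E}\|\nabla^2G(x,y;\zeta)-\nabla^2g(x,y)\|^2\le\sigma_{g,2}^2$ (for all $x,y$). Moment Assumption: there is a constant $r\ge1$ such that every iterate $(x^k,y^k)$ generated by NSBO-SGD satisfies $\mathbb{E}[\|y^k-y^*(x^k)\|^2]\le r\big(\mathbb{E}[\|y^k-y^*(x^k)\|]\big)^2$. Constants: $L_1:=L_{f,1}+L_{g,2}L_{f,0}/\mu$, $L:=\max\{L_{g,1},L_{f,1}\}$, $\kappa:=L/\mu$. Algorithm NSBO-SGD. For a batch $B$ of i.i.d. samples, $F(\cdot;B)$, $G(\cdot;B)$ denote the averages over the batch (and likewise for derivatives), so derivative estimators are unbiased; all batches are drawn freshly and independently. Input $y^0,u^0,x^0$, iteration numbers $K,T$, step sizes $\alpha_k,\gamma_k$. For $k=0,\dots,K-1$: sample batches $B_1^k,B_2^k,B_3^k,B_4^k$ and set $D_y^k=\nabla_2G(x^k,y^k;B_2^k)$, $D_u^k=\nabla^2_{22}G(x^k,y^k;B_1^k)u^k-\nabla_2F(x^k,y^k;B_3^k)$, $D_x^k=\nabla_1F(x^k,y^k;B_3^k)-\nabla^2_{12}G(x^k,y^k;B_4^k)u^k$; set $v^{-1,k}=w^{-1,k}=0$ and for $t=-1,0,\dots,T-1$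 sample a batch $B_1^{t,k}$, let $H^{t,k}=\nabla^2_{22}G(x^k,y^k;B_1^{t,k})$ and $$v^{t+1,k}=[I-\gamma_kH^{t,k}]v^{t,k}+\gamma_kD_y^k,\qquad w^{t+1,k}=[I-\gamma_kH^{t,k}]w^{t,k}+\gamma_kD_u^k;$$ put $y^{k+1}=y^k-v^{T,k}$, $u^{k+1}=u^k-w^{T,k}$, $x^{k+1}=x^k-\alpha_kD_x^k$. Complexity conventions. Gradient complexity for $F$ (resp. $G$) is the total number of sample gradients of $F$ (resp. $G$) evaluated; Jacobian- and Hessian-vector product complexities are the total numbers of products of sample matrices $\nabla^2_{12}G(\cdot;\zeta)$, $\nabla^2_{22}G(\cdot;\zeta)$ with vectors. Asymptotic notation is with respect to $\kappa,\epsilon^{-1},K$; $L_{f,0},L_{f,1},L_{g,1},L_{g,2},C_{f,0},\sigma_{f,1},\sigma_{g,1},\sigma_{g,2},r,\gamma$ and the initial gap $\mathbb{E}[\Phi(x^0)]-\Phi^*$ are regarded as fixed. "$\ge\Theta(\cdot)$" means at least a threshold of that order. *)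

theory Defs
  imports "HOL-Probability.Probability"
begin

section \<open>Gradients and Hessian blocks\<close>

definition grad :: "('a::real_inner \<Rightarrow> real) \<Rightarrow> 'a \<Rightarrow> 'a" where
  "grad h z = (THE D. GDERIV h z :> D)"

text \<open>Pairs carry the Euclidean norm of the product and \<^typ>\<open>real^'n^'m\<close> carries the
  Frobenius norm.\<close>

definition grad_joint ::
    "(real^'m \<Rightarrow> real^'n \<Rightarrow> real) \<Rightarrow> real^'m \<Rightarrow> real^'n \<Rightarrow> (real^'m) \<times> (real^'n)" where
  "grad_joint h x y = grad (\<lambda>z. h (fst z) (snd z)) (x, y)"

definition grad1 :: "(real^'m \<Rightarrow> real^'n \<Rightarrow> real) \<Rightarrow> real^'m \<Rightarrow> real^'n \<Rightarrow> real^'m" where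
  "grad1 h x y = grad (\<lambda>x'. h x' y) x"

definition grad2 :: "(real^'m \<Rightarrow> real^'n \<Rightarrow> real) \<Rightarrow> real^'m \<Rightarrow> real^'n \<Rightarrow> real^'n" where
  "grad2 h x y = grad (\<lambda>y'. h x y') y"

definition hess11 :: "(real^'m \<Rightarrow> real^'n \<Rightarrow> real) \<Rightarrow> real^'m \<Rightarrow> real^'n \<Rightarrow> real^'m^'m" where
  "hess11 h x y = jacobian (\<lambda>x'. grad1 h x' y) (at x)"

definition hess12 :: "(real^'m \<Rightarrow> real^'n \<Rightarrow> real) \<Rightarrow> real^'m \<Rightarrow> real^'n \<Rightarrow> real^'n^'m" where
  "hess12 h x y = jacobian (\<lambda>y'. grad1 h x y') (at y)"

definition hess21 :: "(real^'m \<Rightarrow> real^'n \<Rightarrow> real) \<Rightarrow> real^'m \<Rightarrow> real^'n \<Rightarrow> real^'m^'n" where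
  "hess21 h x y = jacobian (\<lambda>x'. grad2 h x' y) (at x)"

definition hess22 :: "(real^'m \<Rightarrow> real^'n \<Rightarrow> real) \<Rightarrow> real^'m \<Rightarrow> real^'n \<Rightarrow> real^'n^'n" where
  "hess22 h x y = jacobian (\<lambda>y'. grad2 h x y') (at y)"

text \<open>The full Hessian, stored as the tuple of its blocks, so that the norm of the tuple is
  the Frobenius norm of the whole matrix.\<close>

definition hess ::
    "(real^'m \<Rightarrow> real^'n \<Rightarrow> real) \<Rightarrow> real^'m \<Rightarrow> real^'n \<Rightarrow>
     ((real^'m^'m) \<times> (real^'n^'m)) \<times> ((real^'m^'n) \<times> (real^'n^'n))" where
  "hess h x y = ((hess11 h x y, hess12 h x y), (hess21 h x y, hess22 h x y))"

definition differentiable1 :: "(real^'m \<Rightarrow> real^'n \<Rightarrow> real) \<Rightarrow> bool" where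
  "differentiable1 h \<longleftrightarrow> (\<forall>z. (\<lambda>z. h (fst z) (snd z)) differentiable (at z))"

definition differentiable2 :: "(real^'m \<Rightarrow> real^'n \<Rightarrow> real) \<Rightarrow> bool" where
  "differentiable2 h \<longleftrightarrow> differentiable1 h \<and>
     (\<forall>z. (\<lambda>z. grad_joint h (fst z) (snd z)) differentiable (at z))"

section \<open>The bilevel problem\<close>

definition strongly_convex :: "real \<Rightarrow> ('a::real_normed_vector \<Rightarrow> real) \<Rightarrow> bool" where
  "strongly_convex \<mu> h \<longleftrightarrow> (\<forall>y z t. 0 \<le> t \<and> t \<le> 1 \<longrightarrow>
     h (t *\<^sub>R y + (1 - t) *\<^sub>R z) \<le> t * h y + (1 - t) * h z - \<mu> / 2 * t * (1 - t) * (norm (y - z))\<^sup>2)"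

definition ystar :: "(real^'m \<Rightarrow> real^'n \<Rightarrow> real) \<Rightarrow> real^'m \<Rightarrow> real^'n" where
  "ystar g x = (ARG_MIN (g x) y. True)"

definition ustar ::
    "(real^'m \<Rightarrow> real^'n \<Rightarrow> real) \<Rightarrow> (real^'m \<Rightarrow> real^'n \<Rightarrow> real) \<Rightarrow> real^'m \<Rightarrow> real^'n" where
  "ustar f g x = matrix_inv (hess22 g x (ystar g x)) *v grad2 f x (ystar g x)"

definition Phi ::
    "(real^'m \<Rightarrow> real^'n \<Rightarrow> real) \<Rightarrow> (real^'m \<Rightarrow> real^'n \<Rightarrow> real) \<Rightarrow> real^'m \<Rightarrow> real" where
  "Phi f g x = f x (ystar g x)"

definition Phi_opt ::
    "(real^'m \<Rightarrow> real^'n \<Rightarrow> real) \<Rightarrow> (real^'m \<Rightarrow> real^'n \<Rightarrow> real) \<Rightarrow> real" where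
  "Phi_opt f g = (INF x. Phi f g x)"

definition kappa :: "real \<Rightarrow> real \<Rightarrow> real \<Rightarrow> real" where
  "kappa Lf1 Lg1 \<mu> = max Lg1 Lf1 / \<mu>"

definition L1_const :: "real \<Rightarrow> real \<Rightarrow> real \<Rightarrow> real \<Rightarrow> real" where
  "L1_const Lf0 Lf1 Lg2 \<mu> = Lf1 + Lg2 * Lf0 / \<mu>"

definition basic_assumption ::
    "(real^'m \<Rightarrow> real^'n \<Rightarrow> real) \<Rightarrow> (real^'m \<Rightarrow> real^'n \<Rightarrow> real) \<Rightarrow>
     real \<Rightarrow> real \<Rightarrow> real \<Rightarrow> real \<Rightarrow> real \<Rightarrow> real \<Rightarrow> bool" where
  "basic_assumption f g \<mu> Lf0 Lf1 Lg1 Lg2 Cf0 \<longleftrightarrow>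
     0 < \<mu> \<and> 0 < Lf0 \<and> 0 < Lf1 \<and> 0 < Lg1 \<and> 0 < Lg2 \<and> 0 < Cf0 \<and>
     (\<forall>x. strongly_convex \<mu> (g x)) \<and>
     Lg1-lipschitz_on UNIV (\<lambda>z. grad_joint g (fst z) (snd z)) \<and>
     Lg2-lipschitz_on UNIV (\<lambda>z. hess22 g (fst z) (snd z)) \<and>
     Lg2-lipschitz_on UNIV (\<lambda>z. hess12 g (fst z) (snd z)) \<and>
     Lf1-lipschitz_on UNIV (\<lambda>z. grad_joint f (fst z) (snd z)) \<and>
     (\<forall>x. norm (grad2 f x (ystar g x)) \<le> Lf0) \<and>
     (\<forall>x y. norm (grad1 f x y) \<le> Cf0)"

section \<open>Stochastic oracles\<close>

text \<open>\<open>F \<xi> x y\<close> and \<open>G \<zeta> x y\<close> are the sample functions, with \<open>\<xi>\<close>, \<open>\<zeta>\<close> distributed according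
  to the probability measures \<open>Dxi\<close>, \<open>Dzeta\<close>. The last three conjuncts are the unbiasedness of the
  derivatives of a single sample.\<close>

definition bilevel_setting ::
    "(real^'m \<Rightarrow> real^'n \<Rightarrow> real) \<Rightarrow> (real^'m \<Rightarrow> real^'n \<Rightarrow> real) \<Rightarrow>
     ('xi \<Rightarrow> real^'m \<Rightarrow> real^'n \<Rightarrow> real) \<Rightarrow> ('zeta \<Rightarrow> real^'m \<Rightarrow> real^'n \<Rightarrow> real) \<Rightarrow>
     'xi measure \<Rightarrow> 'zeta measure \<Rightarrow> bool" where
  "bilevel_setting f g F G Dxi Dzeta \<longleftrightarrow>
     prob_space Dxi \<and> prob_space Dzeta \<and>
     differentiable1 f \<and> differentiable2 g \<and>
     (\<forall>\<xi>\<in>space Dxi. differentiable1 (F \<xi>)) \<and>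
     (\<forall>\<zeta>\<in>space Dzeta. differentiable2 (G \<zeta>)) \<and>
     (\<forall>x y. has_bochner_integral Dxi (\<lambda>\<xi>. F \<xi> x y) (f x y)) \<and>
     (\<forall>x y. has_bochner_integral Dzeta (\<lambda>\<zeta>. G \<zeta> x y) (g x y)) \<and>
     (\<forall>x y. has_bochner_integral Dxi (\<lambda>\<xi>. grad_joint (F \<xi>) x y) (grad_joint f x y)) \<and>
     (\<forall>x y. has_bochner_integral Dzeta (\<lambda>\<zeta>. grad_joint (G \<zeta>) x y) (grad_joint g x y)) \<and>
     (\<forall>x y. has_bochner_integral Dzeta (\<lambda>\<zeta>. hess (G \<zeta>) x y) (hess g x y))"

text \<open>Expectations of nonnegative quantities are taken in \<^typ>\<open>ennreal\<close>, so that a bound on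
  one includes its finiteness.\<close>

definition mean_norm :: "'w measure \<Rightarrow> ('w \<Rightarrow> 'a::real_normed_vector) \<Rightarrow> ennreal" where
  "mean_norm M X = (\<integral>\<^sup>+\<omega>. ennreal (norm (X \<omega>)) \<partial>M)"

definition mean_sq :: "'w measure \<Rightarrow> ('w \<Rightarrow> 'a::real_normed_vector) \<Rightarrow> ennreal" where
  "mean_sq M X = (\<integral>\<^sup>+\<omega>. ennreal ((norm (X \<omega>))\<^sup>2) \<partial>M)"

definition variance_assumption ::
    "(real^'m \<Rightarrow> real^'n \<Rightarrow> real) \<Rightarrow> (real^'m \<Rightarrow> real^'n \<Rightarrow> real) \<Rightarrow>
     ('xi \<Rightarrow> real^'m \<Rightarrow> real^'n \<Rightarrow> real) \<Rightarrow> ('zeta \<Rightarrow> real^'m \<Rightarrow> real^'n \<Rightarrow> real) \<Rightarrow>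
     'xi measure \<Rightarrow> 'zeta measure \<Rightarrow> real \<Rightarrow> real \<Rightarrow> real \<Rightarrow> bool" where
  "variance_assumption f g F G Dxi Dzeta \<sigma>f1 \<sigma>g1 \<sigma>g2 \<longleftrightarrow>
     0 < \<sigma>f1 \<and> 0 < \<sigma>g1 \<and> 0 < \<sigma>g2 \<and>
     (\<forall>x y. mean_sq Dxi (\<lambda>\<xi>. grad_joint (F \<xi>) x y - grad_joint f x y) \<le> ennreal (\<sigma>f1\<^sup>2)) \<and>
     (\<forall>x y. mean_sq Dzeta (\<lambda>\<zeta>. grad_joint (G \<zeta>) x y - grad_joint g x y) \<le> ennreal (\<sigma>g1\<^sup>2)) \<and>
     (\<forall>x y. mean_sq Dzeta (\<lambda>\<zeta>. hess (G \<zeta>) x y - hess g x y) \<le> ennreal (\<sigma>g2\<^sup>2))"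

section \<open>The algorithm NSBO-SGD\<close>

text \<open>The inner iterations are numbered by \<open>s = t + 1 = 0, \<dots>, T\<close>; thus \<open>B1_inner s k\<close> is the
  batch drawn in inner iteration \<open>t = s - 1\<close> of outer iteration \<open>k\<close>.\<close>

datatype batch = B1_inner nat nat | B1 nat | B2 nat | B3 nat | B4 nat

definition batch_avg :: "nat \<Rightarrow> (nat \<Rightarrow> 'a::real_vector) \<Rightarrow> 'a" where
  "batch_avg n h = (1 / real n) *\<^sub>R (\<Sum>i<n. h i)"

text \<open>\<open>inner_iter \<gamma> H d s\<close> is the vector with index \<open>t = s - 1\<close>; the output \<open>v\<^sup>T\<close> has \<open>s = Suc T\<close>.\<close>

primrec inner_iter :: "real \<Rightarrow> (nat \<Rightarrow> real^'n^'n) \<Rightarrow> real^'n \<Rightarrow> nat \<Rightarrow> real^'n" where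
  "inner_iter \<gamma> H d 0 = 0"
| "inner_iter \<gamma> H d (Suc s) = (mat 1 - \<gamma> *\<^sub>R H s) *v inner_iter \<gamma> H d s + \<gamma> *\<^sub>R d"

text \<open>One outer iteration on realized samples: \<open>b\<close> gives the batch sizes, \<open>\<xi> k i\<close> is the
  \<open>i\<close>-th sample of the batch \<open>B3 k\<close> and \<open>\<zeta> B i\<close> the \<open>i\<close>-th sample of any other batch \<open>B\<close>.\<close>

definition nsbo_step ::
    "('xi \<Rightarrow> real^'m \<Rightarrow> real^'n \<Rightarrow> real) \<Rightarrow> ('zeta \<Rightarrow> real^'m \<Rightarrow> real^'n \<Rightarrow> real) \<Rightarrow>
     real \<Rightarrow> real \<Rightarrow> nat \<Rightarrow> (batch \<Rightarrow> nat) \<Rightarrow>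
     (nat \<Rightarrow> nat \<Rightarrow> 'xi) \<Rightarrow> (batch \<Rightarrow> nat \<Rightarrow> 'zeta) \<Rightarrow> nat \<Rightarrow>
     (real^'m) \<times> (real^'n) \<times> (real^'n) \<Rightarrow> (real^'m) \<times> (real^'n) \<times> (real^'n)" where
  "nsbo_step F G \<alpha> \<gamma> T b \<xi> \<zeta> k = (\<lambda>(x, y, u).
     let Dy = batch_avg (b (B2 k)) (\<lambda>i. grad2 (G (\<zeta> (B2 k) i)) x y);
         Du = batch_avg (b (B1 k)) (\<lambda>i. hess22 (G (\<zeta> (B1 k) i)) x y) *v u
              - batch_avg (b (B3 k)) (\<lambda>i. grad2 (F (\<xi> k i)) x y);
         Dx = batch_avg (b (B3 k)) (\<lambda>i. grad1 (F (\<xi> k i)) x y)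
              - batch_avg (b (B4 k)) (\<lambda>i. hess12 (G (\<zeta> (B4 k) i)) x y) *v u;
         H = (\<lambda>s. batch_avg (b (B1_inner s k)) (\<lambda>i. hess22 (G (\<zeta> (B1_inner s k) i)) x y))
     in (x - \<alpha> *\<^sub>R Dx,
         y - inner_iter \<gamma> H Dy (Suc T),
         u - inner_iter \<gamma> H Du (Suc T)))"

primrec nsbo_sgd ::
    "('xi \<Rightarrow> real^'m \<Rightarrow> real^'n \<Rightarrow> real) \<Rightarrow> ('zeta \<Rightarrow> real^'m \<Rightarrow> real^'n \<Rightarrow> real) \<Rightarrow>
     (nat \<Rightarrow> real) \<Rightarrow> (nat \<Rightarrow> real) \<Rightarrow> nat \<Rightarrow> (batch \<Rightarrow> nat) \<Rightarrow>
     (nat \<Rightarrow> nat \<Rightarrow> 'xi) \<Rightarrow> (batch \<Rightarrow> nat \<Rightarrow> 'zeta) \<Rightarrow>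
     (real^'m) \<times> (real^'n) \<times> (real^'n) \<Rightarrow> nat \<Rightarrow> (real^'m) \<times> (real^'n) \<times> (real^'n)" where
  "nsbo_sgd F G \<alpha> \<gamma> T b \<xi> \<zeta> z0 0 = z0"
| "nsbo_sgd F G \<alpha> \<gamma> T b \<xi> \<zeta> z0 (Suc k) =
     nsbo_step F G (\<alpha> k) (\<gamma> k) T b \<xi> \<zeta> k (nsbo_sgd F G \<alpha> \<gamma> T b \<xi> \<zeta> z0 k)"

text \<open>Independence is that of \<^const>\<open>prob_space.indep_vars\<close>, written with the generated
  events because the initial iterate, the \<open>\<xi>\<close>-samples and the \<open>\<zeta>\<close>-samples have different types.\<close>

datatype source = Init | Sample batch nat

primrec source_events ::
    "'w measure \<Rightarrow> 'xi measure \<Rightarrow> 'zeta measure \<Rightarrow>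
     ('w \<Rightarrow> (real^'m) \<times> (real^'n) \<times> (real^'n)) \<Rightarrow>
     (nat \<Rightarrow> nat \<Rightarrow> 'w \<Rightarrow> 'xi) \<Rightarrow> (batch \<Rightarrow> nat \<Rightarrow> 'w \<Rightarrow> 'zeta) \<Rightarrow> source \<Rightarrow> 'w set set" where
  "source_events M Dxi Dzeta Z0 \<xi> \<zeta> Init = {Z0 -` A \<inter> space M |A. A \<in> sets borel}"
| "source_events M Dxi Dzeta Z0 \<xi> \<zeta> (Sample B i) =
     (case B of
        B3 k \<Rightarrow> {\<xi> k i -` A \<inter> space M |A. A \<in> sets Dxi}
      | _ \<Rightarrow> {\<zeta> B i -` A \<inter> space M |A. A \<in> sets Dzeta})"

definition zeta_batches :: "nat \<Rightarrow> nat \<Rightarrow> batch set" where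
  "zeta_batches K T =
     {B1_inner s k |s k. s \<le> T \<and> k < K} \<union> B1 ` {..<K} \<union> B2 ` {..<K} \<union> B4 ` {..<K}"

definition xi_batches :: "nat \<Rightarrow> batch set" where
  "xi_batches K = B3 ` {..<K}"

definition sources :: "nat \<Rightarrow> nat \<Rightarrow> (batch \<Rightarrow> nat) \<Rightarrow> source set" where
  "sources K T b = insert Init {Sample B i |B i. B \<in> zeta_batches K T \<union> xi_batches K \<and> i < b B}"

definition fresh_samples ::
    "'w measure \<Rightarrow> 'xi measure \<Rightarrow> 'zeta measure \<Rightarrow>
     ('w \<Rightarrow> (real^'m) \<times> (real^'n) \<times> (real^'n)) \<Rightarrow> nat \<Rightarrow> nat \<Rightarrow> (batch \<Rightarrow> nat) \<Rightarrow>
     (nat \<Rightarrow> nat \<Rightarrow> 'w \<Rightarrow> 'xi) \<Rightarrow> (batch \<Rightarrow> nat \<Rightarrow> 'w \<Rightarrow> 'zeta) \<Rightarrow> bool" where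
  "fresh_samples M Dxi Dzeta Z0 K T b \<xi> \<zeta> \<longleftrightarrow>
     (\<forall>k<K. \<forall>i<b (B3 k). \<xi> k i \<in> measurable M Dxi \<and> distr M Dxi (\<xi> k i) = Dxi) \<and>
     (\<forall>B\<in>zeta_batches K T. \<forall>i<b B. \<zeta> B i \<in> measurable M Dzeta \<and> distr M Dzeta (\<zeta> B i) = Dzeta) \<and>
     prob_space.indep_sets M (source_events M Dxi Dzeta Z0 \<xi> \<zeta>) (sources K T b)"

text \<open>\<open>X k\<close>, \<open>Y k\<close>, \<open>U k\<close> are the random iterates of a run with \<open>K\<close> outer iterations.\<close>

definition nsbo_run ::
    "'w measure \<Rightarrow> 'xi measure \<Rightarrow> 'zeta measure \<Rightarrow>
     ('xi \<Rightarrow> real^'m \<Rightarrow> real^'n \<Rightarrow> real) \<Rightarrow> ('zeta \<Rightarrow> real^'m \<Rightarrow> real^'n \<Rightarrow> real) \<Rightarrow>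
     ('w \<Rightarrow> real^'m) \<Rightarrow> ('w \<Rightarrow> real^'n) \<Rightarrow> ('w \<Rightarrow> real^'n) \<Rightarrow>
     (nat \<Rightarrow> real) \<Rightarrow> (nat \<Rightarrow> real) \<Rightarrow> nat \<Rightarrow> nat \<Rightarrow> (batch \<Rightarrow> nat) \<Rightarrow>
     (nat \<Rightarrow> 'w \<Rightarrow> real^'m) \<Rightarrow> (nat \<Rightarrow> 'w \<Rightarrow> real^'n) \<Rightarrow> (nat \<Rightarrow> 'w \<Rightarrow> real^'n) \<Rightarrow> bool" where
  "nsbo_run M Dxi Dzeta F G x0 y0 u0 \<alpha> \<gamma> K T b X Y U \<longleftrightarrow>
     (\<exists>\<xi> \<zeta>. fresh_samples M Dxi Dzeta (\<lambda>\<omega>. (x0 \<omega>, y0 \<omega>, u0 \<omega>)) K T b \<xi> \<zeta> \<and>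
       (\<forall>k\<le>K. \<forall>\<omega>\<in>space M. (X k \<omega>, Y k \<omega>, U k \<omega>) =
          nsbo_sgd F G \<alpha> \<gamma> T b (\<lambda>k i. \<xi> k i \<omega>) (\<lambda>B i. \<zeta> B i \<omega>) (x0 \<omega>, y0 \<omega>, u0 \<omega>) k))"

definition moment_assumption ::
    "'w measure \<Rightarrow> (real^'m \<Rightarrow> real^'n \<Rightarrow> real) \<Rightarrow> real \<Rightarrow> nat \<Rightarrow>
     (nat \<Rightarrow> 'w \<Rightarrow> real^'m) \<Rightarrow> (nat \<Rightarrow> 'w \<Rightarrow> real^'n) \<Rightarrow> bool" where
  "moment_assumption M g r K X Y \<longleftrightarrow> 1 \<le> r \<and>
     (\<forall>k\<le>K. mean_sq M (\<lambda>\<omega>. Y k \<omega> - ystar g (X k \<omega>))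
            \<le> ennreal r * (mean_norm M (\<lambda>\<omega>. Y k \<omega> - ystar g (X k \<omega>)))\<^sup>2)"

definition initial_iterate ::
    "'w measure \<Rightarrow> (real^'m \<Rightarrow> real^'n \<Rightarrow> real) \<Rightarrow> (real^'m \<Rightarrow> real^'n \<Rightarrow> real) \<Rightarrow>
     ('w \<Rightarrow> real^'m) \<Rightarrow> ('w \<Rightarrow> real^'n) \<Rightarrow> ('w \<Rightarrow> real^'n) \<Rightarrow>
     real \<Rightarrow> real \<Rightarrow> real \<Rightarrow> real \<Rightarrow> real \<Rightarrow> bool" where
  "initial_iterate M f g x0 y0 u0 \<mu> Lf0 Lf1 Lg2 r \<longleftrightarrow>
     x0 \<in> borel_measurable M \<and> y0 \<in> borel_measurable M \<and> u0 \<in> borel_measurable M \<and>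
     mean_sq M (\<lambda>\<omega>. y0 \<omega> - ystar g (x0 \<omega>))
       \<le> ennreal (min (\<mu>\<^sup>2 / (20 * r * Lg2\<^sup>2)) (1 / (4 * L1_const Lf0 Lf1 Lg2 \<mu>))) \<and>
     mean_sq M (\<lambda>\<omega>. u0 \<omega> - ustar f g (x0 \<omega>))
       \<le> ennreal (min (4 * (L1_const Lf0 Lf1 Lg2 \<mu>)\<^sup>2 / (5 * r * Lg2\<^sup>2))
                      (L1_const Lf0 Lf1 Lg2 \<mu> / \<mu>\<^sup>2))"

definition initial_gap_le ::
    "'w measure \<Rightarrow> (real^'m \<Rightarrow> real^'n \<Rightarrow> real) \<Rightarrow> (real^'m \<Rightarrow> real^'n \<Rightarrow> real) \<Rightarrow>
     ('w \<Rightarrow> real^'m) \<Rightarrow> real \<Rightarrow> bool" where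
  "initial_gap_le M f g x0 \<Delta> \<longleftrightarrow>
     bdd_below (range (Phi f g)) \<and> integrable M (\<lambda>\<omega>. Phi f g (x0 \<omega>)) \<and>
     (\<integral>\<omega>. Phi f g (x0 \<omega>) \<partial>M) - Phi_opt f g \<le> \<Delta>"

definition batch_sizes_ge ::
    "real \<Rightarrow> real \<Rightarrow> real \<Rightarrow> real \<Rightarrow> real \<Rightarrow> real \<Rightarrow> nat \<Rightarrow> nat \<Rightarrow> (batch \<Rightarrow> nat) \<Rightarrow> bool" where
  "batch_sizes_ge c0 c1 c2 c3 c4 \<kappa> K T b \<longleftrightarrow>
     (\<forall>k<K. (\<forall>s\<le>T. c0 * \<kappa>^2 \<le> real (b (B1_inner s k))) \<and>
       c1 * (\<kappa> * real K + \<kappa>^2) \<le> real (b (B1 k)) \<and>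
       c2 * (\<kappa>^3 * real K + \<kappa>^4) \<le> real (b (B2 k)) \<and>
       c3 * (real K / \<kappa>) \<le> real (b (B3 k)) \<and>
       c4 * (real K / \<kappa>) \<le> real (b (B4 k)))"

section \<open>Complexity counts\<close>

text \<open>\<open>D\<^sub>u\<close> and \<open>D\<^sub>x\<close> use the two components of one sample gradient of \<open>F\<close> at the same point,
  which is counted once. Every inner iteration multiplies the sample Hessians both by \<open>v\<close> and
  by \<open>w\<close>.\<close>

definition grad_complexity_F :: "nat \<Rightarrow> (batch \<Rightarrow> nat) \<Rightarrow> nat" where
  "grad_complexity_F K b = (\<Sum>k<K. b (B3 k))"

definition grad_complexity_G :: "nat \<Rightarrow> (batch \<Rightarrow> nat) \<Rightarrow> nat" where
  "grad_complexity_G K b = (\<Sum>k<K. b (B2 k))"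

definition jacobian_vector_complexity :: "nat \<Rightarrow> (batch \<Rightarrow> nat) \<Rightarrow> nat" where
  "jacobian_vector_complexity K b = (\<Sum>k<K. b (B4 k))"

definition hessian_vector_complexity :: "nat \<Rightarrow> nat \<Rightarrow> (batch \<Rightarrow> nat) \<Rightarrow> nat" where
  "hessian_vector_complexity K T b = (\<Sum>k<K. b (B1 k) + (\<Sum>s\<le>T. 2 * b (B1_inner s k)))"

end

theory Submission
  imports Defs
begin

text \<open>Write \<open>H\<close> for the lower-level Hessian at the current point. The recursion
defining \<open>v\<close> is gradient descent on a quadratic with Hessian \<open>H\<close>, so after \<open>T\<close> of the order of
\<open>\<kappa>\<close> steps \<open>v\<close> is close to \<open>H\<^sup>-\<^sup>1 D\<^sub>y\<close> and \<open>w\<close> is close to \<open>H\<^sup>-\<^sup>1 D\<^sub>u\<close>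
(lemma \<open>mean_sq_inner_iter_error\<close>): each \<open>y\<close>-update is an inexact Newton step for the lower level,
and each \<open>u\<close>-update solves the linear system of the adjoint variable up to the error of \<open>y\<close>. With
\<open>a\<^sub>k = E |y - y\<^sup>*|\<^sup>2\<close>, \<open>b\<^sub>k = E |u - u\<^sup>*|\<^sup>2\<close> and \<open>d\<^sub>k = E |D\<^sub>x|\<^sup>2\<close> this gives, up to constants,

 \<^item> \<open>a\<^sub>k\<^sub>+\<^sub>1 \<le> a\<^sub>k / 8 + 1 / (\<kappa> K) + \<kappa>\<^sup>2 \<alpha>\<^sup>2 d\<^sub>k\<close>,
 \<^item> \<open>b\<^sub>k\<^sub>+\<^sub>1 \<le> b\<^sub>k / 4 + \<kappa>\<^sup>4 a\<^sub>k + \<kappa>\<^sup>3 / K + \<kappa>\<^sup>6 \<alpha>\<^sup>2 d\<^sub>k\<close>,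
 \<^item> \<open>E |D\<^sub>x - \<nabla>\<Phi>|\<^sup>2 \<le> \<kappa>\<^sup>2 a\<^sub>k + b\<^sub>k + \<kappa>\<^sup>3 / K\<close>,

where the terms with \<open>1 / K\<close> are sampling variances and the terms with \<open>d\<^sub>k\<close> come from the motion of
\<open>y\<^sup>*(x)\<close> and \<open>u\<^sup>*(x)\<close> with \<open>x\<close>. Descent on \<open>\<Phi>\<close>, whose gradient has a Lipschitz constant of order
\<open>\<kappa>\<^sup>3\<close>, gives a decrease by \<open>\<alpha>/2 |\<nabla>\<Phi>|\<^sup>2 + \<alpha>/4 |D\<^sub>x|\<^sup>2\<close> at the price \<open>\<alpha>/2 |D\<^sub>x - \<nabla>\<Phi>|\<^sup>2\<close>. For
\<open>\<alpha> = a / \<kappa>\<^sup>3\<close> with a small constant \<open>a\<close> the drift terms are absorbed by the \<open>d\<^sub>k\<close> on the left, and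
summation yields \<open>\<Sum> E |\<nabla>\<Phi>|\<^sup>2 = O(\<kappa>\<^sup>3)\<close>. The complexities follow by multiplying batch sizes with
\<open>K = O(\<kappa>\<^sup>3 / \<epsilon>)\<close>.

Two points need care. A Newton step has the quadratic error \<open>|y - y\<^sup>*|\<^sup>2\<close>, whose square is a fourth moment.
The first moment of the new error, however, only involves the second moment of the old one, and the
moment assumption turns the square of a first moment back into a second moment (\<open>lower_level_step\<close>,
\<open>mY_Suc_le\<close>). Contraction then requires \<open>a\<^sub>k\<close> to stay below the bound of the initial iterate; this
invariant is carried along with a bound of order \<open>\<kappa>\<^sup>2\<close> on \<open>b\<^sub>k\<close> in \<open>scaled_recursion\<close>.

Secondly, the iterates are random, while the estimates of one outer iteration are made for a deterministic
state. Independence allows the passage: the state depends on earlier samples only, so expectations may be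
computed by first integrating over the current samples with the state frozen (\<open>nn_integral_indep_diagonal\<close>,
\<open>freeze_step\<close>). Inside one outer iteration the same device separates each inner Hessian batch from the
vector that it multiplies (\<open>inner_loop_noise\<close>). Freezing requires joint measurability in the sample and the
point, which differentiability of the sample functions provides (\<open>measurable_separately_continuous\<close>).\<close>

section \<open>Self-adjoint operators and symmetric second derivatives\<close>

lemma norm_matrix_vector_mult_le:
  fixes A :: "real^'n^'m"
  shows "norm (A *v x) \<le> norm A * norm x"
proof -
  have "norm (A *v x) = L2_set (\<lambda>i. norm ((A *v x) $ i)) UNIV"
    by (simp add: norm_vec_def)
  also have "\<dots> \<le> L2_set (\<lambda>i. norm (A $ i) * norm x) UNIV"
    by (intro L2_set_mono) (simp_all add: matrix_vector_mul_component Cauchy_Schwarz_ineq2)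
  also have "\<dots> = norm A * norm x"
    by (simp add: norm_vec_def L2_set_left_distrib)
  finally show ?thesis .
qed

text \<open>Polarization writes \<open>4 P x \<bullet> w\<close> as the difference of the quadratic form at \<open>x + w\<close> and at \<open>x - w\<close>.
The second term has a favourable sign, and choosing \<open>w\<close> parallel to \<open>P x\<close> with the length of \<open>x\<close> gives the
bound. This avoids the spectral theorem.\<close>

lemma norm_self_adjoint_le:
  fixes P :: "'a::real_inner \<Rightarrow> 'a"
  assumes lin: "linear P" and sym: "\<And>x y. x \<bullet> P y = P x \<bullet> y"
    and nonneg: "\<And>x. 0 \<le> x \<bullet> P x" and le: "\<And>x. x \<bullet> P x \<le> q * (norm x)\<^sup>2"
  shows "norm (P x) \<le> q * norm x"
proof (cases "P x = 0 \<or> x = 0")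
  case True
  have "0 \<le> q * (norm x)\<^sup>2" using nonneg[of x] le[of x] by linarith
  then have "0 \<le> q * norm x" 
    by (cases "x = 0") (auto simp: zero_le_mult_iff)
  then show ?thesis using True linear_0[OF lin] by auto
next
  case False
  define w where "w = (norm x / norm (P x)) *\<^sub>R P x"
  have nw: "norm w = norm x" using False by (simp add: w_def)
  have "0 \<le> q * (norm x)\<^sup>2" using nonneg[of x] le[of x] by linarith
  then have q0: "0 \<le> q" using False by (simp add: zero_le_mult_iff)
  \<comment> \<open>Polarization identity; the mixed terms agree because \<open>P\<close> is self-adjoint.\<close>
  have "4 * (P x \<bullet> w) = (x + w) \<bullet> P (x + w) - (x - w) \<bullet> P (x - w)"
    using sym[of x w] by (simp add: linear_add[OF lin] linear_diff[OF lin] inner_simps inner_commute)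
  also have "\<dots> \<le> q * (norm (x + w))\<^sup>2" using nonneg[of "x - w"] le[of "x + w"] by linarith
  also have "\<dots> \<le> q * (2 * norm x)\<^sup>2"
    using norm_triangle_ineq[of x w] nw by (intro mult_left_mono power_mono q0) auto
  finally have "P x \<bullet> w \<le> q * (norm x)\<^sup>2" by (simp add: power2_eq_square)
  moreover have "P x \<bullet> w = norm x * norm (P x)"
    using False by (simp add: w_def power2_norm_eq_inner[symmetric] power2_eq_square)
  ultimately have "norm x * norm (P x) \<le> norm x * (q * norm x)"
    by (simp add: power2_eq_square mult_ac)
  then show ?thesis using False by simp
qed

text \<open>Coercivity gives \<open>\<mu> |v| \<le> |A v|\<close>, hence injectivity, which for square matrices is invertibility; the same
inequality at \<open>v = A\<^sup>-\<^sup>1 w\<close> bounds the inverse.\<close>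

lemma coercive_matrix_inv:
  fixes A :: "real^'n^'n"
  assumes mu: "0 < \<mu>" and co: "\<And>v. \<mu> * (norm v)\<^sup>2 \<le> v \<bullet> (A *v v)"
  shows "A *v (matrix_inv A *v w) = w" "matrix_inv A *v (A *v w) = w"
    "norm (matrix_inv A *v w) \<le> norm w / \<mu>"
proof -
  have lower: "\<mu> * norm v \<le> norm (A *v v)" for v
  proof (cases "v = 0")
    case False
    have "\<mu> * (norm v)\<^sup>2 \<le> norm v * norm (A *v v)"
      using co[of v] norm_cauchy_schwarz[of v "A *v v"] by linarith
    then show ?thesis using False by (simp add: power2_eq_square mult_ac)
  qed simp
  have "inj ((*v) A)"
  proof (rule injI)
    fix a b assume "A *v a = A *v b"
    then have "A *v (a - b) = 0" by (simp add: matrix_vector_mult_diff_distrib)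
    then show "a = b" using lower[of "a - b"] mu by (auto simp: mult_le_0_iff)
  qed
  then have inv: "invertible A"
    using invertible_left_inverse matrix_left_invertible_injective by blast
  have ainv: "A ** matrix_inv A = mat 1" "matrix_inv A ** A = mat 1"
    using someI_ex[OF inv[unfolded invertible_def]] unfolding matrix_inv_def by auto
  show 1: "A *v (matrix_inv A *v w) = w" for w
    by (simp add: matrix_vector_mul_assoc ainv)
  show "matrix_inv A *v (A *v w) = w"
    by (simp add: matrix_vector_mul_assoc ainv)
  show "norm (matrix_inv A *v w) \<le> norm w / \<mu>"
    using lower[of "matrix_inv A *v w"] 1 mu by (simp add: field_simps)
qed

lemma GDERIV_unique: "GDERIV h z :> D \<Longrightarrow> GDERIV h z :> E \<Longrightarrow> D = E"
proof -
  assume a: "GDERIV h z :> D" "GDERIV h z :> E"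
  have eq: "(\<lambda>x. x \<bullet> D) = (\<lambda>x. x \<bullet> E)"
    by (rule has_derivative_unique[OF a[unfolded gderiv_def]])
  have "x \<bullet> D = x \<bullet> E" for x using fun_cong[OF eq, of x] .
  then have "(D - E) \<bullet> D = (D - E) \<bullet> E" .
  then have "(D - E) \<bullet> (D - E) = 0" by (simp add: inner_diff_right)
  then show ?thesis by simp
qed

lemma grad_eqI: "GDERIV h z :> D \<Longrightarrow> grad h z = D"
  unfolding grad_def by (rule the_equality, assumption, erule GDERIV_unique, assumption)

lemma GDERIV_grad:
  fixes h :: "'a::euclidean_space \<Rightarrow> real"
  assumes "h differentiable (at z)"
  shows "GDERIV h z :> grad h z"
proof -
  obtain h' where h': "(h has_derivative h') (at z)" using assms by (auto simp: differentiable_def)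
  then interpret bounded_linear h' by (rule has_derivative_bounded_linear)
  have "h' x = x \<bullet> (\<Sum>b\<in>Basis. h' b *\<^sub>R b)" for x
  proof -
    have "h' x = h' (\<Sum>b\<in>Basis. (x \<bullet> b) *\<^sub>R b)" by (simp add: euclidean_representation)
    also have "\<dots> = (\<Sum>b\<in>Basis. (x \<bullet> b) * h' b)" by (simp add: sum scaleR)
    finally show ?thesis by (simp add: inner_sum_right mult_ac)
  qed
  then have "h' = (\<lambda>x. x \<bullet> (\<Sum>b\<in>Basis. h' b *\<^sub>R b))" by blast
  then have "GDERIV h z :> (\<Sum>b\<in>Basis. h' b *\<^sub>R b)"
    unfolding gderiv_def using h' by simp
  then show ?thesis using grad_eqI by fastforce
qed

text \<open>The second difference of \<open>h\<close> over the parallelogram spanned by \<open>s v\<close> and \<open>s w\<close> is symmetric in \<open>v\<close> and \<open>w\<close>.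
The mean value theorem along \<open>v\<close> expresses it by a difference of gradients, and linearizing the gradient at \<open>z\<close>
shows that it equals \<open>s\<^sup>2 (v \<bullet> H w)\<close> up to \<open>o(s\<^sup>2)\<close>.\<close>

lemma second_derivative_symmetric:
  fixes h :: "'a::real_inner \<Rightarrow> real"
  assumes grad: "\<And>z. GDERIV h z :> G z" and der: "(G has_derivative H) (at z)"
  shows "v \<bullet> H w = H v \<bullet> w"
proof -
  interpret H: bounded_linear H using der by (rule has_derivative_bounded_linear)
  define \<Delta> where "\<Delta> s v w = h (z + s *\<^sub>R v + s *\<^sub>R w) - h (z + s *\<^sub>R v) - h (z + s *\<^sub>R w) + h z" for s v w
  define R where "R u = G (z + u) - G z - H u" for u
  have sym: "\<Delta> s v w = \<Delta> s w v" for s v w by (simp add: \<Delta>_def algebra_simps)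
  have small: "\<exists>d>0. \<forall>u. norm u < d \<longrightarrow> norm (R u) \<le> e * norm u" if e0: "0 < e" for e
  proof -
    obtain d where d: "d > 0" "\<forall>y. norm (y - z) < d \<longrightarrow> norm (G y - G z - H (y - z)) \<le> e * norm (y - z)"
      using der[unfolded has_derivative_at_alt, THEN conjunct2, rule_format, OF e0] by auto
    have "norm (R u) \<le> e * norm u" if "norm u < d" for u
      using d(2)[rule_format, of "z + u"] that by (simp add: R_def)
    then show ?thesis using d(1) by blast
  qed
  have main: "\<bar>\<Delta> s v w - s\<^sup>2 * (v \<bullet> H w)\<bar> \<le> 2 * e * s\<^sup>2 * (norm v + norm w)\<^sup>2"
    if s: "0 < s" "s * (norm v + norm w) < d" and e: "0 < e"
      and d: "\<forall>u. norm u < d \<longrightarrow> norm (R u) \<le> e * norm u" for s v w e d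
  proof -
    define \<phi> where "\<phi> t = h (z + t *\<^sub>R (s *\<^sub>R v) + s *\<^sub>R w) - h (z + t *\<^sub>R (s *\<^sub>R v))" for t
    define \<phi>' where "\<phi>' t = s * (v \<bullet> (G (z + t *\<^sub>R (s *\<^sub>R v) + s *\<^sub>R w) - G (z + t *\<^sub>R (s *\<^sub>R v))))" for t
    have "(\<phi> has_real_derivative \<phi>' t) (at t)" for t
    proof -
      have 1: "((\<lambda>t. h (z + t *\<^sub>R (s *\<^sub>R v) + c)) has_derivative (\<lambda>k. (k *\<^sub>R (s *\<^sub>R v)) \<bullet> G (z + t *\<^sub>R (s *\<^sub>R v) + c))) (at t)" for c
        by (rule has_derivative_compose[OF _ grad[unfolded gderiv_def]]) (auto intro!: derivative_eq_intros)
      have "(\<phi> has_derivative (\<lambda>k. \<phi>' t * k)) (at t)"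
        unfolding \<phi>_def
        by (rule has_derivative_eq_rhs[OF has_derivative_diff[OF 1[of "s *\<^sub>R w"] 1[of 0, unfolded add_0_right]]])
           (auto simp: \<phi>'_def fun_eq_iff inner_simps algebra_simps)
      then show ?thesis by (simp add: has_field_derivative_def)
    qed
    then obtain t where t: "0 < t" "t < 1" "\<phi> 1 - \<phi> 0 = \<phi>' t"
      using MVT2[of 0 1 \<phi> \<phi>'] by auto
    let ?a = "t *\<^sub>R (s *\<^sub>R v) + s *\<^sub>R w" and ?b = "t *\<^sub>R (s *\<^sub>R v)"
    have nb: "norm ?b \<le> s * (norm v + norm w)" 
      using t s by (simp add: distrib_left mult_left_le_one_le add_increasing2)
    have na: "norm ?a \<le> s * (norm v + norm w)"
    proof -
      have "norm ?a \<le> t * (s * norm v) + s * norm w" using norm_triangle_ineq[of ?b "s *\<^sub>R w"] s t by simp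
      also have "\<dots> \<le> s * norm v + s * norm w" using t s by (simp add: mult_left_le_one_le)
      finally show ?thesis by (simp add: distrib_left)
    qed
    have "G (z + ?a) - G (z + ?b) = s *\<^sub>R H w + (R ?a - R ?b)"
      by (simp add: R_def H.add H.scaleR)
    then have "\<phi>' t = s * (v \<bullet> (s *\<^sub>R H w + (R ?a - R ?b)))"
      by (simp add: \<phi>'_def add.assoc)
    then have "\<Delta> s v w - s\<^sup>2 * (v \<bullet> H w) = s * (v \<bullet> (R ?a - R ?b))"
      using t(3) by (simp add: \<phi>_def \<Delta>_def inner_simps algebra_simps power2_eq_square)
    moreover have "\<bar>v \<bullet> (R ?a - R ?b)\<bar> \<le> norm v * (2 * e * (s * (norm v + norm w)))"
    proof -
      have "norm (R ?a) \<le> e * (s * (norm v + norm w))" 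
        using d[rule_format, of ?a] na s e mult_left_mono[OF na, of e] by linarith
      moreover have "norm (R ?b) \<le> e * (s * (norm v + norm w))" 
        using d[rule_format, of ?b] nb s e mult_left_mono[OF nb, of e] by linarith
      ultimately have "norm (R ?a - R ?b) \<le> 2 * e * (s * (norm v + norm w))"
        using norm_triangle_ineq4[of "R ?a" "R ?b"] by linarith
      then show ?thesis using Cauchy_Schwarz_ineq2[of v "R ?a - R ?b"]
        by (meson mult_left_mono norm_ge_zero order_trans)
    qed
    ultimately have "\<bar>\<Delta> s v w - s\<^sup>2 * (v \<bullet> H w)\<bar> \<le> s * (norm v * (2 * e * (s * (norm v + norm w))))"
      using s by (simp add: abs_mult)
    also have "\<dots> \<le> s * ((norm v + norm w) * (2 * e * (s * (norm v + norm w))))"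
      using s e by (intro mult_left_mono mult_right_mono) auto
    finally show ?thesis by (simp add: power2_eq_square mult_ac)
  qed
  have "\<bar>v \<bullet> H w - w \<bullet> H v\<bar> \<le> e" if "0 < e" for e
  proof -
    define N where "N = norm v + norm w"
    \<comment> \<open>Chosen so that the two remainders \<open>2 e' s\<^sup>2 N\<^sup>2\<close> add up to at most \<open>e s\<^sup>2\<close>.\<close>
    define e' where "e' = e / (4 * (N\<^sup>2 + 1))"
    have e': "0 < e'" using that unfolding e'_def by (intro divide_pos_pos mult_pos_pos add_nonneg_pos) auto
    obtain d where d: "d > 0" "\<forall>u. norm u < d \<longrightarrow> norm (R u) \<le> e' * norm u" using small[OF e'] by blast
    define s where "s = d / (N + 1)"
    have N: "0 \<le> N" by (simp add: N_def)
    have s: "0 < s" "s * N < d" using d(1) N by (auto simp: s_def field_simps)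
    have 1: "\<bar>\<Delta> s v w - s\<^sup>2 * (v \<bullet> H w)\<bar> \<le> 2 * e' * s\<^sup>2 * N\<^sup>2"
      using main[OF s(1) _ e' d(2)] s(2) by (simp add: N_def)
    have 2: "\<bar>\<Delta> s w v - s\<^sup>2 * (w \<bullet> H v)\<bar> \<le> 2 * e' * s\<^sup>2 * N\<^sup>2"
      using main[OF s(1) _ e' d(2), of w v] s(2) by (simp add: N_def add.commute)
    have "\<bar>s\<^sup>2 * (v \<bullet> H w) - s\<^sup>2 * (w \<bullet> H v)\<bar> \<le> 4 * e' * s\<^sup>2 * N\<^sup>2"
      using 1 2 sym[of s v w] by linarith
    then have "s\<^sup>2 * \<bar>v \<bullet> H w - w \<bullet> H v\<bar> \<le> s\<^sup>2 * (4 * e' * N\<^sup>2)"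
      by (simp only: right_diff_distrib[symmetric] abs_mult) (simp add: mult_ac)
    then have "\<bar>v \<bullet> H w - w \<bullet> H v\<bar> \<le> 4 * e' * N\<^sup>2" using s(1) by simp
    also have "\<dots> \<le> 4 * e' * (N\<^sup>2 + 1)" using e' by (intro mult_left_mono) auto
    also have "\<dots> = e" 
    proof -
      have "4 * N\<^sup>2 + 4 \<noteq> 0" using zero_le_power2[of N] by linarith
      then show ?thesis by (simp add: e'_def field_simps)
    qed
    finally show ?thesis .
  qed
  then have "v \<bullet> H w = w \<bullet> H v" using field_le_epsilon[of "\<bar>v \<bullet> H w - w \<bullet> H v\<bar>" 0] by fastforce
  then show ?thesis by (simp add: inner_commute)
qed

section \<open>Gradients and Hessian blocks\<close>

lemma GDERIV_joint:
  "differentiable1 h \<Longrightarrow> GDERIV (\<lambda>z. h (fst z) (snd z)) z :> grad_joint h (fst z) (snd z)"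
  unfolding grad_joint_def differentiable1_def using GDERIV_grad by fastforce

lemma GDERIV_fst:
  assumes "differentiable1 h"
  shows "GDERIV (\<lambda>x. h x y) x :> fst (grad_joint h x y)"
proof -
  have "((\<lambda>x. h (fst (x, y)) (snd (x, y))) has_derivative (\<lambda>d. (d, 0) \<bullet> grad_joint h x y)) (at x)"
    by (rule has_derivative_compose[of "\<lambda>x. (x, y)" "\<lambda>d. (d, 0)", OF _ GDERIV_joint[OF assms, of "(x, y)", unfolded gderiv_def fst_conv snd_conv]])
       (auto intro!: derivative_eq_intros)
  then show ?thesis by (simp add: gderiv_def inner_prod_def)
qed

lemma GDERIV_snd:
  assumes "differentiable1 h"
  shows "GDERIV (\<lambda>y. h x y) y :> snd (grad_joint h x y)"
proof -
  have "((\<lambda>y. h (fst (x, y)) (snd (x, y))) has_derivative (\<lambda>d. (0, d) \<bullet> grad_joint h x y)) (at y)"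
    by (rule has_derivative_compose[of "\<lambda>y. (x, y)" "\<lambda>d. (0, d)", OF _ GDERIV_joint[OF assms, of "(x, y)", unfolded gderiv_def fst_conv snd_conv]])
       (auto intro!: derivative_eq_intros)
  then show ?thesis by (simp add: gderiv_def inner_prod_def)
qed

lemma grad1_eq: "differentiable1 h \<Longrightarrow> grad1 h x y = fst (grad_joint h x y)"
  unfolding grad1_def by (rule grad_eqI[OF GDERIV_fst])

lemma grad2_eq: "differentiable1 h \<Longrightarrow> grad2 h x y = snd (grad_joint h x y)"
  unfolding grad2_def by (rule grad_eqI[OF GDERIV_snd])

lemma jacobian_eqI:
  fixes F :: "real^'n \<Rightarrow> real^'m"
  assumes "(F has_derivative F') (at x)"
  shows "jacobian F (at x) *v v = F' v"
proof -
  have "F differentiable (at x)" using assms by (auto simp: differentiable_def)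
  then have "(F has_derivative (\<lambda>h. jacobian F (at x) *v h)) (at x)" by (simp add: jacobian_works)
  from has_derivative_unique[OF this assms] show ?thesis by (rule fun_cong)
qed

text \<open>The Jacobians of the partial gradients are the blocks of the derivative of the joint gradient: restrict that
derivative to the two coordinate subspaces.\<close>

lemma grad_joint_has_derivative:
  assumes "differentiable2 h"
  shows "((\<lambda>z. grad_joint h (fst z) (snd z)) has_derivative
    (\<lambda>d. (hess11 h x y *v fst d + hess12 h x y *v snd d, hess21 h x y *v fst d + hess22 h x y *v snd d)))
    (at (x, y))"
proof -
  have d1: "differentiable1 h" using assms by (simp add: differentiable2_def)
  obtain D where D: "((\<lambda>z. grad_joint h (fst z) (snd z)) has_derivative D) (at (x, y))"
    using assms unfolding differentiable2_def differentiable_def by blast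
  then interpret D: bounded_linear D by (rule has_derivative_bounded_linear)
  have dx: "((\<lambda>x. grad_joint h (fst (x, y)) (snd (x, y))) has_derivative (\<lambda>d. D (d, 0))) (at x)"
    by (rule has_derivative_compose[of "\<lambda>x. (x, y)", OF _ D]) (auto intro!: derivative_eq_intros)
  have dy: "((\<lambda>y. grad_joint h (fst (x, y)) (snd (x, y))) has_derivative (\<lambda>d. D (0, d))) (at y)"
    by (rule has_derivative_compose[of "\<lambda>y. (x, y)", OF _ D]) (auto intro!: derivative_eq_intros)
  have h11: "hess11 h x y *v a = fst (D (a, 0))" for a
    unfolding hess11_def grad1_eq[OF d1]
    using jacobian_eqI[OF has_derivative_fst[OF dx]] by simp
  have h12: "hess12 h x y *v b = fst (D (0, b))" for b
    unfolding hess12_def grad1_eq[OF d1]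
    using jacobian_eqI[OF has_derivative_fst[OF dy]] by simp
  have h21: "hess21 h x y *v a = snd (D (a, 0))" for a
    unfolding hess21_def grad2_eq[OF d1]
    using jacobian_eqI[OF has_derivative_snd[OF dx]] by simp
  have h22: "hess22 h x y *v b = snd (D (0, b))" for b
    unfolding hess22_def grad2_eq[OF d1]
    using jacobian_eqI[OF has_derivative_snd[OF dy]] by simp
  have "D d = (hess11 h x y *v fst d + hess12 h x y *v snd d, hess21 h x y *v fst d + hess22 h x y *v snd d)" for d
  proof -
    have "D d = D ((fst d, 0) + (0, snd d))" by simp
    also have "\<dots> = D (fst d, 0) + D (0, snd d)" by (rule D.add)
    finally show ?thesis by (simp add: prod_eq_iff h11 h12 h21 h22)
  qed
  then have "D = (\<lambda>d. (hess11 h x y *v fst d + hess12 h x y *v snd d, hess21 h x y *v fst d + hess22 h x y *v snd d))"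
    by blast
  then show ?thesis using D by simp
qed

lemma
  assumes "differentiable2 h"
  shows hess22_symmetric: "v \<bullet> (hess22 h x y *v w) = (hess22 h x y *v v) \<bullet> w"
    and hess12_transpose: "a \<bullet> (hess12 h x y *v b) = (hess21 h x y *v a) \<bullet> b"
proof -
  have d1: "differentiable1 h" using assms by (simp add: differentiable2_def)
  note sym = second_derivative_symmetric[OF GDERIV_joint[OF d1] grad_joint_has_derivative[OF assms]]
  show "v \<bullet> (hess22 h x y *v w) = (hess22 h x y *v v) \<bullet> w"
    using sym[of "(0, v)" x y "(0, w)"] by (simp add: inner_prod_def)
  show "a \<bullet> (hess12 h x y *v b) = (hess21 h x y *v a) \<bullet> b"
    using sym[of "(a, 0)" x y "(0, b)"] by (simp add: inner_prod_def)
qed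

lemma lipschitz_derivative_bound:
  assumes der: "(F has_derivative F') (at z)"
    and lip: "\<And>z'. norm (F z' - F z) \<le> L * norm (z' - z)"
  shows "norm (F' v) \<le> L * norm v"
proof (rule field_le_epsilon)
  fix e :: real assume e: "0 < e"
  interpret F': bounded_linear F' using der by (rule has_derivative_bounded_linear)
  define e' where "e' = e / (norm v + 1)"
  have nv: "0 < norm v + 1" by (simp add: add_nonneg_pos)
  have e': "0 < e'" using e nv by (simp add: e'_def)
  obtain d where d: "d > 0" "\<forall>y. norm (y - z) < d \<longrightarrow> norm (F y - F z - F' (y - z)) \<le> e' * norm (y - z)"
    using der[unfolded has_derivative_at_alt, THEN conjunct2, rule_format, OF e'] by auto
  define s where "s = d / (2 * (norm v + 1))"
  have s: "0 < s" using d nv by (simp add: s_def)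
  have "s * (norm v + 1) = d / 2" using nv by (simp add: s_def field_simps)
  then have "s * norm v < d" using s d(1) by (simp add: distrib_left)
  then have "norm (F (z + s *\<^sub>R v) - F z - F' (s *\<^sub>R v)) \<le> e' * (s * norm v)"
    using d(2)[rule_format, of "z + s *\<^sub>R v"] s by simp
  moreover have "norm (F (z + s *\<^sub>R v) - F z) \<le> L * (s * norm v)"
    using lip[of "z + s *\<^sub>R v"] s by simp
  ultimately have "norm (F' (s *\<^sub>R v)) \<le> (L + e') * (s * norm v)"
    using norm_triangle_ineq4[of "F (z + s *\<^sub>R v) - F z" "F (z + s *\<^sub>R v) - F z - F' (s *\<^sub>R v)"]
    by (simp add: distrib_right)
  then have "s * norm (F' v) \<le> s * ((L + e') * norm v)" using s by (simp add: F'.scaleR mult_ac)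
  then have "norm (F' v) \<le> L * norm v + e' * norm v" using s by (simp add: distrib_right)
  also have "e' * norm v \<le> e' * (norm v + 1)" using e' by simp
  also have "\<dots> = e" using nv by (simp add: e'_def)
  finally show "norm (F' v) \<le> L * norm v + e" by simp
qed

section \<open>Strong convexity\<close>

text \<open>Divide the convexity inequality between \<open>y\<close> and \<open>y + t (z - y)\<close> by \<open>t\<close> and let \<open>t\<close> tend to \<open>0\<close>.\<close>

lemma strongly_convex_first_order:
  assumes sc: "strongly_convex \<mu> h" and D: "GDERIV h y :> D"
  shows "h y + (z - y) \<bullet> D + \<mu> / 2 * (norm (z - y))\<^sup>2 \<le> h z"
proof -
  let ?d = "z - y"
  have "((\<lambda>t. h (y + t *\<^sub>R ?d)) has_derivative (\<lambda>k. (k *\<^sub>R ?d) \<bullet> D)) (at 0)"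
    using D unfolding gderiv_def
    by (intro has_derivative_compose[of "\<lambda>t. y + t *\<^sub>R ?d" _ 0 _ h]) (auto intro!: derivative_eq_intros)
  then have "((\<lambda>t. h (y + t *\<^sub>R ?d)) has_real_derivative (?d \<bullet> D)) (at 0)"
    by (simp add: has_field_derivative_def mult.commute[of _ "?d \<bullet> D"])
  then have lim: "((\<lambda>t. (h (y + t *\<^sub>R ?d) - h y) / t) \<longlongrightarrow> ?d \<bullet> D) (at_right 0)"
    by (auto simp: has_field_derivative_iff intro: tendsto_within_subset)
  have lim2: "((\<lambda>t. h z - h y - \<mu> / 2 * (1 - t) * (norm ?d)\<^sup>2) \<longlongrightarrow> h z - h y - \<mu> / 2 * (1 - 0) * (norm ?d)\<^sup>2) (at_right 0)"
    by (intro tendsto_intros)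
  have ev: "\<forall>\<^sub>F t in at_right (0::real). (h (y + t *\<^sub>R ?d) - h y) / t \<le> h z - h y - \<mu> / 2 * (1 - t) * (norm ?d)\<^sup>2"
    unfolding eventually_at_right_field
  proof (intro exI[of _ 1] conjI allI impI)
    fix t :: real assume t: "0 < t" "t < 1"
    have "y + t *\<^sub>R ?d = t *\<^sub>R z + (1 - t) *\<^sub>R y" by (simp add: algebra_simps)
    then have "h (y + t *\<^sub>R ?d) \<le> t * h z + (1 - t) * h y - \<mu> / 2 * t * (1 - t) * (norm ?d)\<^sup>2"
      using sc[unfolded strongly_convex_def, rule_format, of t z y] t by simp
    then have "h (y + t *\<^sub>R ?d) - h y \<le> (h z - h y - \<mu> / 2 * (1 - t) * (norm ?d)\<^sup>2) * t"
      by (simp add: algebra_simps)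
    then show "(h (y + t *\<^sub>R ?d) - h y) / t \<le> h z - h y - \<mu> / 2 * (1 - t) * (norm ?d)\<^sup>2"
      using t by (simp add: divide_le_eq)
  qed simp
  have "?d \<bullet> D \<le> h z - h y - \<mu> / 2 * (1 - 0) * (norm ?d)\<^sup>2"
    by (rule tendsto_le[OF _ lim2 lim ev]) simp
  then show ?thesis by simp
qed

lemma strongly_convex_monotone:
  assumes sc: "strongly_convex \<mu> h" and D: "GDERIV h y :> D" and E: "GDERIV h z :> E"
  shows "\<mu> * (norm (z - y))\<^sup>2 \<le> (z - y) \<bullet> (E - D)"
  using strongly_convex_first_order[OF sc D, of z] strongly_convex_first_order[OF sc E, of y]
  by (simp add: norm_minus_commute inner_simps)

text \<open>The first-order inequality at \<open>0\<close> shows \<open>h z \<ge> h 0\<close> outside the ball of radius \<open>2 |D 0| / \<mu>\<close>, so a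
minimum over that compact ball is global.\<close>

lemma strongly_convex_attains_min:
  fixes h :: "'a::euclidean_space \<Rightarrow> real"
  assumes sc: "strongly_convex \<mu> h" and mu: "0 < \<mu>" and D: "\<And>y. GDERIV h y :> D y"
  shows "\<exists>y. \<forall>z. h y \<le> h z"
proof -
  define R where "R = 2 * norm (D 0) / \<mu>"
  have "continuous_on UNIV h"
    using D unfolding gderiv_def by (meson has_derivative_continuous_on has_derivative_at_withinI)
  then have "continuous_on (cball 0 R) h" by (rule continuous_on_subset) simp
  moreover have "0 \<le> R" using mu by (simp add: R_def)
  then have "cball (0::'a) R \<noteq> {}" by simp
  ultimately obtain y where y: "\<forall>z\<in>cball 0 R. h y \<le> h z"
    using continuous_attains_inf[OF compact_cball] by blast
  have "h y \<le> h z" for z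
  proof (cases "norm z \<le> R")
    case False
    then have z: "2 * norm (D 0) < \<mu> * norm z" using mu by (simp add: R_def field_simps)
    have "h 0 + z \<bullet> D 0 + \<mu> / 2 * (norm z)\<^sup>2 \<le> h z"
      using strongly_convex_first_order[OF sc D, of 0 z] by simp
    moreover have "- (norm z * norm (D 0)) \<le> z \<bullet> D 0"
      using Cauchy_Schwarz_ineq2[of z "D 0"] by linarith
    moreover have "norm z * norm (D 0) \<le> \<mu> / 2 * (norm z)\<^sup>2"
      using mult_left_mono[OF less_imp_le[OF z], of "norm z / 2"] by (simp add: power2_eq_square mult_ac)
    moreover have "h y \<le> h 0" using y mu by (auto simp: R_def)
    ultimately show ?thesis by linarith
  qed (use y in auto)
  then show ?thesis by blast
qed

text \<open>Mean value inequality for \<open>F (a + t (b - a)) - t F' a (b - a)\<close> on the unit interval.\<close>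

lemma taylor_second_order_bound:
  fixes F :: "'a::real_normed_vector \<Rightarrow> 'b::real_inner"
  assumes der: "\<And>z. (F has_derivative F' z) (at z)"
    and lip: "\<And>z v. norm (F' z v - F' a v) \<le> L * norm (z - a) * norm v" and L: "0 \<le> L"
  shows "norm (F b - F a - F' a (b - a)) \<le> L * (norm (b - a))\<^sup>2"
proof -
  define d where "d = b - a"
  define \<phi> where "\<phi> t = F (a + t *\<^sub>R d) - t *\<^sub>R F' a d" for t :: real
  interpret F': bounded_linear "F' z" for z using der by (rule has_derivative_bounded_linear)
  have "(\<phi> has_derivative (\<lambda>k. F' (a + t *\<^sub>R d) (k *\<^sub>R d) - k *\<^sub>R F' a d)) (at t)" for t
    unfolding \<phi>_def
    by (intro has_derivative_diff has_derivative_compose[of "\<lambda>t. a + t *\<^sub>R d", OF _ der])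
       (auto intro!: derivative_eq_intros)
  then have "(\<phi> has_derivative (\<lambda>k. F' (a + t *\<^sub>R d) (k *\<^sub>R d) - k *\<^sub>R F' a d)) (at t within {0..1})" for t
    by (rule has_derivative_at_withinI)
  moreover have "onorm (\<lambda>k. F' (a + t *\<^sub>R d) (k *\<^sub>R d) - k *\<^sub>R F' a d) \<le> L * (norm d)\<^sup>2"
    if "t \<in> {0..1}" for t
  proof (rule onorm_le)
    fix k :: real
    have "norm (F' (a + t *\<^sub>R d) (k *\<^sub>R d) - k *\<^sub>R F' a d) = \<bar>k\<bar> * norm (F' (a + t *\<^sub>R d) d - F' a d)"
      by (simp add: F'.scaleR flip: scaleR_diff_right)
    also have "\<dots> \<le> \<bar>k\<bar> * (L * norm (t *\<^sub>R d) * norm d)"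
      using lip[of "a + t *\<^sub>R d" d] by (intro mult_left_mono) auto
    also have "\<dots> \<le> \<bar>k\<bar> * (L * norm d * norm d)"
      using that L by (intro mult_left_mono mult_right_mono) (auto simp: mult_left_le_one_le)
    finally show "norm (F' (a + t *\<^sub>R d) (k *\<^sub>R d) - k *\<^sub>R F' a d) \<le> L * (norm d)\<^sup>2 * norm k"
      by (simp add: power2_eq_square mult_ac)
  qed
  ultimately have "norm (\<phi> 1 - \<phi> 0) \<le> L * (norm d)\<^sup>2 * norm (1 - 0 :: real)"
    by (intro differentiable_bound[of "{0..1}" \<phi> "\<lambda>t k. F' (a + t *\<^sub>R d) (k *\<^sub>R d) - k *\<^sub>R F' a d"]) auto
  then show ?thesis by (simp add: \<phi>_def d_def algebra_simps)
qed

section \<open>The deterministic bilevel problem\<close>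

lemma norm_snd_component_le: "norm (snd p) \<le> norm p" and norm_fst_component_le: "norm (fst p) \<le> norm p"
  for p :: "'a::real_normed_vector \<times> 'b::real_normed_vector"
  using norm_snd_le[of "snd p" "fst p"] norm_fst_le[of "fst p" "snd p"] by simp_all

text \<open>Everything about \<open>y\<^sup>*\<close>, \<open>u\<^sup>*\<close> and \<open>\<nabla>\<Phi>\<close> that involves no sampling.\<close>

locale bilevel_problem =
  fixes f g :: "real^'m \<Rightarrow> real^'n \<Rightarrow> real" and \<mu> Lf0 Lf1 Lg1 Lg2 Cf0 :: real
  assumes basic: "basic_assumption f g \<mu> Lf0 Lf1 Lg1 Lg2 Cf0"
    and diff_f: "differentiable1 f" and diff_g: "differentiable2 g"
begin

abbreviation "ys \<equiv> ystar g"
abbreviation "us \<equiv> ustar f g"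
abbreviation "A \<equiv> hess22 g"
abbreviation "L1 \<equiv> L1_const Lf0 Lf1 Lg2 \<mu>"

lemma pos: "0 < \<mu>" "0 < Lf0" "0 < Lf1" "0 < Lg1" "0 < Lg2" "0 < Cf0"
  and convex: "strongly_convex \<mu> (g x)"
  and grad2_f_bound: "norm (grad2 f x (ys x)) \<le> Lf0"
  and grad1_f_bound: "norm (grad1 f x y) \<le> Cf0"
  using basic by (auto simp: basic_assumption_def)

lemma L1_pos: "0 < L1" using pos by (simp add: L1_const_def add_pos_pos)

lemma diff1_g: "differentiable1 g" using diff_g by (simp add: differentiable2_def)

lemma lip:
  "norm (grad_joint g x y - grad_joint g x' y') \<le> Lg1 * norm ((x, y) - (x', y'))"
  "norm (grad_joint f x y - grad_joint f x' y') \<le> Lf1 * norm ((x, y) - (x', y'))"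
  "norm (A x y - A x' y') \<le> Lg2 * norm ((x, y) - (x', y'))"
  "norm (hess12 g x y - hess12 g x' y') \<le> Lg2 * norm ((x, y) - (x', y'))"
  using basic unfolding basic_assumption_def
  by (auto dest!: lipschitz_onD[of _ _ _ "(x, y)" "(x', y')"] simp: dist_norm)

lemma lip_parts:
  "norm (grad1 f x y - grad1 f x' y') \<le> Lf1 * norm ((x, y) - (x', y'))"
  "norm (grad2 f x y - grad2 f x' y') \<le> Lf1 * norm ((x, y) - (x', y'))"
  "norm (grad2 g x y - grad2 g x' y') \<le> Lg1 * norm ((x, y) - (x', y'))"
  using lip(2)[of x y x' y'] lip(1)[of x y x' y']
    norm_fst_component_le[of "grad_joint f x y - grad_joint f x' y'"]
    norm_snd_component_le[of "grad_joint f x y - grad_joint f x' y'"]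
    norm_snd_component_le[of "grad_joint g x y - grad_joint g x' y'"]
  by (simp_all add: grad1_eq[OF diff_f] grad2_eq[OF diff_f] grad2_eq[OF diff1_g])

lemma hess12_bound: "norm (hess12 g x y *v v) \<le> Lg1 * norm v"
  and hess22_bound: "norm (A x y *v v) \<le> Lg1 * norm v"
proof -
  have lipz: "norm (grad_joint g (fst z') (snd z') - grad_joint g (fst (x, y)) (snd (x, y))) \<le> Lg1 * norm (z' - (x, y))" for z'
    using lip(1)[of "fst z'" "snd z'" x y] by simp
  have "norm (hess12 g x y *v v, A x y *v v) \<le> Lg1 * norm (0 :: real^'m, v)"
    using lipschitz_derivative_bound[OF grad_joint_has_derivative[OF diff_g, of x y] lipz, of "(0, v)"] by simp
  then show "norm (hess12 g x y *v v) \<le> Lg1 * norm v" "norm (A x y *v v) \<le> Lg1 * norm v"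
    using norm_fst_component_le[of "(hess12 g x y *v v, A x y *v v)"] norm_snd_component_le[of "(hess12 g x y *v v, A x y *v v)"]
    by simp_all
qed

lemma GDERIV_g_y: "GDERIV (g x) y :> grad2 g x y"
  using GDERIV_snd[OF diff1_g, of x y] by (simp add: grad2_eq[OF diff1_g])

lemma grad2_g_derivative: "(grad2 g x has_derivative (\<lambda>v. A x y *v v)) (at y)"
proof -
  have "((\<lambda>y. grad_joint g (fst (x, y)) (snd (x, y))) has_derivative
      (\<lambda>d. (hess11 g x y *v fst (0, d) + hess12 g x y *v snd (0 :: real^'m, d), hess21 g x y *v fst (0, d) + A x y *v snd (0 :: real^'m, d)))) (at y)"
    by (rule has_derivative_compose[of "\<lambda>y. (x, y)" "\<lambda>d. (0, d)", OF _ grad_joint_has_derivative[OF diff_g, of x y]])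
      (auto intro!: derivative_eq_intros)
  from has_derivative_snd[OF this] show ?thesis
    by (simp add: grad2_eq[OF diff1_g, abs_def])
qed

text \<open>Strong monotonicity of \<open>\<nabla>\<^sub>2 g\<close> between \<open>y\<close> and \<open>y + t v\<close>, divided by \<open>t\<^sup>2\<close>, passes to the limit.\<close>

lemma hess22_coercive: "\<mu> * (norm v)\<^sup>2 \<le> v \<bullet> (A x y *v v)"
proof -
  have "((\<lambda>t. grad2 g x (y + t *\<^sub>R v)) has_derivative (\<lambda>k. A x y *v (k *\<^sub>R v))) (at 0)"
    using grad2_g_derivative[of x y]
    by (intro has_derivative_compose[of "\<lambda>t. y + t *\<^sub>R v" _ 0 _ "grad2 g x"]) (auto intro!: derivative_eq_intros)
  from has_derivative_inner_right[OF this, of v]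
  have "((\<lambda>t. v \<bullet> grad2 g x (y + t *\<^sub>R v)) has_real_derivative (v \<bullet> (A x y *v v))) (at 0)"
    by (simp add: has_field_derivative_def matrix_vector_mult_scaleR mult.commute[of _ "v \<bullet> (A x y *v v)"])
  then have lim: "((\<lambda>t. (v \<bullet> grad2 g x (y + t *\<^sub>R v) - v \<bullet> grad2 g x y) / t) \<longlongrightarrow> v \<bullet> (A x y *v v)) (at_right 0)"
    by (auto simp: has_field_derivative_iff intro: tendsto_within_subset)
  have "\<forall>\<^sub>F t in at_right (0::real). \<mu> * (norm v)\<^sup>2 \<le> (v \<bullet> grad2 g x (y + t *\<^sub>R v) - v \<bullet> grad2 g x y) / t"
    unfolding eventually_at_right_field
  proof (intro exI[of _ 1] conjI allI impI)
    fix t :: real assume t: "0 < t" "t < 1"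
    have "\<mu> * (norm (t *\<^sub>R v))\<^sup>2 \<le> (t *\<^sub>R v) \<bullet> (grad2 g x (y + t *\<^sub>R v) - grad2 g x y)"
      using strongly_convex_monotone[OF convex[of x] GDERIV_g_y[of x y] GDERIV_g_y[of x "y + t *\<^sub>R v"]] by simp
    then have "t * (t * (\<mu> * (norm v)\<^sup>2)) \<le> t * (v \<bullet> (grad2 g x (y + t *\<^sub>R v) - grad2 g x y))"
      using t by (simp add: power2_eq_square mult_ac)
    then have "t * (\<mu> * (norm v)\<^sup>2) \<le> v \<bullet> (grad2 g x (y + t *\<^sub>R v) - grad2 g x y)"
      by (simp only: mult_le_cancel_left_pos[OF t(1)])
    then show "\<mu> * (norm v)\<^sup>2 \<le> (v \<bullet> grad2 g x (y + t *\<^sub>R v) - v \<bullet> grad2 g x y) / t"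
      using t by (simp add: pos_le_divide_eq inner_diff_right mult_ac)
  qed simp
  then show ?thesis by (intro tendsto_lowerbound[OF lim]) auto
qed

lemma hess22_symmetric_g: "v \<bullet> (A x y *v w) = (A x y *v v) \<bullet> w"
  by (rule hess22_symmetric[OF diff_g])

lemmas Ainv = coercive_matrix_inv[OF pos(1) hess22_coercive]

lemma \<mu>_le_Lg1: "\<mu> \<le> Lg1"
proof -
  \<comment> \<open>Any unit vector; the index type is nonempty.\<close>
  let ?v = "axis undefined 1 :: real^'n"
  have "\<mu> * (norm ?v)\<^sup>2 \<le> norm ?v * norm (A 0 0 *v ?v)"
    using hess22_coercive[of ?v 0 0] norm_cauchy_schwarz[of ?v "A 0 0 *v ?v"] by linarith
  then show ?thesis using hess22_bound[of 0 0 ?v] by (simp add: norm_axis_1)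
qed

text \<open>The matrix \<open>I - \<gamma> A\<close> is symmetric with quadratic form between \<open>0\<close> (because \<open>\<gamma> \<le> 1 / L\<^sub>g\<^sub>1\<close>) and
\<open>1 - \<gamma> \<mu>\<close>.\<close>

lemma gradient_step_contraction:
  assumes "0 < \<gamma>" "\<gamma> \<le> 1 / Lg1"
  shows "norm (v - \<gamma> *\<^sub>R (A x y *v v)) \<le> (1 - \<gamma> * \<mu>) * norm v"
proof (rule norm_self_adjoint_le[of "\<lambda>v. v - \<gamma> *\<^sub>R (A x y *v v)"])
  show "linear (\<lambda>v. v - \<gamma> *\<^sub>R (A x y *v v))"
    by (intro linearI) (simp_all add: matrix_vector_right_distrib matrix_vector_mult_scaleR algebra_simps)
  fix v w :: "real^'n"
  show "v \<bullet> (w - \<gamma> *\<^sub>R (A x y *v w)) = (v - \<gamma> *\<^sub>R (A x y *v v)) \<bullet> w"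
    by (simp add: inner_simps hess22_symmetric_g)
  have "v \<bullet> (A x y *v v) \<le> norm v * (Lg1 * norm v)"
    using norm_cauchy_schwarz[of v "A x y *v v"] hess22_bound[of x y v]
    by (meson mult_left_mono norm_ge_zero order_trans)
  then have "\<gamma> * (v \<bullet> (A x y *v v)) \<le> \<gamma> * (norm v * (Lg1 * norm v))"
    using assms by simp
  also have "\<dots> = (\<gamma> * Lg1) * (norm v)\<^sup>2" by (simp add: power2_eq_square)
  also have "\<dots> \<le> 1 * (norm v)\<^sup>2"
    using assms pos by (intro mult_right_mono) (auto simp: field_simps)
  finally show "0 \<le> v \<bullet> (v - \<gamma> *\<^sub>R (A x y *v v))"
    by (simp add: inner_simps power2_norm_eq_inner)
  show "v \<bullet> (v - \<gamma> *\<^sub>R (A x y *v v)) \<le> (1 - \<gamma> * \<mu>) * (norm v)\<^sup>2"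
    using mult_left_mono[OF hess22_coercive[of v x y], of \<gamma>] assms
    by (simp add: inner_simps power2_norm_eq_inner algebra_simps)
qed

lemma ystar_min: "g x (ys x) \<le> g x y"
proof -
  obtain y0 where "\<forall>z. g x y0 \<le> g x z"
    using strongly_convex_attains_min[OF convex pos(1) GDERIV_g_y] by blast
  then have "is_arg_min (g x) (\<lambda>_. True) y0" by (auto simp: is_arg_min_linorder)
  then have "is_arg_min (g x) (\<lambda>_. True) (ys x)"
    unfolding ystar_def arg_min_def by (rule someI)
  then show ?thesis by (simp add: is_arg_min_linorder)
qed

lemma grad2_ystar: "grad2 g x (ys x) = 0"
proof -
  have "(\<lambda>h. h \<bullet> grad2 g x (ys x)) = (\<lambda>h. 0)"
    using GDERIV_g_y[of x "ys x"] ystar_min[of x] unfolding gderiv_def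
    by (intro differential_zero_maxmin[of "ys x" UNIV "g x"]) auto
  from fun_cong[OF this, of "grad2 g x (ys x)"] show ?thesis by simp
qed

lemma grad2_g_monotone: "\<mu> * norm (z - y) \<le> norm (grad2 g x z - grad2 g x y)"
proof (cases "z = y")
  case False
  have "\<mu> * (norm (z - y))\<^sup>2 \<le> (z - y) \<bullet> (grad2 g x z - grad2 g x y)"
    by (rule strongly_convex_monotone[OF convex GDERIV_g_y GDERIV_g_y])
  also have "\<dots> \<le> norm (z - y) * norm (grad2 g x z - grad2 g x y)"
    by (rule norm_cauchy_schwarz)
  finally show ?thesis using False by (simp add: power2_eq_square mult_ac)
qed simp

text \<open>At \<open>y\<^sup>*(x')\<close> the gradient \<open>\<nabla>\<^sub>2 g (x', _)\<close> vanishes, so \<open>\<nabla>\<^sub>2 g (x, _)\<close> is at most \<open>L\<^sub>g\<^sub>1 |x - x'|\<close> there, and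
strong monotonicity converts a small gradient into a small distance from the minimizer \<open>y\<^sup>*(x)\<close>.\<close>

lemma ystar_lipschitz: "norm (ys x - ys x') \<le> Lg1 / \<mu> * norm (x - x')"
proof -
  have "\<mu> * norm (ys x - ys x') \<le> norm (grad2 g x (ys x') - grad2 g x' (ys x'))"
    using grad2_g_monotone[of "ys x'" "ys x" x] by (simp add: grad2_ystar norm_minus_commute)
  also have "\<dots> \<le> Lg1 * norm (x - x')"
    using lip_parts(3)[of x "ys x'" x' "ys x'"] by simp
  finally show ?thesis using pos by (simp add: field_simps)
qed

lemma graph_lipschitz: "norm ((x, ys x) - (x', ys x')) \<le> (1 + Lg1 / \<mu>) * norm (x - x')"
  using norm_Pair_le[of "x - x'" "ys x - ys x'"] ystar_lipschitz[of x x'] by (simp add: distrib_right)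

lemma ustar_bound: "norm (us x) \<le> Lf0 / \<mu>"
  unfolding ustar_def using Ainv(3) grad2_f_bound pos
  by (meson divide_right_mono less_imp_le order_trans)

lemma A_ustar: "A x (ys x) *v us x = grad2 f x (ys x)"
  unfolding ustar_def by (rule Ainv(1))

text \<open>Since \<open>A u\<^sup>* = \<nabla>\<^sub>2 f\<close> on the graph of \<open>y\<^sup>*\<close>, the difference of the two solutions is \<open>A\<^sup>-\<^sup>1\<close> applied to the
change of the right-hand side minus the change of the matrix times \<open>u\<^sup>*\<close>. For \<open>x' = x\<close> this is the error
caused by an inexact \<open>y\<close>; for \<open>y = y\<^sup>*(x)\<close> it is the Lipschitz continuity of \<open>u\<^sup>*\<close>.\<close>

lemma adjoint_solution_error:
  "norm (matrix_inv (A x y) *v grad2 f x y - us x') \<le> L1 / \<mu> * norm ((x, y) - (x', ys x'))"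
proof -
  let ?n = "norm ((x, y) - (x', ys x'))"
  have "matrix_inv (A x y) *v grad2 f x y - us x' =
      matrix_inv (A x y) *v ((grad2 f x y - grad2 f x' (ys x')) - (A x y - A x' (ys x')) *v us x')"
    by (simp add: matrix_vector_mult_diff_distrib matrix_vector_mult_diff_rdistrib A_ustar Ainv(2))
  then have "norm (matrix_inv (A x y) *v grad2 f x y - us x') \<le>
      norm ((grad2 f x y - grad2 f x' (ys x')) - (A x y - A x' (ys x')) *v us x') / \<mu>"
    using Ainv(3) by simp
  also have "norm ((grad2 f x y - grad2 f x' (ys x')) - (A x y - A x' (ys x')) *v us x') \<le>
      Lf1 * ?n + (Lg2 * ?n) * (Lf0 / \<mu>)"
  proof (rule order_trans[OF norm_triangle_ineq4 add_mono[OF lip_parts(2)]])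
    show "norm ((A x y - A x' (ys x')) *v us x') \<le> (Lg2 * ?n) * (Lf0 / \<mu>)"
      using lip(3) ustar_bound pos
      by (intro order_trans[OF norm_matrix_vector_mult_le] mult_mono) auto
  qed
  also have "(Lf1 * ?n + (Lg2 * ?n) * (Lf0 / \<mu>)) / \<mu> = L1 / \<mu> * ?n"
    using pos by (simp add: L1_const_def field_simps)
  finally show ?thesis using pos by (simp add: divide_right_mono)
qed

lemma ustar_lipschitz: "norm (us x - us x') \<le> L1 / \<mu> * (1 + Lg1 / \<mu>) * norm (x - x')"
proof -
  have "norm (us x - us x') \<le> L1 / \<mu> * norm ((x, ys x) - (x', ys x'))"
    using adjoint_solution_error[of x "ys x" x'] by (simp add: ustar_def)
  also have "\<dots> \<le> L1 / \<mu> * ((1 + Lg1 / \<mu>) * norm (x - x'))"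
    using L1_pos pos by (intro mult_left_mono graph_lipschitz) auto
  finally show ?thesis by simp
qed

text \<open>The quadratic convergence of Newton's method for \<open>\<nabla>\<^sub>2 g = 0\<close>.\<close>

lemma newton_step_error:
  "norm (y - matrix_inv (A x y) *v grad2 g x y - ys x) \<le> Lg2 / \<mu> * (norm (y - ys x))\<^sup>2"
proof -
  have "y - matrix_inv (A x y) *v grad2 g x y - ys x =
      matrix_inv (A x y) *v (grad2 g x (ys x) - grad2 g x y - A x y *v (ys x - y))"
    by (simp add: matrix_vector_mult_diff_distrib Ainv(2) grad2_ystar linear_neg[OF matrix_vector_mul_linear])
  then have "norm (y - matrix_inv (A x y) *v grad2 g x y - ys x) \<le>
      norm (grad2 g x (ys x) - grad2 g x y - A x y *v (ys x - y)) / \<mu>"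
    using Ainv(3) by simp
  also have "\<dots> \<le> (Lg2 * (norm (ys x - y))\<^sup>2) / \<mu>"
  proof (intro divide_right_mono taylor_second_order_bound[of "grad2 g x" "\<lambda>y v. A x y *v v"] grad2_g_derivative)
    fix z v
    show "norm (A x z *v v - A x y *v v) \<le> Lg2 * norm (z - y) * norm v"
      using lip(3)[of x z x y]
      by (simp flip: matrix_vector_mult_diff_rdistrib)
         (meson mult_right_mono norm_ge_zero norm_matrix_vector_mult_le order_trans)
  qed (use pos in auto)
  finally show ?thesis by (simp add: norm_minus_commute)
qed

definition gradPhi :: "real^'m \<Rightarrow> real^'m" where
  "gradPhi x = grad1 f x (ys x) - hess12 g x (ys x) *v us x"

text \<open>The bias of the direction \<open>D\<^sub>x\<close>, and for \<open>y = y\<^sup>*(x)\<close>, \<open>u = u\<^sup>*(x)\<close> the smoothness of \<open>\<Phi>\<close>. The terms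
with \<open>u\<^sup>*(x')\<close> are arranged so that the unbounded \<open>u\<close> is only ever multiplied by a bounded block.\<close>

lemma hypergradient_error:
  "norm ((grad1 f x y - hess12 g x y *v u) - gradPhi x') \<le>
     L1 * norm ((x, y) - (x', ys x')) + Lg1 * norm (u - us x')"
proof -
  let ?n = "norm ((x, y) - (x', ys x'))"
  have "(grad1 f x y - hess12 g x y *v u) - gradPhi x' =
      ((grad1 f x y - grad1 f x' (ys x')) - (hess12 g x y - hess12 g x' (ys x')) *v us x')
      - hess12 g x y *v (u - us x')"
    by (simp add: gradPhi_def matrix_vector_mult_diff_distrib matrix_vector_mult_diff_rdistrib)
  also have "norm \<dots> \<le> (Lf1 * ?n + (Lg2 * ?n) * (Lf0 / \<mu>)) + Lg1 * norm (u - us x')"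
  proof (rule order_trans[OF norm_triangle_ineq4 add_mono[OF order_trans[OF norm_triangle_ineq4 add_mono[OF lip_parts(1)]] hess12_bound]])
    show "norm ((hess12 g x y - hess12 g x' (ys x')) *v us x') \<le> (Lg2 * ?n) * (Lf0 / \<mu>)"
      using lip(4) ustar_bound pos
      by (intro order_trans[OF norm_matrix_vector_mult_le] mult_mono) auto
  qed
  also have "\<dots> = L1 * ?n + Lg1 * norm (u - us x')"
    by (simp add: L1_const_def algebra_simps)
  finally show ?thesis .
qed

definition "LPhi = L1 * (1 + Lg1 / \<mu>)\<^sup>2"

lemma gradPhi_lipschitz: "norm (gradPhi x - gradPhi x') \<le> LPhi * norm (x - x')"
proof -
  let ?n = "norm ((x, ys x) - (x', ys x'))"
  have "norm (us x - us x') \<le> L1 / \<mu> * ?n"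
    using adjoint_solution_error[of x "ys x" x'] by (simp add: ustar_def)
  then have "L1 * ?n + Lg1 * norm (us x - us x') \<le> L1 * ?n + Lg1 * (L1 / \<mu> * ?n)"
    using pos(4) by (intro add_left_mono mult_left_mono) auto
  also have "\<dots> = L1 * (1 + Lg1 / \<mu>) * ?n" by (simp add: algebra_simps)
  also have "\<dots> \<le> L1 * (1 + Lg1 / \<mu>) * ((1 + Lg1 / \<mu>) * norm (x - x'))"
    using L1_pos pos by (intro mult_left_mono graph_lipschitz) auto
  finally show ?thesis
    using hypergradient_error[of x "ys x" "us x" x'] by (simp add: gradPhi_def LPhi_def power2_eq_square mult_ac)
qed

lemma gradPhi_bound: "norm (gradPhi x) \<le> Cf0 + Lg1 * Lf0 / \<mu>"
proof -
  have "norm (hess12 g x (ys x) *v us x) \<le> Lg1 * (Lf0 / \<mu>)"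
    using hess12_bound[of x "ys x" "us x"] ustar_bound[of x] pos
    by (meson less_imp_le mult_left_mono order_trans)
  then show ?thesis unfolding gradPhi_def
    using norm_triangle_ineq4[of "grad1 f x (ys x)" "hess12 g x (ys x) *v us x"] grad1_f_bound[of x "ys x"] by simp
qed

text \<open>Implicit differentiation of \<open>\<nabla>\<^sub>2 g (x, y\<^sup>*(x)) = 0\<close>. The Lipschitz continuity of \<open>y\<^sup>*\<close> makes the remainder
\<open>o(|x' - x|)\<close>, and coercivity of \<open>A\<close> allows to solve for the increment of \<open>y\<^sup>*\<close>.\<close>

lemma ystar_has_derivative:
  "(ys has_derivative (\<lambda>d. - (matrix_inv (A x (ys x)) *v (hess21 g x (ys x) *v d)))) (at x)"
  unfolding has_derivative_at_alt
proof (intro conjI allI impI)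
  let ?Ai = "matrix_inv (A x (ys x))" and ?B = "hess21 g x (ys x)"
  let ?k = "1 + Lg1 / \<mu>"
  have k: "0 < ?k" using pos by (simp add: add_pos_pos)
  show "bounded_linear (\<lambda>d. - (?Ai *v (?B *v d)))"
    using bounded_linear_minus[OF bounded_linear_compose[OF matrix_vector_mul_bounded_linear[of ?Ai] matrix_vector_mul_bounded_linear[of ?B]]] by simp
  fix e :: real assume e: "0 < e"
  have e': "0 < e * \<mu> / ?k" by (intro divide_pos_pos mult_pos_pos e pos(1) k)
  obtain d where d: "d > 0" "\<forall>z. norm (z - (x, ys x)) < d \<longrightarrow>
      norm (grad_joint g (fst z) (snd z) - grad_joint g (fst (x, ys x)) (snd (x, ys x)) -
       (hess11 g x (ys x) *v fst (z - (x, ys x)) + hess12 g x (ys x) *v snd (z - (x, ys x)),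
        ?B *v fst (z - (x, ys x)) + A x (ys x) *v snd (z - (x, ys x))))
       \<le> e * \<mu> / ?k * norm (z - (x, ys x))"
    using grad_joint_has_derivative[OF diff_g, of x "ys x", unfolded has_derivative_at_alt, THEN conjunct2, rule_format, OF e']
    by auto
  show "\<exists>d>0. \<forall>x'. norm (x' - x) < d \<longrightarrow>
      norm (ys x' - ys x - - (?Ai *v (?B *v (x' - x)))) \<le> e * norm (x' - x)"
  proof (intro exI[of _ "d / ?k"] conjI allI impI)
    show "0 < d / ?k" using d(1) k by simp
    fix x' assume "norm (x' - x) < d / ?k"
    then have lt: "?k * norm (x' - x) < d" using k by (simp add: field_simps)
    let ?r = "?B *v (x' - x) + A x (ys x) *v (ys x' - ys x)"
    let ?q = "grad_joint g x' (ys x') - grad_joint g x (ys x) -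
       (hess11 g x (ys x) *v (x' - x) + hess12 g x (ys x) *v (ys x' - ys x), ?r)"
    have n: "norm ((x', ys x') - (x, ys x)) \<le> ?k * norm (x' - x)" by (rule graph_lipschitz)
    have "snd ?q = - ?r"
      using grad2_ystar[of x] grad2_ystar[of x'] by (simp add: grad2_eq[OF diff1_g])
    then have "norm ?r \<le> norm ?q" using norm_snd_component_le[of ?q] by (metis norm_minus_cancel)
    also have "\<dots> \<le> e * \<mu> / ?k * norm ((x', ys x') - (x, ys x))"
      using d(2)[rule_format, of "(x', ys x')"] n lt by simp
    also have "\<dots> \<le> e * \<mu> / ?k * (?k * norm (x' - x))"
      using e' by (intro mult_left_mono n) simp
    also have "\<dots> = e * \<mu> * norm (x' - x)" using k by simp
    finally have r: "norm ?r \<le> e * \<mu> * norm (x' - x)" .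
    have "ys x' - ys x - - (?Ai *v (?B *v (x' - x))) = ?Ai *v ?r"
      by (simp add: matrix_vector_right_distrib Ainv(2))
    then have "norm (ys x' - ys x - - (?Ai *v (?B *v (x' - x)))) \<le> norm ?r / \<mu>"
      using Ainv(3) by simp
    also have "\<dots> \<le> e * norm (x' - x)" using r pos by (simp add: field_simps)
    finally show "norm (ys x' - ys x - - (?Ai *v (?B *v (x' - x)))) \<le> e * norm (x' - x)" .
  qed
qed

text \<open>By the chain rule the derivative in direction \<open>d\<close> contains \<open>-(A\<^sup>-\<^sup>1 \<nabla>\<^sup>2\<^sub>2\<^sub>1g d) \<bullet> \<nabla>\<^sub>2 f\<close>. Writing
\<open>\<nabla>\<^sub>2 f = A u\<^sup>*\<close>, symmetry of \<open>A\<close> cancels the inverse, and transposing the mixed block moves it to \<open>u\<^sup>*\<close>.\<close>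

lemma GDERIV_Phi: "GDERIV (Phi f g) x :> gradPhi x"
proof -
  let ?Ai = "matrix_inv (A x (ys x))" and ?B = "hess21 g x (ys x)"
  have "((\<lambda>x. f (fst (x, ys x)) (snd (x, ys x))) has_derivative
      (\<lambda>d. (d, - (?Ai *v (?B *v d))) \<bullet> grad_joint f x (ys x))) (at x)"
    by (rule has_derivative_compose[of "\<lambda>x. (x, ys x)" "\<lambda>d. (d, - (?Ai *v (?B *v d)))", OF _ GDERIV_joint[OF diff_f, of "(x, ys x)", unfolded gderiv_def fst_conv snd_conv]])
       (intro has_derivative_Pair has_derivative_ident ystar_has_derivative)
  moreover have "(d, - (?Ai *v (?B *v d))) \<bullet> grad_joint f x (ys x) = d \<bullet> gradPhi x" for d
  proof -
    have "(?Ai *v (?B *v d)) \<bullet> grad2 f x (ys x) = (?Ai *v (?B *v d)) \<bullet> (A x (ys x) *v us x)"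
      by (simp add: A_ustar)
    also have "\<dots> = (?B *v d) \<bullet> us x"
      by (simp add: hess22_symmetric_g Ainv(1))
    also have "\<dots> = d \<bullet> (hess12 g x (ys x) *v us x)"
      by (simp add: hess12_transpose[OF diff_g])
    finally show ?thesis
      by (simp add: inner_prod_def gradPhi_def inner_diff_right grad1_eq[OF diff_f] grad2_eq[OF diff_f])
  qed
  ultimately show ?thesis unfolding gderiv_def Phi_def by simp
qed

lemma grad_Phi: "grad (Phi f g) x = gradPhi x"
  by (rule grad_eqI[OF GDERIV_Phi])

text \<open>From \<open>2 (D \<bullet> \<nabla>\<Phi>) = |D|\<^sup>2 + |\<nabla>\<Phi>|\<^sup>2 - |D - \<nabla>\<Phi>|\<^sup>2\<close>. The term \<open>\<alpha>/4 |D|\<^sup>2\<close> is retained because it pays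
for the drift of \<open>y\<^sup>*\<close> and \<open>u\<^sup>*\<close>; bias and noise of \<open>D\<close> enter together through \<open>|D - \<nabla>\<Phi>|\<^sup>2\<close>.\<close>

lemma gradient_descent_step:
  assumes "0 \<le> \<alpha>" "\<alpha> * LPhi \<le> 1 / 4"
  shows "Phi f g (x - \<alpha> *\<^sub>R D) + \<alpha> / 2 * (norm (gradPhi x))\<^sup>2 + \<alpha> / 4 * (norm D)\<^sup>2
    \<le> Phi f g x + \<alpha> / 2 * (norm (D - gradPhi x))\<^sup>2"
proof -
  have LP: "0 \<le> LPhi" using L1_pos pos by (simp add: LPhi_def)
  have "norm (Phi f g (x - \<alpha> *\<^sub>R D) - Phi f g x - ((x - \<alpha> *\<^sub>R D) - x) \<bullet> gradPhi x)
      \<le> LPhi * (norm ((x - \<alpha> *\<^sub>R D) - x))\<^sup>2"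
  proof (rule taylor_second_order_bound[of "Phi f g" "\<lambda>x d. d \<bullet> gradPhi x"])
    show "(Phi f g has_derivative (\<lambda>d. d \<bullet> gradPhi z)) (at z)" for z
      using GDERIV_Phi by (simp add: gderiv_def)
    show "norm (v \<bullet> gradPhi z - v \<bullet> gradPhi x) \<le> LPhi * norm (z - x) * norm v" for z v
    proof -
      have "norm (v \<bullet> gradPhi z - v \<bullet> gradPhi x) \<le> norm v * norm (gradPhi z - gradPhi x)"
        using Cauchy_Schwarz_ineq2[of v "gradPhi z - gradPhi x"] by (simp add: inner_diff_right)
      also have "\<dots> \<le> norm v * (LPhi * norm (z - x))" by (intro mult_left_mono gradPhi_lipschitz) simp
      finally show ?thesis by (simp add: mult_ac)
    qed
  qed (rule LP)
  then have "Phi f g (x - \<alpha> *\<^sub>R D) \<le> Phi f g x - \<alpha> * (D \<bullet> gradPhi x) + \<alpha> * (\<alpha> * LPhi) * (norm D)\<^sup>2"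
    using assms by (simp add: power_mult_distrib power2_eq_square mult_ac)
  moreover have "\<alpha> * (\<alpha> * LPhi) * (norm D)\<^sup>2 \<le> \<alpha> * (1 / 4) * (norm D)\<^sup>2"
    using assms by (intro mult_right_mono mult_left_mono) auto
  moreover have eq: "(norm (D - gradPhi x))\<^sup>2 = (norm D)\<^sup>2 + (norm (gradPhi x))\<^sup>2 - 2 * (D \<bullet> gradPhi x)"
    by (simp add: power2_norm_eq_inner inner_simps inner_commute)
  then have "\<alpha> / 2 * (norm (D - gradPhi x))\<^sup>2 = \<alpha> / 2 * (norm D)\<^sup>2 + \<alpha> / 2 * (norm (gradPhi x))\<^sup>2 - \<alpha> * (D \<bullet> gradPhi x)"
    by (subst eq) (simp add: algebra_simps)
  ultimately show ?thesis by (simp add: algebra_simps)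
qed

end

section \<open>Joint measurability of sample derivatives\<close>

lemma mat_vec_measurable [measurable (raw)]:
  fixes A :: "'a \<Rightarrow> real^'n^'m"
  assumes [measurable]: "A \<in> borel_measurable M" "v \<in> borel_measurable M"
  shows "(\<lambda>x. A x *v v x) \<in> borel_measurable M"
proof -
  have "(\<lambda>p. fst p *v snd p :: real^'m) \<in> borel_measurable (borel :: ((real^'n^'m) \<times> (real^'n)) measure)"
    unfolding matrix_vector_mult_def
    by (intro borel_measurable_continuous_onI continuous_intros continuous_on_vec_lambda)
  from measurable_compose[OF _ this, of "\<lambda>x. (A x, v x)" M] show ?thesis by simp
qed

lemma borel_measurable_vecI:
  fixes f :: "'a \<Rightarrow> ('b::euclidean_space)^'n"
  assumes "\<And>i. (\<lambda>x. f x $ i) \<in> borel_measurable M"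
  shows "f \<in> borel_measurable M"
proof (subst borel_measurable_euclidean_space, intro ballI)
  fix e :: "'b^'n" assume "e \<in> Basis"
  then obtain i u where e: "e = axis i u" by (auto simp: Basis_vec_def)
  show "(\<lambda>x. f x \<bullet> e) \<in> borel_measurable M"
    unfolding e inner_axis using assms[of i] by measurable
qed

text \<open>Caratheodory functions are jointly measurable. Replace the point \<open>p\<close> by simple functions \<open>q\<^sub>i p\<close> tending to \<open>p\<close>:
each approximation is a finite case distinction over measurable functions of \<open>\<zeta>\<close>.\<close>

lemma measurable_separately_continuous:
  fixes H :: "'z \<Rightarrow> 'p::{metric_space, second_countable_topology} \<Rightarrow> 'b::metric_space"
  assumes meas: "\<And>p. (\<lambda>\<zeta>. H \<zeta> p) \<in> borel_measurable D"
    and cont: "\<And>\<zeta>. \<zeta> \<in> space D \<Longrightarrow> continuous_on UNIV (H \<zeta>)"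
  shows "(\<lambda>(\<zeta>, p). H \<zeta> p) \<in> borel_measurable (D \<Otimes>\<^sub>M borel)"
proof -
  obtain q :: "nat \<Rightarrow> 'p \<Rightarrow> 'p" where q: "\<And>i. simple_function borel (q i)"
    and lim: "\<And>p. (\<lambda>i. q i p) \<longlonglongrightarrow> p"
    using borel_measurable_implies_sequence_metric[of "\<lambda>p::'p. p" borel undefined] by auto
  show ?thesis
  proof (rule borel_measurable_LIMSEQ_metric)
    fix z assume "z \<in> space (D \<Otimes>\<^sub>M (borel :: 'p measure))"
    then have "fst z \<in> space D" by (auto simp: space_pair_measure)
    then have "isCont (H (fst z)) (snd z)" using cont by (simp add: continuous_on_eq_continuous_at)
    then show "(\<lambda>i. H (fst z) (q i (snd z))) \<longlonglongrightarrow> (case z of (\<zeta>, p) \<Rightarrow> H \<zeta> p)"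
      using isCont_tendsto_compose[OF _ lim] by (auto simp: case_prod_beta)
  next
    fix i
    have fin: "finite (range (q i))" and pre: "\<And>c. c \<in> range (q i) \<Longrightarrow> q i -` {c} \<in> sets borel"
      using q[of i] by (auto simp: simple_function_def)
    have "q i \<in> measurable borel (count_space (range (q i)))"
      using fin pre by (subst measurable_count_space_eq2) auto
    then have "(\<lambda>z. q i (snd z)) \<in> measurable (D \<Otimes>\<^sub>M borel) (count_space (range (q i)))"
      by measurable
    show "(\<lambda>z. H (fst z) (q i (snd z))) \<in> borel_measurable (D \<Otimes>\<^sub>M borel)"
    proof (rule measurable_compose_countable'[where f = "\<lambda>c z. H (fst z) c" and I = "range (q i)"])
      show "(\<lambda>z. q i (snd z)) \<in> measurable (D \<Otimes>\<^sub>M borel) (count_space (range (q i)))" by fact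
      show "(\<lambda>z. H (fst z) c) \<in> borel_measurable (D \<Otimes>\<^sub>M borel)" for c
        using meas[of c] by measurable
      show "countable (range (q i))" using fin by (rule countable_finite)
    qed
  qed
qed

lemma has_derivative_LIMSEQ:
  fixes P :: "'a::real_normed_vector \<Rightarrow> 'b::real_normed_vector"
  assumes "(P has_derivative P') (at y)"
  shows "(\<lambda>n. real (Suc n) *\<^sub>R (P (y + (1 / real (Suc n)) *\<^sub>R b) - P y)) \<longlonglongrightarrow> P' b"
proof -
  interpret bounded_linear P' using assms by (rule has_derivative_bounded_linear)
  have "((\<lambda>t. P (y + t *\<^sub>R b)) has_derivative (\<lambda>k. P' (k *\<^sub>R b))) (at 0)"
    using assms by (intro has_derivative_compose[of "\<lambda>t. y + t *\<^sub>R b" _ 0 _ P]) (auto intro!: derivative_eq_intros)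
  then have "((\<lambda>t. inverse \<bar>t\<bar> * norm (P (y + t *\<^sub>R b) - P y - t *\<^sub>R P' b)) \<longlongrightarrow> 0) (at 0)"
    by (simp add: has_derivative_at scaleR divide_inverse_commute)
  then have "((\<lambda>t. norm ((P (y + t *\<^sub>R b) - P y) /\<^sub>R t - P' b)) \<longlongrightarrow> 0) (at 0)"
  proof (rule Lim_transform_eventually)
    have "inverse \<bar>t\<bar> * norm (v - t *\<^sub>R p) = norm (v /\<^sub>R t - p)" if "t \<noteq> 0" for t :: real and v p :: 'b
    proof -
      have "v /\<^sub>R t - p = (v - t *\<^sub>R p) /\<^sub>R t" using that by (simp add: scaleR_diff_right)
      then show ?thesis by simp
    qed
    then show "\<forall>\<^sub>F t in at 0. inverse \<bar>t\<bar> * norm (P (y + t *\<^sub>R b) - P y - t *\<^sub>R P' b) = norm ((P (y + t *\<^sub>R b) - P y) /\<^sub>R t - P' b)"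
      by (simp add: eventually_at_filter)
  qed
  then have lim: "((\<lambda>t. (P (y + t *\<^sub>R b) - P y) /\<^sub>R t) \<longlongrightarrow> P' b) (at 0)"
    using tendsto_norm_zero_iff LIM_zero_iff by blast
  have "filterlim (\<lambda>n. 1 / real (Suc n)) (at 0) sequentially"
    unfolding filterlim_at using LIMSEQ_inverse_real_of_nat by (auto simp: inverse_eq_divide)
  from filterlim_compose[OF lim this] show ?thesis by (simp add: field_simps)
qed

context
  fixes h :: "'z \<Rightarrow> real^'m \<Rightarrow> real^'n \<Rightarrow> real" and D :: "'z measure"
  assumes meas: "\<And>x y. (\<lambda>\<zeta>. h \<zeta> x y) \<in> borel_measurable D"
    and diff: "\<And>\<zeta>. \<zeta> \<in> space D \<Longrightarrow> differentiable1 (h \<zeta>)"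
begin

lemma sample_measurable: "(\<lambda>(\<zeta>, z). h \<zeta> (fst z) (snd z)) \<in> borel_measurable (D \<Otimes>\<^sub>M borel)"
proof (rule measurable_separately_continuous)
  show "continuous_on UNIV (\<lambda>z. h \<zeta> (fst z) (snd z))" if "\<zeta> \<in> space D" for \<zeta>
    using diff[OF that] unfolding differentiable1_def
    by (simp add: continuous_at_imp_continuous_on differentiable_imp_continuous_within)
qed (rule meas)

text \<open>Each component of the gradient is a limit of difference quotients, which are jointly measurable by the
previous lemma.\<close>

lemma sample_grad_measurable:
  "(\<lambda>(\<zeta>, z). grad_joint (h \<zeta>) (fst z) (snd z)) \<in> borel_measurable (D \<Otimes>\<^sub>M borel)"
proof (subst borel_measurable_euclidean_space, intro ballI)
  fix b :: "(real^'m) \<times> (real^'n)" assume "b \<in> Basis"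
  have hm: "(\<lambda>p. h (fst p) (fst (snd p + c)) (snd (snd p + c))) \<in> borel_measurable (D \<Otimes>\<^sub>M borel)" for c
    using measurable_compose[OF _ sample_measurable, of "\<lambda>p. (fst p, snd p + c)" "D \<Otimes>\<^sub>M borel"]
    by (simp add: case_prod_beta)
  show "(\<lambda>p. (case p of (\<zeta>, z) \<Rightarrow> grad_joint (h \<zeta>) (fst z) (snd z)) \<bullet> b) \<in> borel_measurable (D \<Otimes>\<^sub>M borel)"
  proof (rule borel_measurable_LIMSEQ_metric)
    fix p assume "p \<in> space (D \<Otimes>\<^sub>M (borel :: ((real^'m) \<times> (real^'n)) measure))"
    then have "fst p \<in> space D" by (auto simp: space_pair_measure)
    from has_derivative_LIMSEQ[OF GDERIV_joint[OF diff[OF this], of "snd p", unfolded gderiv_def], of b]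
    show "(\<lambda>n. real (Suc n) *\<^sub>R (h (fst p) (fst (snd p + (1 / real (Suc n)) *\<^sub>R b)) (snd (snd p + (1 / real (Suc n)) *\<^sub>R b)) - h (fst p) (fst (snd p + 0)) (snd (snd p + 0))))
      \<longlonglongrightarrow> (case p of (\<zeta>, z) \<Rightarrow> grad_joint (h \<zeta>) (fst z) (snd z)) \<bullet> b"
      by (simp only: add_0_right case_prod_beta inner_commute)
  next
    fix n
    show "(\<lambda>p. real (Suc n) *\<^sub>R (h (fst p) (fst (snd p + (1 / real (Suc n)) *\<^sub>R b)) (snd (snd p + (1 / real (Suc n)) *\<^sub>R b)) - h (fst p) (fst (snd p + 0)) (snd (snd p + 0)))) \<in> borel_measurable (D \<Otimes>\<^sub>M borel)"
      by (intro borel_measurable_scaleR borel_measurable_diff hm borel_measurable_const)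
  qed
qed

lemma grad_joint_measurable:
  assumes "\<zeta> \<in> measurable N D" "x \<in> borel_measurable N" "y \<in> borel_measurable N"
  shows "(\<lambda>\<omega>. grad_joint (h (\<zeta> \<omega>)) (x \<omega>) (y \<omega>)) \<in> borel_measurable N"
  using measurable_compose[OF _ sample_grad_measurable, of "\<lambda>\<omega>. (\<zeta> \<omega>, (x \<omega>, y \<omega>))" N] assms by simp

lemma
  assumes "\<zeta> \<in> measurable N D" "x \<in> borel_measurable N" "y \<in> borel_measurable N"
  shows grad1_measurable: "(\<lambda>\<omega>. grad1 (h (\<zeta> \<omega>)) (x \<omega>) (y \<omega>)) \<in> borel_measurable N"
    and grad2_measurable: "(\<lambda>\<omega>. grad2 (h (\<zeta> \<omega>)) (x \<omega>) (y \<omega>)) \<in> borel_measurable N"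
proof -
  have "fst \<circ> (\<lambda>\<omega>. grad_joint (h (\<zeta> \<omega>)) (x \<omega>) (y \<omega>)) \<in> borel_measurable N"
    by (rule measurable_comp[OF grad_joint_measurable[OF assms]]) (simp add: borel_prod[symmetric])
  then show "(\<lambda>\<omega>. grad1 (h (\<zeta> \<omega>)) (x \<omega>) (y \<omega>)) \<in> borel_measurable N"
    using measurable_space[OF assms(1)]
    by (subst measurable_cong[where g = "fst \<circ> (\<lambda>\<omega>. grad_joint (h (\<zeta> \<omega>)) (x \<omega>) (y \<omega>))"]) (auto simp: grad1_eq[OF diff])
  have "snd \<circ> (\<lambda>\<omega>. grad_joint (h (\<zeta> \<omega>)) (x \<omega>) (y \<omega>)) \<in> borel_measurable N"
    by (rule measurable_comp[OF grad_joint_measurable[OF assms]]) (simp add: borel_prod[symmetric])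
  then show "(\<lambda>\<omega>. grad2 (h (\<zeta> \<omega>)) (x \<omega>) (y \<omega>)) \<in> borel_measurable N"
    using measurable_space[OF assms(1)]
    by (subst measurable_cong[where g = "snd \<circ> (\<lambda>\<omega>. grad_joint (h (\<zeta> \<omega>)) (x \<omega>) (y \<omega>))"]) (auto simp: grad2_eq[OF diff])
qed

lemma
  assumes diff2: "\<And>\<zeta>. \<zeta> \<in> space D \<Longrightarrow> differentiable2 (h \<zeta>)"
    and m: "\<zeta> \<in> measurable N D" "x \<in> borel_measurable N" "y \<in> borel_measurable N"
  shows hess12_measurable: "(\<lambda>\<omega>. hess12 (h (\<zeta> \<omega>)) (x \<omega>) (y \<omega>)) \<in> borel_measurable N"
    and hess22_measurable: "(\<lambda>\<omega>. hess22 (h (\<zeta> \<omega>)) (x \<omega>) (y \<omega>)) \<in> borel_measurable N"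
proof -
  have col: "(\<lambda>\<omega>. (hess12 (h (\<zeta> \<omega>)) (x \<omega>) (y \<omega>) *v v, hess22 (h (\<zeta> \<omega>)) (x \<omega>) (y \<omega>) *v v)) \<in> borel_measurable N" for v
  proof (rule borel_measurable_LIMSEQ_metric)
    fix \<omega> assume "\<omega> \<in> space N"
    then have "\<zeta> \<omega> \<in> space D" using m(1) by (auto dest: measurable_space)
    from has_derivative_LIMSEQ[OF grad_joint_has_derivative[OF diff2[OF this], of "x \<omega>" "y \<omega>"], of "(0, v)"]
    show "(\<lambda>n. real (Suc n) *\<^sub>R (grad_joint (h (\<zeta> \<omega>)) (x \<omega>) (y \<omega> + (1 / real (Suc n)) *\<^sub>R v) - grad_joint (h (\<zeta> \<omega>)) (x \<omega>) (y \<omega>)))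
      \<longlonglongrightarrow> (hess12 (h (\<zeta> \<omega>)) (x \<omega>) (y \<omega>) *v v, hess22 (h (\<zeta> \<omega>)) (x \<omega>) (y \<omega>) *v v)"
      by (simp del: of_nat_Suc)
  next
    fix n
    show "(\<lambda>\<omega>. real (Suc n) *\<^sub>R (grad_joint (h (\<zeta> \<omega>)) (x \<omega>) (y \<omega> + (1 / real (Suc n)) *\<^sub>R v) - grad_joint (h (\<zeta> \<omega>)) (x \<omega>) (y \<omega>))) \<in> borel_measurable N"
      using m by (intro borel_measurable_scaleR borel_measurable_diff borel_measurable_const grad_joint_measurable) auto
  qed
  have "fst \<circ> (\<lambda>\<omega>. (hess12 (h (\<zeta> \<omega>)) (x \<omega>) (y \<omega>) *v v, hess22 (h (\<zeta> \<omega>)) (x \<omega>) (y \<omega>) *v v)) \<in> borel_measurable N" for v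
    by (rule measurable_comp[OF col]) (simp add: borel_prod[symmetric])
  then have 1: "(\<lambda>\<omega>. hess12 (h (\<zeta> \<omega>)) (x \<omega>) (y \<omega>) *v v) \<in> borel_measurable N" for v by (simp add: comp_def)
  have "snd \<circ> (\<lambda>\<omega>. (hess12 (h (\<zeta> \<omega>)) (x \<omega>) (y \<omega>) *v v, hess22 (h (\<zeta> \<omega>)) (x \<omega>) (y \<omega>) *v v)) \<in> borel_measurable N" for v
    by (rule measurable_comp[OF col]) (simp add: borel_prod[symmetric])
  then have 2: "(\<lambda>\<omega>. hess22 (h (\<zeta> \<omega>)) (x \<omega>) (y \<omega>) *v v) \<in> borel_measurable N" for v by (simp add: comp_def)
  have nth: "(\<lambda>v :: real^'k. v $ i) \<in> borel_measurable borel" for i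
    by (intro borel_measurable_continuous_onI continuous_intros)
  have entry: "B $ i $ j = (B *v axis j 1) $ i" for B :: "real^'n^'k" and i j
    by (simp add: matrix_vector_mul_component inner_axis)
  show "(\<lambda>\<omega>. hess12 (h (\<zeta> \<omega>)) (x \<omega>) (y \<omega>)) \<in> borel_measurable N"
  proof (intro borel_measurable_vecI)
    fix i j show "(\<lambda>\<omega>. hess12 (h (\<zeta> \<omega>)) (x \<omega>) (y \<omega>) $ i $ j) \<in> borel_measurable N"
      unfolding entry by (rule measurable_compose[OF 1 nth])
  qed
  show "(\<lambda>\<omega>. hess22 (h (\<zeta> \<omega>)) (x \<omega>) (y \<omega>)) \<in> borel_measurable N"
  proof (intro borel_measurable_vecI)
    fix i j show "(\<lambda>\<omega>. hess22 (h (\<zeta> \<omega>)) (x \<omega>) (y \<omega>) $ i $ j) \<in> borel_measurable N"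
      unfolding entry by (rule measurable_compose[OF 2 nth])
  qed
qed

end

section \<open>Independence and averages\<close>

text \<open>For independent sub-\<open>\<sigma>\<close>-algebras \<open>S\<close> and \<open>T\<close> the diagonal map pushes the probability measure to the product of
its restrictions, so Tonelli's theorem applies to functions evaluated on the diagonal. Compared with random
variables in product spaces, sub-\<open>\<sigma>\<close>-algebras of one space handle samples of different types uniformly.\<close>

lemma (in prob_space) nn_integral_indep_diagonal:
  assumes S: "space S = space M" "sets S \<subseteq> sets M" and T: "space T = space M" "sets T \<subseteq> sets M"
    and ind: "indep_set (sets S) (sets T)" and h: "h \<in> borel_measurable (S \<Otimes>\<^sub>M T)"
  shows "(\<integral>\<^sup>+\<omega>. h (\<omega>, \<omega>) \<partial>M) = (\<integral>\<^sup>+\<omega>. \<integral>\<^sup>+\<omega>'. h (\<omega>, \<omega>') \<partial>M \<partial>M)"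
proof -
  have id: "(\<lambda>\<omega>. \<omega>) \<in> measurable M N" if "space N = space M" "sets N \<subseteq> sets M" for N
    unfolding measurable_def using that by (auto intro!: sets.Int)
  note idS = id[OF S] and idT = id[OF T]
  have sub: "sigma_sets (space M) {(\<lambda>\<omega>. \<omega>) -` A \<inter> space M |A. A \<in> sets N} \<subseteq> sets N"
    if "space N = space M" for N
  proof -
    have "{(\<lambda>\<omega>. \<omega>) -` A \<inter> space M |A. A \<in> sets N} \<subseteq> sets N"
      unfolding that[symmetric] by auto
    from sets.sigma_sets_subset[OF this] that show ?thesis by simp
  qed
  have "indep_var S (\<lambda>\<omega>. \<omega>) T (\<lambda>\<omega>. \<omega>)"
    unfolding indep_var_eq
  proof (intro conjI idS idT)
    show "indep_set (sigma_sets (space M) {(\<lambda>\<omega>. \<omega>) -` A \<inter> space M |A. A \<in> sets S})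
     (sigma_sets (space M) {(\<lambda>\<omega>. \<omega>) -` A \<inter> space M |A. A \<in> sets T})"
      using ind sub[OF S(1)] sub[OF T(1)] unfolding indep_sets2_eq by (meson subset_iff)
  qed
  then have eq: "distr M S (\<lambda>\<omega>. \<omega>) \<Otimes>\<^sub>M distr M T (\<lambda>\<omega>. \<omega>) = distr M (S \<Otimes>\<^sub>M T) (\<lambda>\<omega>. (\<omega>, \<omega>))"
    by (simp add: indep_var_distribution_eq)
  interpret PT: prob_space "distr M T (\<lambda>\<omega>. \<omega>)" by (rule prob_space_distr[OF idT])
  have h': "h \<in> borel_measurable (distr M S (\<lambda>\<omega>. \<omega>) \<Otimes>\<^sub>M distr M T (\<lambda>\<omega>. \<omega>))"
    using h by simp
  have "(\<integral>\<^sup>+\<omega>. h (\<omega>, \<omega>) \<partial>M) = (\<integral>\<^sup>+z. h z \<partial>distr M (S \<Otimes>\<^sub>M T) (\<lambda>\<omega>. (\<omega>, \<omega>)))"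
    using h idS idT by (subst nn_integral_distr) auto
  also have "\<dots> = (\<integral>\<^sup>+\<omega>. \<integral>\<^sup>+\<omega>'. h (\<omega>, \<omega>') \<partial>distr M T (\<lambda>\<omega>. \<omega>) \<partial>distr M S (\<lambda>\<omega>. \<omega>))"
    unfolding eq[symmetric] by (rule PT.nn_integral_fst[OF h', symmetric])
  also have "\<dots> = (\<integral>\<^sup>+\<omega>. \<integral>\<^sup>+\<omega>'. h (\<omega>, \<omega>') \<partial>distr M T (\<lambda>\<omega>. \<omega>) \<partial>M)"
    using PT.borel_measurable_nn_integral_fst[OF h'] idS by (subst nn_integral_distr) auto
  also have "\<dots> = (\<integral>\<^sup>+\<omega>. \<integral>\<^sup>+\<omega>'. h (\<omega>, \<omega>') \<partial>M \<partial>M)"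
  proof (rule nn_integral_cong)
    fix \<omega> assume "\<omega> \<in> space M"
    then have "(\<lambda>\<omega>'. h (\<omega>, \<omega>')) \<in> borel_measurable T"
      using h S by (intro measurable_Pair2[OF h]) simp
    then show "(\<integral>\<^sup>+\<omega>'. h (\<omega>, \<omega>') \<partial>distr M T (\<lambda>\<omega>. \<omega>)) = (\<integral>\<^sup>+\<omega>'. h (\<omega>, \<omega>') \<partial>M)"
      using idT by (subst nn_integral_distr) auto
  qed
  finally show ?thesis .
qed

text \<open>Expand the square of the sum of the centred variables; the mixed terms have mean zero, coordinate by coordinate,
by independence.\<close>

lemma (in prob_space) batch_variance:
  fixes W :: "nat \<Rightarrow> 'a \<Rightarrow> 'b::euclidean_space"
  assumes n: "0 < n" and mean: "\<And>i. i < n \<Longrightarrow> has_bochner_integral M (W i) m"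
    and var: "\<And>i. i < n \<Longrightarrow> mean_sq M (\<lambda>\<omega>. W i \<omega> - m) \<le> ennreal (\<sigma>\<^sup>2)"
    and ind: "\<And>i j. i < n \<Longrightarrow> j < n \<Longrightarrow> i \<noteq> j \<Longrightarrow> indep_var borel (W i) borel (W j)"
  shows "mean_sq M (\<lambda>\<omega>. batch_avg n (\<lambda>i. W i \<omega>) - m) \<le> ennreal (\<sigma>\<^sup>2 / real n)"
proof -
  define D where "D i \<omega> = W i \<omega> - m" for i \<omega>
  have Wm: "W i \<in> borel_measurable M" if "i < n" for i using mean[OF that] by (rule borel_measurable_has_bochner_integral)
  have Dm: "D i \<in> borel_measurable M" if "i < n" for i using Wm[OF that] by (simp add: D_def[abs_def])
  have Dint: "has_bochner_integral M (D i) 0" if "i < n" for i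
    using mean[OF that] by (auto simp: has_bochner_integral_iff D_def[abs_def] prob_space)
  have sq_fin: "(\<integral>\<^sup>+\<omega>. ennreal ((norm (D i \<omega>))\<^sup>2) \<partial>M) \<le> ennreal (\<sigma>\<^sup>2)" if "i < n" for i
    using var[OF that] by (simp add: mean_sq_def D_def)
  have sq_int: "integrable M (\<lambda>\<omega>. (norm (D i \<omega>))\<^sup>2)" if "i < n" for i
    using sq_fin[OF that] Dm[OF that]
    by (intro integrableI_nonneg) (auto intro: le_less_trans)
  have sq_le: "(\<integral>\<omega>. (norm (D i \<omega>))\<^sup>2 \<partial>M) \<le> \<sigma>\<^sup>2" if "i < n" for i
    using sq_fin[OF that] nn_integral_eq_integral[OF sq_int[OF that]] by (simp)
  have cross_int: "integrable M (\<lambda>\<omega>. D i \<omega> \<bullet> D j \<omega>)" if "i < n" "j < n" for i j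
  proof (rule Bochner_Integration.integrable_bound)
    show "integrable M (\<lambda>\<omega>. (norm (D i \<omega>))\<^sup>2 + (norm (D j \<omega>))\<^sup>2)"
      using sq_int that by simp
    show "(\<lambda>\<omega>. D i \<omega> \<bullet> D j \<omega>) \<in> borel_measurable M" using Dm that by simp
    have "\<bar>a \<bullet> b\<bar> \<le> (norm a)\<^sup>2 + (norm b)\<^sup>2" for a b :: 'b
    proof -
      have "\<bar>a \<bullet> b\<bar> \<le> norm a * norm b" by (rule Cauchy_Schwarz_ineq2)
      also have "\<dots> \<le> (norm a)\<^sup>2 + (norm b)\<^sup>2"
        using sum_squares_bound[of "norm a" "norm b"] mult_nonneg_nonneg[OF norm_ge_zero[of a] norm_ge_zero[of b]] by linarith
      finally show ?thesis .
    qed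
    then show "AE \<omega> in M. norm (D i \<omega> \<bullet> D j \<omega>) \<le> norm ((norm (D i \<omega>))\<^sup>2 + (norm (D j \<omega>))\<^sup>2)"
      by auto
  qed
  have cross: "(\<integral>\<omega>. D i \<omega> \<bullet> D j \<omega> \<partial>M) = 0" if ij: "i < n" "j < n" "i \<noteq> j" for i j
  proof -
    have coord: "integrable M (\<lambda>\<omega>. (D i \<omega> \<bullet> b) * (D j \<omega> \<bullet> b)) \<and> (\<integral>\<omega>. (D i \<omega> \<bullet> b) * (D j \<omega> \<bullet> b) \<partial>M) = 0" for b
    proof -
      have indb: "indep_var borel (\<lambda>\<omega>. D i \<omega> \<bullet> b) borel (\<lambda>\<omega>. D j \<omega> \<bullet> b)"
        using indep_var_compose[OF ind[OF ij], of "\<lambda>w. (w - m) \<bullet> b" borel "\<lambda>w. (w - m) \<bullet> b" borel]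
        by (simp add: comp_def D_def)
      have hb: "has_bochner_integral M (\<lambda>\<omega>. D k \<omega> \<bullet> b) 0" if "k < n" for k
        using has_bochner_integral_inner_left[of b M "D k" 0] Dint[OF that] by simp
      have "integrable M (\<lambda>\<omega>. D i \<omega> \<bullet> b)" "integrable M (\<lambda>\<omega>. D j \<omega> \<bullet> b)"
        using hb ij by (auto simp: has_bochner_integral_iff)
      from indep_var_integrable[OF indb this] indep_var_lebesgue_integral[OF indb this] hb[OF ij(1)]
      show ?thesis by (simp add: has_bochner_integral_iff)
    qed
    have "(\<integral>\<omega>. D i \<omega> \<bullet> D j \<omega> \<partial>M) = (\<integral>\<omega>. (\<Sum>b\<in>Basis. (D i \<omega> \<bullet> b) * (D j \<omega> \<bullet> b)) \<partial>M)"
      by (intro Bochner_Integration.integral_cong refl euclidean_inner)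
    also have "\<dots> = 0" using coord by (subst Bochner_Integration.integral_sum) auto
    finally show ?thesis .
  qed
  have sumsq: "(norm (\<Sum>i<n. D i \<omega>))\<^sup>2 = (\<Sum>i<n. \<Sum>j<n. D i \<omega> \<bullet> D j \<omega>)" for \<omega>
    by (simp add: power2_norm_eq_inner inner_sum_left inner_sum_right) (rule sum.swap)
  have int_sum: "integrable M (\<lambda>\<omega>. (norm (\<Sum>i<n. D i \<omega>))\<^sup>2)"
    unfolding sumsq by (intro Bochner_Integration.integrable_sum cross_int) auto
  have "(\<integral>\<omega>. (norm (\<Sum>i<n. D i \<omega>))\<^sup>2 \<partial>M) = (\<Sum>i<n. (\<integral>\<omega>. (\<Sum>j<n. D i \<omega> \<bullet> D j \<omega>) \<partial>M))"
    unfolding sumsq by (intro Bochner_Integration.integral_sum Bochner_Integration.integrable_sum cross_int) auto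
  also have "\<dots> = (\<Sum>i<n. \<Sum>j<n. (\<integral>\<omega>. D i \<omega> \<bullet> D j \<omega> \<partial>M))"
    by (intro sum.cong refl Bochner_Integration.integral_sum cross_int) auto
  also have "\<dots> = (\<Sum>i<n. \<Sum>j<n. if j = i then (\<integral>\<omega>. D i \<omega> \<bullet> D i \<omega> \<partial>M) else 0)"
    using cross by (intro sum.cong refl) auto
  also have "\<dots> = (\<Sum>i<n. (\<integral>\<omega>. (norm (D i \<omega>))\<^sup>2 \<partial>M))"
    by (simp add: power2_norm_eq_inner)
  also have "\<dots> \<le> real n * \<sigma>\<^sup>2"
    using sum_mono[of "{..<n}" _ "\<lambda>_. \<sigma>\<^sup>2"] sq_le by simp
  finally have total: "(\<integral>\<omega>. (norm (\<Sum>i<n. D i \<omega>))\<^sup>2 \<partial>M) \<le> real n * \<sigma>\<^sup>2" .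
  have avg: "batch_avg n (\<lambda>i. W i \<omega>) - m = (1 / real n) *\<^sub>R (\<Sum>i<n. D i \<omega>)" for \<omega>
    using n by (simp add: batch_avg_def D_def sum_subtractf scaleR_diff_right sum_constant_scaleR)
  have "mean_sq M (\<lambda>\<omega>. batch_avg n (\<lambda>i. W i \<omega>) - m) = (\<integral>\<^sup>+\<omega>. ennreal ((1 / real n)\<^sup>2 * (norm (\<Sum>i<n. D i \<omega>))\<^sup>2) \<partial>M)"
    unfolding mean_sq_def avg by (simp add: power_divide)
  also have "\<dots> = ennreal (\<integral>\<omega>. (1 / real n)\<^sup>2 * (norm (\<Sum>i<n. D i \<omega>))\<^sup>2 \<partial>M)"
    using int_sum by (intro nn_integral_eq_integral) auto
  also have "\<dots> = ennreal ((1 / real n)\<^sup>2 * (\<integral>\<omega>. (norm (\<Sum>i<n. D i \<omega>))\<^sup>2 \<partial>M))" by simp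
  also have "\<dots> \<le> ennreal ((1 / real n)\<^sup>2 * (real n * \<sigma>\<^sup>2))"
    using total by (intro ennreal_leI mult_left_mono) auto
  also have "(1 / real n)\<^sup>2 * (real n * \<sigma>\<^sup>2) = \<sigma>\<^sup>2 / real n"
    using n by (simp add: power2_eq_square)
  finally show ?thesis .
qed

section \<open>Stochastic oracles\<close>

lemma mean_sq_mono:
  "(\<And>\<omega>. \<omega> \<in> space M \<Longrightarrow> norm (X \<omega>) \<le> norm (Y \<omega>)) \<Longrightarrow> mean_sq M X \<le> mean_sq M Y"
  unfolding mean_sq_def by (intro nn_integral_mono ennreal_leI power_mono) auto

lemma (in prob_space) mean_norm_le_sqrt:
  assumes X: "X \<in> borel_measurable M" and a: "0 \<le> a" and le: "mean_sq M X \<le> ennreal a"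
  shows "mean_norm M X \<le> ennreal (sqrt a)"
proof -
  have "(mean_norm M X)\<^sup>2 \<le> mean_sq M X"
    using Cauchy_Schwarz_nn_integral[of "\<lambda>\<omega>. ennreal (norm (X \<omega>))" M "\<lambda>_. 1"] X
    by (simp add: mean_norm_def mean_sq_def emeasure_space_1 ennreal_power)
  also have "\<dots> \<le> (ennreal (sqrt a))\<^sup>2" using le a by (simp add: ennreal_power)
  finally have "(mean_norm M X)\<^sup>2 \<le> ennreal a" using a by (simp add: ennreal_power)
  then show ?thesis
    by (cases "mean_norm M X" rule: ennreal_cases)
       (auto simp: ennreal_power a real_le_rsqrt ennreal_top_mult power2_eq_square top_unique ennreal_mult[symmetric] intro!: ennreal_leI)
qed

locale stochastic_bilevel =
  bilevel_problem f g \<mu> Lf0 Lf1 Lg1 Lg2 Cf0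
  for f g :: "real^'m \<Rightarrow> real^'n \<Rightarrow> real" and \<mu> Lf0 Lf1 Lg1 Lg2 Cf0 +
  fixes F :: "'xi \<Rightarrow> real^'m \<Rightarrow> real^'n \<Rightarrow> real" and G :: "'zeta \<Rightarrow> real^'m \<Rightarrow> real^'n \<Rightarrow> real"
    and Dxi :: "'xi measure" and Dzeta :: "'zeta measure" and \<sigma>f1 \<sigma>g1 \<sigma>g2 :: real
  assumes setting: "bilevel_setting f g F G Dxi Dzeta"
    and variance: "variance_assumption f g F G Dxi Dzeta \<sigma>f1 \<sigma>g1 \<sigma>g2"
begin

lemma diff_F: "\<xi> \<in> space Dxi \<Longrightarrow> differentiable1 (F \<xi>)"
  and diff_G: "\<zeta> \<in> space Dzeta \<Longrightarrow> differentiable2 (G \<zeta>)"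
  and diff1_G: "\<zeta> \<in> space Dzeta \<Longrightarrow> differentiable1 (G \<zeta>)"
  using setting by (auto simp: bilevel_setting_def differentiable2_def)

lemma F_measurable: "(\<lambda>\<xi>. F \<xi> x y) \<in> borel_measurable Dxi"
  and G_measurable: "(\<lambda>\<zeta>. G \<zeta> x y) \<in> borel_measurable Dzeta"
proof -
  have "has_bochner_integral Dxi (\<lambda>\<xi>. F \<xi> x y) (f x y)" "has_bochner_integral Dzeta (\<lambda>\<zeta>. G \<zeta> x y) (g x y)"
    using setting by (simp_all add: bilevel_setting_def)
  then show "(\<lambda>\<xi>. F \<xi> x y) \<in> borel_measurable Dxi" "(\<lambda>\<zeta>. G \<zeta> x y) \<in> borel_measurable Dzeta"
    by (simp_all add: borel_measurable_has_bochner_integral)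
qed

text \<open>The blocks are images of the joint gradient and of the full Hessian under coordinate projections.\<close>

lemma unbiased:
  "has_bochner_integral Dxi (\<lambda>\<xi>. grad1 (F \<xi>) x y) (grad1 f x y)"
  "has_bochner_integral Dxi (\<lambda>\<xi>. grad2 (F \<xi>) x y) (grad2 f x y)"
  "has_bochner_integral Dzeta (\<lambda>\<zeta>. grad2 (G \<zeta>) x y) (grad2 g x y)"
  "has_bochner_integral Dzeta (\<lambda>\<zeta>. hess12 (G \<zeta>) x y) (hess12 g x y)"
  "has_bochner_integral Dzeta (\<lambda>\<zeta>. hess22 (G \<zeta>) x y) (hess22 g x y)"
proof -
  have F: "has_bochner_integral Dxi (\<lambda>\<xi>. grad_joint (F \<xi>) x y) (grad_joint f x y)"
    and G: "has_bochner_integral Dzeta (\<lambda>\<zeta>. grad_joint (G \<zeta>) x y) (grad_joint g x y)"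
    and H: "has_bochner_integral Dzeta (\<lambda>\<zeta>. hess (G \<zeta>) x y) (hess g x y)"
    using setting by (auto simp: bilevel_setting_def)
  note bl = has_bochner_integral_bounded_linear
  have 1: "has_bochner_integral Dxi (\<lambda>\<xi>. grad1 (F \<xi>) x y) (grad1 f x y) \<longleftrightarrow>
      has_bochner_integral Dxi (\<lambda>\<xi>. fst (grad_joint (F \<xi>) x y)) (fst (grad_joint f x y))"
    by (rule has_bochner_integral_cong) (auto simp: grad1_eq diff_F diff_f)
  have 2: "has_bochner_integral Dxi (\<lambda>\<xi>. grad2 (F \<xi>) x y) (grad2 f x y) \<longleftrightarrow>
      has_bochner_integral Dxi (\<lambda>\<xi>. snd (grad_joint (F \<xi>) x y)) (snd (grad_joint f x y))"
    by (rule has_bochner_integral_cong) (auto simp: grad2_eq diff_F diff_f)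
  have 3: "has_bochner_integral Dzeta (\<lambda>\<zeta>. grad2 (G \<zeta>) x y) (grad2 g x y) \<longleftrightarrow>
      has_bochner_integral Dzeta (\<lambda>\<zeta>. snd (grad_joint (G \<zeta>) x y)) (snd (grad_joint g x y))"
    by (rule has_bochner_integral_cong) (auto simp: grad2_eq diff1_G diff1_g)
  show "has_bochner_integral Dxi (\<lambda>\<xi>. grad1 (F \<xi>) x y) (grad1 f x y)"
    unfolding 1 by (rule bl[OF bounded_linear_fst F])
  show "has_bochner_integral Dxi (\<lambda>\<xi>. grad2 (F \<xi>) x y) (grad2 f x y)"
    unfolding 2 by (rule bl[OF bounded_linear_snd F])
  show "has_bochner_integral Dzeta (\<lambda>\<zeta>. grad2 (G \<zeta>) x y) (grad2 g x y)"
    unfolding 3 by (rule bl[OF bounded_linear_snd G])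
  show "has_bochner_integral Dzeta (\<lambda>\<zeta>. hess12 (G \<zeta>) x y) (hess12 g x y)"
    using bl[OF bounded_linear_snd bl[OF bounded_linear_fst H]] by (simp add: hess_def)
  show "has_bochner_integral Dzeta (\<lambda>\<zeta>. hess22 (G \<zeta>) x y) (hess22 g x y)"
    using bl[OF bounded_linear_snd bl[OF bounded_linear_snd H]] by (simp add: hess_def)
qed

lemma sample_variance:
  "mean_sq Dxi (\<lambda>\<xi>. grad1 (F \<xi>) x y - grad1 f x y) \<le> ennreal (\<sigma>f1\<^sup>2)"
  "mean_sq Dxi (\<lambda>\<xi>. grad2 (F \<xi>) x y - grad2 f x y) \<le> ennreal (\<sigma>f1\<^sup>2)"
  "mean_sq Dzeta (\<lambda>\<zeta>. grad2 (G \<zeta>) x y - grad2 g x y) \<le> ennreal (\<sigma>g1\<^sup>2)"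
  "mean_sq Dzeta (\<lambda>\<zeta>. hess12 (G \<zeta>) x y - hess12 g x y) \<le> ennreal (\<sigma>g2\<^sup>2)"
  "mean_sq Dzeta (\<lambda>\<zeta>. hess22 (G \<zeta>) x y - hess22 g x y) \<le> ennreal (\<sigma>g2\<^sup>2)"
proof -
  have F: "mean_sq Dxi (\<lambda>\<xi>. grad_joint (F \<xi>) x y - grad_joint f x y) \<le> ennreal (\<sigma>f1\<^sup>2)"
    and G: "mean_sq Dzeta (\<lambda>\<zeta>. grad_joint (G \<zeta>) x y - grad_joint g x y) \<le> ennreal (\<sigma>g1\<^sup>2)"
    and H: "mean_sq Dzeta (\<lambda>\<zeta>. hess (G \<zeta>) x y - hess g x y) \<le> ennreal (\<sigma>g2\<^sup>2)"
    using variance by (auto simp: variance_assumption_def)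
  have n1: "norm (fst p - fst q) \<le> norm (p - q)" and n2: "norm (snd p - snd q) \<le> norm (p - q)"
    for p q :: "'x::real_normed_vector \<times> 'y::real_normed_vector"
    using norm_fst_component_le[of "p - q"] norm_snd_component_le[of "p - q"] by simp_all
  show "mean_sq Dxi (\<lambda>\<xi>. grad1 (F \<xi>) x y - grad1 f x y) \<le> ennreal (\<sigma>f1\<^sup>2)"
    by (rule order_trans[OF mean_sq_mono F]) (simp add: grad1_eq diff_F diff_f n1)
  show "mean_sq Dxi (\<lambda>\<xi>. grad2 (F \<xi>) x y - grad2 f x y) \<le> ennreal (\<sigma>f1\<^sup>2)"
    by (rule order_trans[OF mean_sq_mono F]) (simp add: grad2_eq diff_F diff_f n2)
  show "mean_sq Dzeta (\<lambda>\<zeta>. grad2 (G \<zeta>) x y - grad2 g x y) \<le> ennreal (\<sigma>g1\<^sup>2)"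
    by (rule order_trans[OF mean_sq_mono G]) (simp add: grad2_eq diff1_G diff1_g n2)
  show "mean_sq Dzeta (\<lambda>\<zeta>. hess12 (G \<zeta>) x y - hess12 g x y) \<le> ennreal (\<sigma>g2\<^sup>2)"
  proof (rule order_trans[OF mean_sq_mono H])
    show "norm (hess12 (G \<zeta>) x y - hess12 g x y) \<le> norm (hess (G \<zeta>) x y - hess g x y)" for \<zeta>
      using order_trans[OF n2[of "fst (hess (G \<zeta>) x y)" "fst (hess g x y)"] n1] by (simp add: hess_def)
  qed
  show "mean_sq Dzeta (\<lambda>\<zeta>. hess22 (G \<zeta>) x y - hess22 g x y) \<le> ennreal (\<sigma>g2\<^sup>2)"
  proof (rule order_trans[OF mean_sq_mono H])
    show "norm (hess22 (G \<zeta>) x y - hess22 g x y) \<le> norm (hess (G \<zeta>) x y - hess g x y)" for \<zeta>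
      using order_trans[OF n2[of "snd (hess (G \<zeta>) x y)" "snd (hess g x y)"] n2] by (simp add: hess_def)
  qed
qed

end

section \<open>Information carried by sets of samples\<close>

primrec outer_index :: "batch \<Rightarrow> nat" where
  "outer_index (B1_inner s k) = k"
| "outer_index (B1 k) = k"
| "outer_index (B2 k) = k"
| "outer_index (B3 k) = k"
| "outer_index (B4 k) = k"

lemma Int_stable_vimages: "Int_stable {X -` A \<inter> \<Omega> |A. A \<in> sets N}"
proof (rule Int_stableI)
  fix A B assume "A \<in> {X -` A \<inter> \<Omega> |A. A \<in> sets N}" "B \<in> {X -` A \<inter> \<Omega> |A. A \<in> sets N}"
  then obtain A' B' where AB: "A = X -` A' \<inter> \<Omega>" "B = X -` B' \<inter> \<Omega>" "A' \<in> sets N" "B' \<in> sets N" by blast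
  then have "A \<inter> B = X -` (A' \<inter> B') \<inter> \<Omega>" "A' \<inter> B' \<in> sets N" by auto
  then show "A \<inter> B \<in> {X -` A \<inter> \<Omega> |A. A \<in> sets N}" by blast
qed

text \<open>A space carrying the initial iterate and all samples of a run. For a set \<open>S\<close> of sources, \<open>info S\<close> is the
\<open>\<sigma>\<close>-algebra that they generate; measurability with respect to \<open>info S\<close> expresses being a function of these
sources, and disjoint sets of sources have independent information.\<close>

locale sampling =
  stochastic_bilevel f g \<mu> Lf0 Lf1 Lg1 Lg2 Cf0 F G Dxi Dzeta \<sigma>f1 \<sigma>g1 \<sigma>g2 + prob_space M
  for f g :: "real^'m \<Rightarrow> real^'n \<Rightarrow> real" and \<mu> Lf0 Lf1 Lg1 Lg2 Cf0
    and F :: "'xi \<Rightarrow> real^'m \<Rightarrow> real^'n \<Rightarrow> real" and G :: "'zeta \<Rightarrow> real^'m \<Rightarrow> real^'n \<Rightarrow> real"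
    and Dxi Dzeta \<sigma>f1 \<sigma>g1 \<sigma>g2 and M :: "'w measure" +
  fixes Z0 :: "'w \<Rightarrow> (real^'m) \<times> (real^'n) \<times> (real^'n)" and K T :: nat and b :: "batch \<Rightarrow> nat"
    and \<xi> :: "nat \<Rightarrow> nat \<Rightarrow> 'w \<Rightarrow> 'xi" and \<zeta> :: "batch \<Rightarrow> nat \<Rightarrow> 'w \<Rightarrow> 'zeta"
  assumes fresh: "fresh_samples M Dxi Dzeta Z0 K T b \<xi> \<zeta>" and Z0_measurable: "Z0 \<in> borel_measurable M"
begin

definition info :: "source set \<Rightarrow> 'w measure" where
  "info S = sigma (space M) (\<Union>s\<in>S. source_events M Dxi Dzeta Z0 \<xi> \<zeta> s)"

lemma source_events_subset: "source_events M Dxi Dzeta Z0 \<xi> \<zeta> s \<subseteq> Pow (space M)"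
  by (cases s) (auto split: batch.splits)

lemma space_info [simp]: "space (info S) = space M"
  and sets_info: "sets (info S) = sigma_sets (space M) (\<Union>s\<in>S. source_events M Dxi Dzeta Z0 \<xi> \<zeta> s)"
proof -
  have "(\<Union>s\<in>S. source_events M Dxi Dzeta Z0 \<xi> \<zeta> s) \<subseteq> Pow (space M)"
    using source_events_subset by blast
  then show "space (info S) = space M"
    "sets (info S) = sigma_sets (space M) (\<Union>s\<in>S. source_events M Dxi Dzeta Z0 \<xi> \<zeta> s)"
    unfolding info_def by (simp_all add: space_measure_of sets_measure_of)
qed

lemma sets_info_subset:
  assumes "S \<subseteq> sources K T b"
  shows "sets (info S) \<subseteq> sets M"
proof -
  have "\<forall>s\<in>sources K T b. source_events M Dxi Dzeta Z0 \<xi> \<zeta> s \<subseteq> sets M"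
    using fresh unfolding fresh_samples_def indep_sets_def by blast
  then have "(\<Union>s\<in>S. source_events M Dxi Dzeta Z0 \<xi> \<zeta> s) \<subseteq> sets M"
    using assms by blast
  then show ?thesis unfolding sets_info by (rule sets.sigma_sets_subset)
qed

lemma Int_stable_source_events: "Int_stable (source_events M Dxi Dzeta Z0 \<xi> \<zeta> s)"
  by (cases s) (auto simp: Int_stable_vimages split: batch.splits)

lemma indep_info:
  assumes "S \<subseteq> sources K T b" "S' \<subseteq> sources K T b" "S \<inter> S' = {}"
  shows "indep_set (sets (info S)) (sets (info S'))"
proof -
  have sub: "(\<Union>j\<in>UNIV. case_bool S S' j) \<subseteq> sources K T b"
    using assms by (auto split: bool.splits)
  have all: "indep_sets (source_events M Dxi Dzeta Z0 \<xi> \<zeta>) (sources K T b)"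
    using fresh by (simp add: fresh_samples_def)
  have "indep_sets (\<lambda>j. sigma_sets (space M) (\<Union>s\<in>case_bool S S' j. source_events M Dxi Dzeta Z0 \<xi> \<zeta> s)) UNIV"
  proof (rule indep_sets_collect_sigma)
    show "indep_sets (source_events M Dxi Dzeta Z0 \<xi> \<zeta>) (\<Union>j\<in>UNIV. case_bool S S' j)"
      by (rule indep_sets_mono_index[OF sub all])
    show "disjoint_family_on (case_bool S S') UNIV"
      using assms(3) by (auto simp: disjoint_family_on_def split: bool.splits)
  qed (rule Int_stable_source_events)
  moreover have "(\<lambda>j. sigma_sets (space M) (\<Union>s\<in>case_bool S S' j. source_events M Dxi Dzeta Z0 \<xi> \<zeta> s))
      = case_bool (sets (info S)) (sets (info S'))"
    by (auto simp: fun_eq_iff sets_info split: bool.split)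
  ultimately show ?thesis unfolding indep_set_def by simp
qed

lemma nn_integral_freeze:
  assumes "S \<subseteq> sources K T b" "S' \<subseteq> sources K T b" "S \<inter> S' = {}"
    and "h \<in> borel_measurable (info S \<Otimes>\<^sub>M info S')"
  shows "(\<integral>\<^sup>+\<omega>. h (\<omega>, \<omega>) \<partial>M) = (\<integral>\<^sup>+\<omega>. \<integral>\<^sup>+\<omega>'. h (\<omega>, \<omega>') \<partial>M \<partial>M)"
  by (rule nn_integral_indep_diagonal[OF space_info sets_info_subset[OF assms(1)] space_info sets_info_subset[OF assms(2)] indep_info[OF assms(1-3)] assms(4)])

lemma measurable_info_imp:
  assumes S: "S \<subseteq> sources K T b" and X: "X \<in> measurable (info S) N"
  shows "X \<in> measurable M N"
proof (rule measurableI)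
  show "X \<omega> \<in> space N" if "\<omega> \<in> space M" for \<omega> using measurable_space[OF X] that by simp
  show "X -` A \<inter> space M \<in> sets M" if "A \<in> sets N" for A
    using measurable_sets[OF X that] sets_info_subset[OF S] by auto
qed

lemma sigma_vimage_info:
  assumes "X \<in> measurable (info S) N"
  shows "sigma_sets (space M) {X -` A \<inter> space M |A. A \<in> sets N} \<subseteq> sets (info S)"
proof -
  have "{X -` A \<inter> space M |A. A \<in> sets N} \<subseteq> sets (info S)"
    using measurable_sets[OF assms] by auto
  from sets.sigma_sets_subset[OF this] show ?thesis by simp
qed

lemma indep_var_info:
  assumes S: "S \<subseteq> sources K T b" "S' \<subseteq> sources K T b" "S \<inter> S' = {}"
    and X: "X \<in> measurable (info S) N" and Y: "Y \<in> measurable (info S') N'"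
  shows "indep_var N X N' Y"
  unfolding indep_var_eq
proof (intro conjI measurable_info_imp[OF S(1) X] measurable_info_imp[OF S(2) Y])
  have ind: "sets (info S) \<subseteq> events" "sets (info S') \<subseteq> events"
    "\<And>a b. a \<in> sets (info S) \<Longrightarrow> b \<in> sets (info S') \<Longrightarrow> prob (a \<inter> b) = prob a * prob b"
    using indep_info[OF S] unfolding indep_sets2_eq by simp_all
  show "indep_set (sigma_sets (space M) {X -` A \<inter> space M |A. A \<in> sets N})
     (sigma_sets (space M) {Y -` A \<inter> space M |A. A \<in> sets N'})"
    unfolding indep_sets2_eq
  proof (intro conjI ballI)
    show "sigma_sets (space M) {X -` A \<inter> space M |A. A \<in> sets N} \<subseteq> events"
      using sigma_vimage_info[OF X] ind(1) by (rule subset_trans)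
    show "sigma_sets (space M) {Y -` A \<inter> space M |A. A \<in> sets N'} \<subseteq> events"
      using sigma_vimage_info[OF Y] ind(2) by (rule subset_trans)
    fix a b assume "a \<in> sigma_sets (space M) {X -` A \<inter> space M |A. A \<in> sets N}"
      "b \<in> sigma_sets (space M) {Y -` A \<inter> space M |A. A \<in> sets N'}"
    then show "prob (a \<inter> b) = prob a * prob b"
      using ind(3) sigma_vimage_info[OF X] sigma_vimage_info[OF Y] by (meson subsetD)
  qed
qed

lemma zeta_measurable: "B \<in> zeta_batches K T \<Longrightarrow> i < b B \<Longrightarrow> \<zeta> B i \<in> measurable M Dzeta"
  and zeta_distr: "B \<in> zeta_batches K T \<Longrightarrow> i < b B \<Longrightarrow> distr M Dzeta (\<zeta> B i) = Dzeta"
  and xi_measurable: "k < K \<Longrightarrow> i < b (B3 k) \<Longrightarrow> \<xi> k i \<in> measurable M Dxi"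
  and xi_distr: "k < K \<Longrightarrow> i < b (B3 k) \<Longrightarrow> distr M Dxi (\<xi> k i) = Dxi"
  using fresh by (auto simp: fresh_samples_def)

lemma zeta_measurable_info:
  assumes B: "B \<in> zeta_batches K T" "i < b B" and S: "Sample B i \<in> S"
  shows "\<zeta> B i \<in> measurable (info S) Dzeta"
proof (rule measurableI)
  show "\<zeta> B i \<omega> \<in> space Dzeta" if "\<omega> \<in> space (info S)" for \<omega>
    using that measurable_space[OF zeta_measurable[OF B]] by simp
  fix A assume A: "A \<in> sets Dzeta"
  have "source_events M Dxi Dzeta Z0 \<xi> \<zeta> (Sample B i) = {\<zeta> B i -` A \<inter> space M |A. A \<in> sets Dzeta}"
    using B by (cases B) (simp_all, auto simp: zeta_batches_def)
  then show "\<zeta> B i -` A \<inter> space (info S) \<in> sets (info S)"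
    using A S unfolding sets_info space_info by (intro sigma_sets.Basic UN_I[of "Sample B i"]) blast+
qed

lemma xi_measurable_info:
  assumes k: "k < K" "i < b (B3 k)" and S: "Sample (B3 k) i \<in> S"
  shows "\<xi> k i \<in> measurable (info S) Dxi"
proof (rule measurableI)
  show "\<xi> k i \<omega> \<in> space Dxi" if "\<omega> \<in> space (info S)" for \<omega>
    using that measurable_space[OF xi_measurable[OF k]] by simp
  fix A assume A: "A \<in> sets Dxi"
  have "source_events M Dxi Dzeta Z0 \<xi> \<zeta> (Sample (B3 k) i) = {\<xi> k i -` A \<inter> space M |A. A \<in> sets Dxi}"
    by auto
  then show "\<xi> k i -` A \<inter> space (info S) \<in> sets (info S)"
    using A S unfolding sets_info space_info by (intro sigma_sets.Basic UN_I[of "Sample (B3 k) i"]) blast+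
qed

lemma Z0_measurable_info:
  assumes S: "Init \<in> S"
  shows "Z0 \<in> borel_measurable (info S)"
proof (rule measurableI)
  fix A :: "((real^'m) \<times> (real^'n) \<times> (real^'n)) set" assume A: "A \<in> sets borel"
  show "Z0 -` A \<inter> space (info S) \<in> sets (info S)"
    using A S unfolding sets_info space_info by (intro sigma_sets.Basic UN_I[of "Init"]) auto
qed simp

lemma Sample_in_sources:
  "B \<in> zeta_batches K T \<Longrightarrow> i < b B \<Longrightarrow> Sample B i \<in> sources K T b"
  "k < K \<Longrightarrow> i < b (B3 k) \<Longrightarrow> Sample (B3 k) i \<in> sources K T b"
  by (auto simp: sources_def xi_batches_def)

lemma transport:
  fixes \<Psi> :: "'z \<Rightarrow> 'b::euclidean_space"
  assumes X: "X \<in> measurable M N" "distr M N X = N" and \<Psi>: "has_bochner_integral N \<Psi> m"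
  shows "has_bochner_integral M (\<lambda>\<omega>. \<Psi> (X \<omega>)) m"
    and "mean_sq M (\<lambda>\<omega>. \<Psi> (X \<omega>) - m) = mean_sq N (\<lambda>z. \<Psi> z - m)"
proof -
  have m: "\<Psi> \<in> borel_measurable N" using \<Psi> by (rule borel_measurable_has_bochner_integral)
  show "has_bochner_integral M (\<lambda>\<omega>. \<Psi> (X \<omega>)) m"
    using \<Psi> integrable_distr_eq[OF X(1) m] integral_distr[OF X(1) m] X(2)
    by (simp add: has_bochner_integral_iff)
  have "mean_sq N (\<lambda>z. \<Psi> z - m) = mean_sq (distr M N X) (\<lambda>z. \<Psi> z - m)" by (simp add: X(2))
  also have "\<dots> = mean_sq M (\<lambda>\<omega>. \<Psi> (X \<omega>) - m)"
    unfolding mean_sq_def using m X(1) by (subst nn_integral_distr) auto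
  finally show "mean_sq M (\<lambda>\<omega>. \<Psi> (X \<omega>) - m) = mean_sq N (\<lambda>z. \<Psi> z - m)" by simp
qed

lemma zeta_batch_variance:
  fixes \<Psi> :: "'zeta \<Rightarrow> 'b::euclidean_space"
  assumes B: "B \<in> zeta_batches K T" "0 < b B" and mean: "has_bochner_integral Dzeta \<Psi> m"
    and var: "mean_sq Dzeta (\<lambda>z. \<Psi> z - m) \<le> ennreal (\<sigma>\<^sup>2)"
  shows "mean_sq M (\<lambda>\<omega>. batch_avg (b B) (\<lambda>i. \<Psi> (\<zeta> B i \<omega>)) - m) \<le> ennreal (\<sigma>\<^sup>2 / real (b B))"
proof (rule batch_variance[OF B(2)])
  fix i assume i: "i < b B"
  note t = transport[OF zeta_measurable[OF B(1) i] zeta_distr[OF B(1) i] mean]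
  show "has_bochner_integral M (\<lambda>\<omega>. \<Psi> (\<zeta> B i \<omega>)) m" by (rule t)
  show "mean_sq M (\<lambda>\<omega>. \<Psi> (\<zeta> B i \<omega>) - m) \<le> ennreal (\<sigma>\<^sup>2)" using t var by simp
  fix j assume j: "j < b B" "i \<noteq> j"
  have m: "\<Psi> \<in> borel_measurable Dzeta" using mean by (rule borel_measurable_has_bochner_integral)
  show "indep_var borel (\<lambda>\<omega>. \<Psi> (\<zeta> B i \<omega>)) borel (\<lambda>\<omega>. \<Psi> (\<zeta> B j \<omega>))"
    by (rule indep_var_info[of "{Sample B i}" "{Sample B j}"])
       (use B i j in \<open>auto intro!: measurable_compose[OF zeta_measurable_info m] Sample_in_sources\<close>)
qed

lemma xi_batch_variance:
  fixes \<Psi> :: "'xi \<Rightarrow> 'b::euclidean_space"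
  assumes k: "k < K" "0 < b (B3 k)" and mean: "has_bochner_integral Dxi \<Psi> m"
    and var: "mean_sq Dxi (\<lambda>z. \<Psi> z - m) \<le> ennreal (\<sigma>\<^sup>2)"
  shows "mean_sq M (\<lambda>\<omega>. batch_avg (b (B3 k)) (\<lambda>i. \<Psi> (\<xi> k i \<omega>)) - m) \<le> ennreal (\<sigma>\<^sup>2 / real (b (B3 k)))"
proof (rule batch_variance[OF k(2)])
  fix i assume i: "i < b (B3 k)"
  note t = transport[OF xi_measurable[OF k(1) i] xi_distr[OF k(1) i] mean]
  show "has_bochner_integral M (\<lambda>\<omega>. \<Psi> (\<xi> k i \<omega>)) m" by (rule t)
  show "mean_sq M (\<lambda>\<omega>. \<Psi> (\<xi> k i \<omega>) - m) \<le> ennreal (\<sigma>\<^sup>2)" using t var by simp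
  fix j assume j: "j < b (B3 k)" "i \<noteq> j"
  have m: "\<Psi> \<in> borel_measurable Dxi" using mean by (rule borel_measurable_has_bochner_integral)
  show "indep_var borel (\<lambda>\<omega>. \<Psi> (\<xi> k i \<omega>)) borel (\<lambda>\<omega>. \<Psi> (\<xi> k j \<omega>))"
    by (rule indep_var_info[of "{Sample (B3 k) i}" "{Sample (B3 k) j}"])
       (use k i j in \<open>auto intro!: measurable_compose[OF xi_measurable_info m] Sample_in_sources\<close>)
qed

end

section \<open>The stochastic inner loop\<close>

lemma sum3_sq_le: "(a + b + c)\<^sup>2 \<le> 3 * a\<^sup>2 + 3 * b\<^sup>2 + 3 * (c :: real)\<^sup>2"
  using sum_squares_ge_zero[of "a - b" "b - c"] zero_le_power2[of "a - c"]
    zero_le_power2[of "a - b"] zero_le_power2[of "b - c"]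
  by (simp add: power2_eq_square algebra_simps)

lemma norm_sum3_sq_le: "norm x \<le> a + b + c \<Longrightarrow> (norm x)\<^sup>2 \<le> 3 * a\<^sup>2 + 3 * b\<^sup>2 + 3 * c\<^sup>2"
  using power_mono[of "norm x" "a + b + c" 2] sum3_sq_le[of a b c] by simp

lemma sum4_sq_le: "(a + b + c + d)\<^sup>2 \<le> 4 * a\<^sup>2 + 4 * b\<^sup>2 + 4 * c\<^sup>2 + 4 * (d :: real)\<^sup>2"
  using zero_le_power2[of "a - c"] zero_le_power2[of "a - b"] zero_le_power2[of "b - c"]
    zero_le_power2[of "a - d"] zero_le_power2[of "b - d"] zero_le_power2[of "c - d"]
  by (simp add: power2_eq_square algebra_simps)

text \<open>Integrates a pointwise bound by two squared norms and a constant; most estimates below are pointwise bounds of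
this shape.\<close>

lemma (in prob_space) nn_integral_sq_combination:
  assumes P: "P \<in> borel_measurable M" "mean_sq M P \<le> ennreal a" "0 \<le> a"
    and Q: "Q \<in> borel_measurable M" "mean_sq M Q \<le> ennreal b" "0 \<le> b"
    and c: "0 \<le> p" "0 \<le> q" "0 \<le> r"
    and le: "\<And>\<omega>. \<omega> \<in> space M \<Longrightarrow> h \<omega> \<le> ennreal (p * (norm (P \<omega>))\<^sup>2 + q * (norm (Q \<omega>))\<^sup>2 + r)"
  shows "(\<integral>\<^sup>+\<omega>. h \<omega> \<partial>M) \<le> ennreal (p * a + q * b + r)"
proof -
  have "(\<integral>\<^sup>+\<omega>. h \<omega> \<partial>M) \<le> (\<integral>\<^sup>+\<omega>. ennreal p * ennreal ((norm (P \<omega>))\<^sup>2) + ennreal q * ennreal ((norm (Q \<omega>))\<^sup>2) + ennreal r \<partial>M)"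
  proof (rule nn_integral_mono)
    fix \<omega> assume "\<omega> \<in> space M"
    from le[OF this]
    show "h \<omega> \<le> ennreal p * ennreal ((norm (P \<omega>))\<^sup>2) + ennreal q * ennreal ((norm (Q \<omega>))\<^sup>2) + ennreal r"
      using c by (simp add: ennreal_plus ennreal_mult)
  qed
  also have "\<dots> = ennreal p * mean_sq M P + ennreal q * mean_sq M Q + ennreal r"
    using P(1) Q(1) by (simp add: mean_sq_def nn_integral_add nn_integral_cmult emeasure_space_1)
  also have "\<dots> \<le> ennreal p * ennreal a + ennreal q * ennreal b + ennreal r"
    using P(2) Q(2) by (intro add_mono mult_left_mono order_refl) auto
  also have "\<dots> = ennreal (p * a + q * b + r)"
    using c P(3) Q(3) by (simp add: ennreal_plus ennreal_mult)
  finally show ?thesis .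
qed

lemma (in prob_space) mean_sq_combination:
  assumes P: "P \<in> borel_measurable M" "mean_sq M P \<le> ennreal a" "0 \<le> a"
    and Q: "Q \<in> borel_measurable M" "mean_sq M Q \<le> ennreal b" "0 \<le> b"
    and c: "0 \<le> p" "0 \<le> q" "0 \<le> r"
    and le: "\<And>\<omega>. \<omega> \<in> space M \<Longrightarrow> (norm (X \<omega>))\<^sup>2 \<le> p * (norm (P \<omega>))\<^sup>2 + q * (norm (Q \<omega>))\<^sup>2 + r"
  shows "mean_sq M X \<le> ennreal (p * a + q * b + r)"
  unfolding mean_sq_def[of M X] by (intro nn_integral_sq_combination[OF P Q c] ennreal_leI le)

lemma batch_avg_measurable:
  fixes h :: "nat \<Rightarrow> 'a \<Rightarrow> 'b::euclidean_space"
  shows "(\<And>i. i < n \<Longrightarrow> h i \<in> borel_measurable N) \<Longrightarrow> (\<lambda>\<nu>. batch_avg n (\<lambda>i. h i \<nu>)) \<in> borel_measurable N"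
  unfolding batch_avg_def by (intro borel_measurable_scaleR borel_measurable_const borel_measurable_sum) auto

lemma inner_iter_measurable:
  fixes H :: "nat \<Rightarrow> 'a \<Rightarrow> real^'n^'n"
  shows "(\<And>s. s < n \<Longrightarrow> H s \<in> borel_measurable N) \<Longrightarrow> d \<in> borel_measurable N \<Longrightarrow>
    (\<lambda>\<nu>. inner_iter \<gamma> (\<lambda>s. H s \<nu>) (d \<nu>) n) \<in> borel_measurable N"
proof (induction n)
  case (Suc n)
  then have "(\<lambda>\<nu>. inner_iter \<gamma> (\<lambda>s. H s \<nu>) (d \<nu>) n) \<in> borel_measurable N" by simp
  moreover have "H n \<in> borel_measurable N" using Suc by simp
  moreover note Suc.prems(2)
  ultimately show ?case
    unfolding inner_iter.simps
    by (intro borel_measurable_add mat_vec_measurable borel_measurable_diff borel_measurable_scaleR borel_measurable_const)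
qed simp

text \<open>With \<open>z = A\<^sup>-\<^sup>1 d\<close> and \<open>v\<^sub>s\<close> the inner iterate, the error satisfies
\<open>v\<^sub>s\<^sub>+\<^sub>1 - z = (I - \<gamma> A) (v\<^sub>s - z) + \<gamma> (A - H\<^sub>s) v\<^sub>s\<close>. Contraction and Young's inequality
with weight \<open>q = \<gamma> \<mu>\<close> bound the mean square by \<open>(1 - q)\<close> times the old one plus \<open>2 \<gamma> / \<mu>\<close> times that of the
noise. The noise is relative to \<open>v\<^sub>s\<close>, hence to \<open>v\<^sub>s - z\<close> and \<open>z\<close>: one part is absorbed by half of the
contraction, the other leaves the stationary error \<open>8 \<tau> / \<mu>\<^sup>2\<close>.\<close>

lemma (in prob_space) mean_sq_inner_iter_error:
  fixes A :: "real^'n^'n" and H :: "nat \<Rightarrow> 'a \<Rightarrow> real^'n^'n"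
  assumes mu: "0 < \<mu>" and \<gamma>: "0 < \<gamma>" "\<gamma> * \<mu> \<le> 1"
    and contr: "\<And>v. norm (v - \<gamma> *\<^sub>R (A *v v)) \<le> (1 - \<gamma> * \<mu>) * norm v"
    and inv: "\<And>\<omega>. \<omega> \<in> space M \<Longrightarrow> A *v z \<omega> = d \<omega>"
    and H: "\<And>s. s < n \<Longrightarrow> H s \<in> borel_measurable M" and d: "d \<in> borel_measurable M" and z: "z \<in> borel_measurable M"
    and noise: "\<And>s. s < n \<Longrightarrow> mean_sq M (\<lambda>\<omega>. (A - H s \<omega>) *v inner_iter \<gamma> (\<lambda>s. H s \<omega>) (d \<omega>) s)
      \<le> ennreal \<tau> * mean_sq M (\<lambda>\<omega>. inner_iter \<gamma> (\<lambda>s. H s \<omega>) (d \<omega>) s)"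
    and \<tau>: "0 \<le> \<tau>" "8 * \<tau> \<le> \<mu>\<^sup>2"
  shows "mean_sq M (\<lambda>\<omega>. inner_iter \<gamma> (\<lambda>s. H s \<omega>) (d \<omega>) n - z \<omega>)
    \<le> ennreal ((1 - \<gamma> * \<mu> / 2) ^ n + 8 * \<tau> / \<mu>\<^sup>2) * mean_sq M z"
  using H noise
proof (induction n)
  case 0
  have "mean_sq M (\<lambda>\<omega>. inner_iter \<gamma> (\<lambda>s. H s \<omega>) (d \<omega>) 0 - z \<omega>) = 1 * mean_sq M z"
    by (simp add: mean_sq_def)
  also have "\<dots> \<le> ennreal (1 + 8 * \<tau> / \<mu>\<^sup>2) * mean_sq M z"
    using \<tau> by (intro mult_right_mono) (auto simp flip: ennreal_1 intro!: ennreal_leI)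
  finally show ?case by simp
next
  case (Suc n)
  define q where "q = \<gamma> * \<mu>"
  have q: "0 < q" "q \<le> 1" using mu \<gamma> by (simp_all add: q_def)
  define v where "v \<omega> = inner_iter \<gamma> (\<lambda>s. H s \<omega>) (d \<omega>) n" for \<omega>
  have vm: "v \<in> borel_measurable M" unfolding v_def
    using Suc.prems(1) d by (intro inner_iter_measurable) auto
  have Hm: "H n \<in> borel_measurable M" using Suc.prems(1) by simp
  define p where "p = (1 - q / 2) ^ n + 8 * \<tau> / \<mu>\<^sup>2"
  have p0: "0 \<le> p" using q \<tau> unfolding p_def by (intro add_nonneg_nonneg zero_le_power) auto
  have IH: "mean_sq M (\<lambda>\<omega>. v \<omega> - z \<omega>) \<le> ennreal p * mean_sq M z"
    using Suc.IH Suc.prems by (simp add: v_def p_def q_def)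
  have err_m: "(\<lambda>\<omega>. v \<omega> - z \<omega>) \<in> borel_measurable M" using vm z by simp
  have noise_m: "(\<lambda>\<omega>. (A - H n \<omega>) *v v \<omega>) \<in> borel_measurable M"
    using vm Hm by (intro mat_vec_measurable borel_measurable_diff borel_measurable_const)
  have sum_m: "mean_sq M v \<le> ennreal (2 * p + 2) * mean_sq M z"
  proof -
    have "mean_sq M v \<le> (\<integral>\<^sup>+\<omega>. ennreal 2 * ennreal ((norm (v \<omega> - z \<omega>))\<^sup>2) + ennreal 2 * ennreal ((norm (z \<omega>))\<^sup>2) \<partial>M)"
      unfolding mean_sq_def
    proof (rule nn_integral_mono)
      fix \<omega>
      have "norm (v \<omega>) \<le> norm (v \<omega> - z \<omega>) + norm (z \<omega>)" using norm_triangle_ineq[of "v \<omega> - z \<omega>" "z \<omega>"] by simp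
      then have "(norm (v \<omega>))\<^sup>2 \<le> (norm (v \<omega> - z \<omega>) + norm (z \<omega>))\<^sup>2" by (intro power_mono) auto
      also have "\<dots> \<le> 2 * (norm (v \<omega> - z \<omega>))\<^sup>2 + 2 * (norm (z \<omega>))\<^sup>2"
        using sum_squares_bound[of "norm (v \<omega> - z \<omega>)" "norm (z \<omega>)"] by (simp add: power2_sum)
      finally show "ennreal ((norm (v \<omega>))\<^sup>2) \<le> ennreal 2 * ennreal ((norm (v \<omega> - z \<omega>))\<^sup>2) + ennreal 2 * ennreal ((norm (z \<omega>))\<^sup>2)"
        by (simp add: ennreal_mult[symmetric] ennreal_plus[symmetric] ennreal_leI del: ennreal_plus ennreal_numeral)
    qed
    also have "\<dots> = ennreal 2 * mean_sq M (\<lambda>\<omega>. v \<omega> - z \<omega>) + ennreal 2 * mean_sq M z"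
      using err_m z by (simp add: mean_sq_def nn_integral_add nn_integral_cmult del: ennreal_numeral)
    also have "\<dots> \<le> ennreal 2 * (ennreal p * mean_sq M z) + ennreal 2 * mean_sq M z"
      by (intro add_mono mult_left_mono IH order_refl) simp
    also have "\<dots> = (ennreal (2 * p) + ennreal 2) * mean_sq M z"
      using p0 by (simp add: ennreal_mult distrib_right mult.assoc del: ennreal_numeral)
    also have "ennreal (2 * p) + ennreal 2 = ennreal (2 * p + 2)" using p0 by (subst ennreal_plus) auto
    finally show ?thesis .
  qed
  have "mean_sq M (\<lambda>\<omega>. inner_iter \<gamma> (\<lambda>s. H s \<omega>) (d \<omega>) (Suc n) - z \<omega>) \<le>
     (\<integral>\<^sup>+\<omega>. ennreal (1 - q) * ennreal ((norm (v \<omega> - z \<omega>))\<^sup>2) + ennreal (2 * \<gamma> / \<mu>) * ennreal ((norm ((A - H n \<omega>) *v v \<omega>))\<^sup>2) \<partial>M)"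
    unfolding mean_sq_def
  proof (rule nn_integral_mono)
    fix \<omega> assume \<omega>: "\<omega> \<in> space M"
    let ?e = "v \<omega> - z \<omega>" and ?n = "(A - H n \<omega>) *v v \<omega>"
    have eq: "inner_iter \<gamma> (\<lambda>s. H s \<omega>) (d \<omega>) (Suc n) - z \<omega> = (?e - \<gamma> *\<^sub>R (A *v ?e)) + \<gamma> *\<^sub>R ?n"
      using inv[OF \<omega>]
      by (simp add: v_def matrix_vector_mult_diff_rdistrib matrix_vector_mult_diff_distrib scaleR_matrix_vector_assoc[symmetric] algebra_simps)
    have "norm (inner_iter \<gamma> (\<lambda>s. H s \<omega>) (d \<omega>) (Suc n) - z \<omega>) \<le> (1 - q) * norm ?e + \<gamma> * norm ?n"
      unfolding eq
      using norm_triangle_ineq[of "?e - \<gamma> *\<^sub>R (A *v ?e)" "\<gamma> *\<^sub>R ?n"] contr[of ?e] \<gamma> by (simp add: q_def)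
    then have "(norm (inner_iter \<gamma> (\<lambda>s. H s \<omega>) (d \<omega>) (Suc n) - z \<omega>))\<^sup>2 \<le> ((1 - q) * norm ?e + \<gamma> * norm ?n)\<^sup>2"
      by (intro power_mono) auto
    also have "\<dots> \<le> (1 - q) * (norm ?e)\<^sup>2 + 2 * \<gamma> / \<mu> * (norm ?n)\<^sup>2"
    proof -
      \<comment> \<open>Young's inequality, as a completed square.\<close>
      have young: "((1 - q) * a + c)\<^sup>2 \<le> (1 - q) * a\<^sup>2 + c\<^sup>2 / q" for a c
      proof -
        have "(1 - q) * a\<^sup>2 + c\<^sup>2 / q - ((1 - q) * a + c)\<^sup>2 = (1 - q) / q * (q * a - c)\<^sup>2"
          using q by (simp add: field_simps power2_eq_square)
        moreover have "0 \<le> (1 - q) / q * (q * a - c)\<^sup>2" using q by simp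
        ultimately show ?thesis by linarith
      qed
      have "(\<gamma> * norm ?n)\<^sup>2 / q = \<gamma> / \<mu> * (norm ?n)\<^sup>2"
        using mu \<gamma> by (simp add: q_def power2_eq_square)
      also have "\<dots> \<le> 2 * \<gamma> / \<mu> * (norm ?n)\<^sup>2" using mu \<gamma> by (intro mult_right_mono divide_right_mono) auto
      finally show ?thesis using young[of "norm ?e" "\<gamma> * norm ?n"] by linarith
    qed
    finally show "ennreal ((norm (inner_iter \<gamma> (\<lambda>s. H s \<omega>) (d \<omega>) (Suc n) - z \<omega>))\<^sup>2) \<le>
        ennreal (1 - q) * ennreal ((norm ?e)\<^sup>2) + ennreal (2 * \<gamma> / \<mu>) * ennreal ((norm ?n)\<^sup>2)"
      using q mu \<gamma> by (simp add: ennreal_mult[symmetric] ennreal_plus[symmetric] ennreal_leI del: ennreal_plus)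
  qed
  also have "\<dots> = ennreal (1 - q) * mean_sq M (\<lambda>\<omega>. v \<omega> - z \<omega>) + ennreal (2 * \<gamma> / \<mu>) * mean_sq M (\<lambda>\<omega>. (A - H n \<omega>) *v v \<omega>)"
    using err_m noise_m by (simp add: mean_sq_def nn_integral_add nn_integral_cmult)
  also have "\<dots> \<le> ennreal (1 - q) * (ennreal p * mean_sq M z) + ennreal (2 * \<gamma> / \<mu>) * (ennreal \<tau> * (ennreal (2 * p + 2) * mean_sq M z))"
  proof (intro add_mono mult_left_mono IH)
    show "mean_sq M (\<lambda>\<omega>. (A - H n \<omega>) *v v \<omega>) \<le> ennreal \<tau> * (ennreal (2 * p + 2) * mean_sq M z)"
      using Suc.prems(2)[of n] sum_m unfolding v_def[symmetric]
      by (meson lessI mult_left_mono order_trans zero_le)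
  qed auto
  also have "\<dots> = ennreal ((1 - q) * p + 2 * \<gamma> / \<mu> * (\<tau> * (2 * p + 2))) * mean_sq M z"
  proof -
    have eqn: "ennreal (1 - q) * ennreal p + ennreal (2 * \<gamma> / \<mu>) * (ennreal \<tau> * ennreal (2 * p + 2)) = ennreal ((1 - q) * p + 2 * \<gamma> / \<mu> * (\<tau> * (2 * p + 2)))"
    proof -
      have "0 \<le> 1 - q" "0 \<le> 2 * \<gamma> / \<mu>" "0 \<le> 2 * p + 2" "0 \<le> \<tau> * (2 * p + 2)" "0 \<le> (1 - q) * p"
        "0 \<le> 2 * \<gamma> / \<mu> * (\<tau> * (2 * p + 2))"
        using q p0 mu \<gamma> \<tau> by simp_all
      then show ?thesis using p0 \<tau> by (simp only: ennreal_mult ennreal_plus)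
    qed
    show ?thesis unfolding eqn[symmetric] by (simp only: distrib_right mult.assoc)
  qed
  also have "\<dots> \<le> ennreal ((1 - \<gamma> * \<mu> / 2) ^ Suc n + 8 * \<tau> / \<mu>\<^sup>2) * mean_sq M z"
  proof (intro mult_right_mono ennreal_leI)
    define \<eta> where "\<eta> = 4 * \<tau> / \<mu>\<^sup>2"
    have \<eta>: "\<eta> \<le> 1 / 2" using \<tau> mu by (simp add: \<eta>_def divide_le_eq)
    have "2 * \<gamma> / \<mu> * (\<tau> * (2 * p + 2)) = q * \<eta> * (p + 1)"
      using mu by (simp add: q_def \<eta>_def power2_eq_square field_simps)
    moreover have "q * \<eta> * p \<le> q * (1 / 2) * p"
      using \<eta> q p0 by (intro mult_right_mono mult_left_mono) auto
    ultimately have "(1 - q) * p + 2 * \<gamma> / \<mu> * (\<tau> * (2 * p + 2)) \<le> (1 - q / 2) * p + q * \<eta>"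
      by (simp add: algebra_simps)
    also have "(1 - q / 2) * p + q * \<eta> = (1 - q / 2) ^ Suc n + 2 * \<eta>"
    proof -
      have pe: "p = (1 - q / 2) ^ n + 2 * \<eta>" by (simp add: p_def \<eta>_def)
      show ?thesis unfolding pe by (simp add: algebra_simps)
    qed
    finally show "(1 - q) * p + 2 * \<gamma> / \<mu> * (\<tau> * (2 * p + 2)) \<le> (1 - \<gamma> * \<mu> / 2) ^ Suc n + 8 * \<tau> / \<mu>\<^sup>2"
      by (simp add: q_def \<eta>_def)
  qed simp
  finally show ?case .
qed

section \<open>One outer iteration from a frozen state\<close>

text \<open>Here \<open>\<tau>\<close> bounds the variances of the averaged inner Hessians and \<open>\<delta>\<close> is the resulting relative mean square
error of the inner loop.\<close>

locale nsbo =
  sampling f g \<mu> Lf0 Lf1 Lg1 Lg2 Cf0 F G Dxi Dzeta \<sigma>f1 \<sigma>g1 \<sigma>g2 M Z0 K T b \<xi> \<zeta>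
  for f g :: "real^'m \<Rightarrow> real^'n \<Rightarrow> real" and \<mu> Lf0 Lf1 Lg1 Lg2 Cf0
    and F :: "'xi \<Rightarrow> real^'m \<Rightarrow> real^'n \<Rightarrow> real" and G :: "'zeta \<Rightarrow> real^'m \<Rightarrow> real^'n \<Rightarrow> real"
    and Dxi Dzeta \<sigma>f1 \<sigma>g1 \<sigma>g2 and M :: "'w measure"
    and Z0 :: "'w \<Rightarrow> (real^'m) \<times> (real^'n) \<times> (real^'n)" and K T :: nat and b :: "batch \<Rightarrow> nat"
    and \<xi> :: "nat \<Rightarrow> nat \<Rightarrow> 'w \<Rightarrow> 'xi" and \<zeta> :: "batch \<Rightarrow> nat \<Rightarrow> 'w \<Rightarrow> 'zeta" +
  fixes \<alpha> \<gamma> \<tau> \<delta> :: real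
  assumes gamma: "0 < \<gamma>" "\<gamma> \<le> 1 / Lg1"
    and batch_pos: "\<And>B. B \<in> zeta_batches K T \<union> xi_batches K \<Longrightarrow> 0 < b B"
    and tau: "0 \<le> \<tau>" "8 * \<tau> \<le> \<mu>\<^sup>2"
    and inner_batch: "\<And>s k. k < K \<Longrightarrow> s \<le> T \<Longrightarrow> \<sigma>g2\<^sup>2 / real (b (B1_inner s k)) \<le> \<tau>"
    and delta: "(1 - \<gamma> * \<mu> / 2) ^ Suc T + 8 * \<tau> / \<mu>\<^sup>2 \<le> \<delta>"
begin

lemma batches_in:
  "k < K \<Longrightarrow> s \<le> T \<Longrightarrow> B1_inner s k \<in> zeta_batches K T"
  "k < K \<Longrightarrow> B1 k \<in> zeta_batches K T"
  "k < K \<Longrightarrow> B2 k \<in> zeta_batches K T"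
  "k < K \<Longrightarrow> B4 k \<in> zeta_batches K T"
  by (auto simp: zeta_batches_def)

lemma batches_pos:
  "k < K \<Longrightarrow> s \<le> T \<Longrightarrow> 0 < b (B1_inner s k)"
  "k < K \<Longrightarrow> 0 < b (B1 k)" "k < K \<Longrightarrow> 0 < b (B2 k)"
  "k < K \<Longrightarrow> 0 < b (B3 k)" "k < K \<Longrightarrow> 0 < b (B4 k)"
  using batches_in batch_pos by (auto simp: xi_batches_def)

lemma \<gamma>\<mu>_le_1: "\<gamma> * \<mu> \<le> 1"
proof -
  have "\<gamma> * \<mu> \<le> \<gamma> * Lg1" using gamma \<mu>_le_Lg1 by simp
  also have "\<dots> \<le> 1" using gamma pos by (simp add: field_simps)
  finally show ?thesis .
qed

lemma delta_nonneg: "0 \<le> \<delta>"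
proof -
  have "0 \<le> (1 - \<gamma> * \<mu> / 2) ^ Suc T + 8 * \<tau> / \<mu>\<^sup>2"
    using \<gamma>\<mu>_le_1 tau pos(1) by (intro add_nonneg_nonneg zero_le_power divide_nonneg_nonneg) auto
  then show ?thesis using delta by linarith
qed

text \<open>The averaged estimators of outer iteration \<open>k\<close> at a point \<open>(x, y)\<close>: \<open>Hin\<close> the Hessians of the inner loop, \<open>Hu\<close>
and \<open>Jx\<close> the matrices multiplying \<open>u\<close>, and \<open>Fx\<close>, \<open>Fy\<close> the two components of the gradient of \<open>F\<close>. State and
sample point are separate arguments so that the state can be frozen.\<close>

definition "Hin s k x y \<omega> = batch_avg (b (B1_inner s k)) (\<lambda>i. hess22 (G (\<zeta> (B1_inner s k) i \<omega>)) x y)"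
definition "Hu k x y \<omega> = batch_avg (b (B1 k)) (\<lambda>i. hess22 (G (\<zeta> (B1 k) i \<omega>)) x y)"
definition "Dy k x y \<omega> = batch_avg (b (B2 k)) (\<lambda>i. grad2 (G (\<zeta> (B2 k) i \<omega>)) x y)"
definition "Jx k x y \<omega> = batch_avg (b (B4 k)) (\<lambda>i. hess12 (G (\<zeta> (B4 k) i \<omega>)) x y)"
definition "Fx k x y \<omega> = batch_avg (b (B3 k)) (\<lambda>i. grad1 (F (\<xi> k i \<omega>)) x y)"
definition "Fy k x y \<omega> = batch_avg (b (B3 k)) (\<lambda>i. grad2 (F (\<xi> k i \<omega>)) x y)"
definition "Du k x y u \<omega> = Hu k x y \<omega> *v u - Fy k x y \<omega>"
definition "Dx k x y u \<omega> = Fx k x y \<omega> - Jx k x y \<omega> *v u"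
definition "ynext k x y \<omega> = y - inner_iter \<gamma> (\<lambda>s. Hin s k x y \<omega>) (Dy k x y \<omega>) (Suc T)"
definition "unext k x y u \<omega> = u - inner_iter \<gamma> (\<lambda>s. Hin s k x y \<omega>) (Du k x y u \<omega>) (Suc T)"

text \<open>The state is measurable on an arbitrary space \<open>N\<close> from which \<open>\<pi>\<close> leads to the sample space. The cases are a
constant state (\<open>\<pi>\<close> the identity), the iterates as functions of the past, and the product of past and present
information (\<open>\<pi>\<close> the second projection).\<close>

context
  fixes N :: "'v measure" and \<pi> :: "'v \<Rightarrow> 'w" and x :: "'v \<Rightarrow> real^'m" and y u :: "'v \<Rightarrow> real^'n" and k :: nat
  assumes xm: "x \<in> borel_measurable N" and ym: "y \<in> borel_measurable N" and um: "u \<in> borel_measurable N"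
begin

lemma Hin_measurable:
  "(\<And>i. i < b (B1_inner s k) \<Longrightarrow> (\<lambda>\<nu>. \<zeta> (B1_inner s k) i (\<pi> \<nu>)) \<in> measurable N Dzeta) \<Longrightarrow>
    (\<lambda>\<nu>. Hin s k (x \<nu>) (y \<nu>) (\<pi> \<nu>)) \<in> borel_measurable N"
  unfolding Hin_def by (intro batch_avg_measurable hess22_measurable[OF G_measurable diff1_G diff_G] xm ym)

lemma Hu_measurable:
  "(\<And>i. i < b (B1 k) \<Longrightarrow> (\<lambda>\<nu>. \<zeta> (B1 k) i (\<pi> \<nu>)) \<in> measurable N Dzeta) \<Longrightarrow>
    (\<lambda>\<nu>. Hu k (x \<nu>) (y \<nu>) (\<pi> \<nu>)) \<in> borel_measurable N"
  unfolding Hu_def by (intro batch_avg_measurable hess22_measurable[OF G_measurable diff1_G diff_G] xm ym)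

lemma Jx_measurable:
  "(\<And>i. i < b (B4 k) \<Longrightarrow> (\<lambda>\<nu>. \<zeta> (B4 k) i (\<pi> \<nu>)) \<in> measurable N Dzeta) \<Longrightarrow>
    (\<lambda>\<nu>. Jx k (x \<nu>) (y \<nu>) (\<pi> \<nu>)) \<in> borel_measurable N"
  unfolding Jx_def by (intro batch_avg_measurable hess12_measurable[OF G_measurable diff1_G diff_G] xm ym)

lemma Dy_measurable:
  "(\<And>i. i < b (B2 k) \<Longrightarrow> (\<lambda>\<nu>. \<zeta> (B2 k) i (\<pi> \<nu>)) \<in> measurable N Dzeta) \<Longrightarrow>
    (\<lambda>\<nu>. Dy k (x \<nu>) (y \<nu>) (\<pi> \<nu>)) \<in> borel_measurable N"
  unfolding Dy_def by (intro batch_avg_measurable grad2_measurable[OF G_measurable diff1_G] xm ym)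

lemma Fx_measurable:
  "(\<And>i. i < b (B3 k) \<Longrightarrow> (\<lambda>\<nu>. \<xi> k i (\<pi> \<nu>)) \<in> measurable N Dxi) \<Longrightarrow>
    (\<lambda>\<nu>. Fx k (x \<nu>) (y \<nu>) (\<pi> \<nu>)) \<in> borel_measurable N"
  unfolding Fx_def by (intro batch_avg_measurable grad1_measurable[OF F_measurable diff_F] xm ym)

lemma Fy_measurable:
  "(\<And>i. i < b (B3 k) \<Longrightarrow> (\<lambda>\<nu>. \<xi> k i (\<pi> \<nu>)) \<in> measurable N Dxi) \<Longrightarrow>
    (\<lambda>\<nu>. Fy k (x \<nu>) (y \<nu>) (\<pi> \<nu>)) \<in> borel_measurable N"
  unfolding Fy_def by (intro batch_avg_measurable grad2_measurable[OF F_measurable diff_F] xm ym)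

lemma Du_measurable:
  "(\<And>i. i < b (B1 k) \<Longrightarrow> (\<lambda>\<nu>. \<zeta> (B1 k) i (\<pi> \<nu>)) \<in> measurable N Dzeta) \<Longrightarrow>
   (\<And>i. i < b (B3 k) \<Longrightarrow> (\<lambda>\<nu>. \<xi> k i (\<pi> \<nu>)) \<in> measurable N Dxi) \<Longrightarrow>
    (\<lambda>\<nu>. Du k (x \<nu>) (y \<nu>) (u \<nu>) (\<pi> \<nu>)) \<in> borel_measurable N"
  unfolding Du_def by (intro borel_measurable_diff mat_vec_measurable Hu_measurable Fy_measurable um)

lemma Dx_measurable:
  "(\<And>i. i < b (B4 k) \<Longrightarrow> (\<lambda>\<nu>. \<zeta> (B4 k) i (\<pi> \<nu>)) \<in> measurable N Dzeta) \<Longrightarrow>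
   (\<And>i. i < b (B3 k) \<Longrightarrow> (\<lambda>\<nu>. \<xi> k i (\<pi> \<nu>)) \<in> measurable N Dxi) \<Longrightarrow>
    (\<lambda>\<nu>. Dx k (x \<nu>) (y \<nu>) (u \<nu>) (\<pi> \<nu>)) \<in> borel_measurable N"
  unfolding Dx_def by (intro borel_measurable_diff mat_vec_measurable Jx_measurable Fx_measurable um)

lemma ynext_measurable:
  "(\<And>B i. B \<in> zeta_batches K T \<Longrightarrow> outer_index B = k \<Longrightarrow> i < b B \<Longrightarrow> (\<lambda>\<nu>. \<zeta> B i (\<pi> \<nu>)) \<in> measurable N Dzeta) \<Longrightarrow>
   k < K \<Longrightarrow> (\<lambda>\<nu>. ynext k (x \<nu>) (y \<nu>) (\<pi> \<nu>)) \<in> borel_measurable N"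
  unfolding ynext_def
  by (intro borel_measurable_diff ym inner_iter_measurable Hin_measurable Dy_measurable) (auto simp: batches_in)

lemma unext_measurable:
  "(\<And>B i. B \<in> zeta_batches K T \<Longrightarrow> outer_index B = k \<Longrightarrow> i < b B \<Longrightarrow> (\<lambda>\<nu>. \<zeta> B i (\<pi> \<nu>)) \<in> measurable N Dzeta) \<Longrightarrow>
   (\<And>i. i < b (B3 k) \<Longrightarrow> (\<lambda>\<nu>. \<xi> k i (\<pi> \<nu>)) \<in> measurable N Dxi) \<Longrightarrow>
   k < K \<Longrightarrow> (\<lambda>\<nu>. unext k (x \<nu>) (y \<nu>) (u \<nu>) (\<pi> \<nu>)) \<in> borel_measurable N"
  unfolding unext_def
  by (intro borel_measurable_diff um inner_iter_measurable Hin_measurable Du_measurable) (auto simp: batches_in)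

end

lemma measurable_info_mono:
  assumes "S \<subseteq> S'" and X: "X \<in> measurable (info S) N"
  shows "X \<in> measurable (info S') N"
proof (rule measurableI)
  show "X \<omega> \<in> space N" if "\<omega> \<in> space (info S')" for \<omega> using measurable_space[OF X] that by simp
  have "sets (info S) \<subseteq> sets (info S')"
    unfolding sets_info using assms(1) by (intro sigma_sets_mono') blast
  then show "X -` A \<inter> space (info S') \<in> sets (info S')" if "A \<in> sets N" for A
    using measurable_sets[OF X that] by auto
qed

lemma mean_sq_matrix_noise:
  fixes B :: "'w \<Rightarrow> real^'n^'k"
  assumes "B \<in> borel_measurable M" "mean_sq M B \<le> ennreal a" "0 \<le> a"
  shows "mean_sq M (\<lambda>\<omega>. B \<omega> *v v) \<le> ennreal (a * (norm v)\<^sup>2)"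
proof -
  have "mean_sq M (\<lambda>\<omega>. B \<omega> *v v) \<le> ennreal ((norm v)\<^sup>2 * a + 0 * 0 + 0)"
  proof (rule mean_sq_combination[where P = B and Q = "\<lambda>_. 0 :: real"])
    show "(norm (B \<omega> *v v))\<^sup>2 \<le> (norm v)\<^sup>2 * (norm (B \<omega>))\<^sup>2 + 0 * (norm (0::real))\<^sup>2 + 0" for \<omega>
      using power_mono[OF norm_matrix_vector_mult_le[of "B \<omega>" v], of 2] by (simp add: power_mult_distrib mult.commute)
  qed (use assms in \<open>auto simp: mean_sq_def\<close>)
  then show ?thesis by (simp add: mult.commute)
qed

context
  fixes k :: nat and x :: "real^'m" and y u :: "real^'n"
  assumes k: "k < K"
begin

abbreviation "Ai \<equiv> matrix_inv (hess22 g x y)"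
abbreviation "ey \<equiv> norm (y - ys x)"
abbreviation "eu \<equiv> norm (u - us x)"

lemma
  shows Hin_m: "s \<le> T \<Longrightarrow> Hin s k x y \<in> borel_measurable M" and Hu_m: "Hu k x y \<in> borel_measurable M"
    and Dy_m: "Dy k x y \<in> borel_measurable M" and Jx_m: "Jx k x y \<in> borel_measurable M"
    and Fx_m: "Fx k x y \<in> borel_measurable M" and Fy_m: "Fy k x y \<in> borel_measurable M"
proof -
  note c = borel_measurable_const[of x M] borel_measurable_const[of y M] borel_measurable_const[of u M]
  note z = zeta_measurable[OF batches_in(1)[OF k]] zeta_measurable[OF batches_in(2)[OF k]]
    zeta_measurable[OF batches_in(3)[OF k]] zeta_measurable[OF batches_in(4)[OF k]] xi_measurable[OF k]
  show "s \<le> T \<Longrightarrow> Hin s k x y \<in> borel_measurable M" by (rule Hin_measurable[OF c, where \<pi> = "\<lambda>\<omega>. \<omega>", OF z(1)])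
  show "Hu k x y \<in> borel_measurable M" by (rule Hu_measurable[OF c, where \<pi> = "\<lambda>\<omega>. \<omega>", OF z(2)])
  show "Dy k x y \<in> borel_measurable M" by (rule Dy_measurable[OF c, where \<pi> = "\<lambda>\<omega>. \<omega>", OF z(3)])
  show "Jx k x y \<in> borel_measurable M" by (rule Jx_measurable[OF c, where \<pi> = "\<lambda>\<omega>. \<omega>", OF z(4)])
  show "Fx k x y \<in> borel_measurable M" by (rule Fx_measurable[OF c, where \<pi> = "\<lambda>\<omega>. \<omega>", OF z(5)])
  show "Fy k x y \<in> borel_measurable M" by (rule Fy_measurable[OF c, where \<pi> = "\<lambda>\<omega>. \<omega>", OF z(5)])
qed

lemma
  shows Hin_var: "s \<le> T \<Longrightarrow> mean_sq M (\<lambda>\<omega>. Hin s k x y \<omega> - hess22 g x y) \<le> ennreal (\<sigma>g2\<^sup>2 / real (b (B1_inner s k)))"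
  and Hu_var: "mean_sq M (\<lambda>\<omega>. Hu k x y \<omega> - hess22 g x y) \<le> ennreal (\<sigma>g2\<^sup>2 / real (b (B1 k)))"
  and Dy_var: "mean_sq M (\<lambda>\<omega>. Dy k x y \<omega> - grad2 g x y) \<le> ennreal (\<sigma>g1\<^sup>2 / real (b (B2 k)))"
  and Jx_var: "mean_sq M (\<lambda>\<omega>. Jx k x y \<omega> - hess12 g x y) \<le> ennreal (\<sigma>g2\<^sup>2 / real (b (B4 k)))"
  and Fx_var: "mean_sq M (\<lambda>\<omega>. Fx k x y \<omega> - grad1 f x y) \<le> ennreal (\<sigma>f1\<^sup>2 / real (b (B3 k)))"
  and Fy_var: "mean_sq M (\<lambda>\<omega>. Fy k x y \<omega> - grad2 f x y) \<le> ennreal (\<sigma>f1\<^sup>2 / real (b (B3 k)))"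
  unfolding Hin_def Hu_def Dy_def Jx_def Fx_def Fy_def
  by (rule zeta_batch_variance[OF batches_in(1)[OF k] batches_pos(1)[OF k] unbiased(5) sample_variance(5)], assumption, assumption)
     (rule zeta_batch_variance[OF batches_in(2)[OF k] batches_pos(2)[OF k] unbiased(5) sample_variance(5)]
       zeta_batch_variance[OF batches_in(3)[OF k] batches_pos(3)[OF k] unbiased(3) sample_variance(3)]
       zeta_batch_variance[OF batches_in(4)[OF k] batches_pos(5)[OF k] unbiased(4) sample_variance(4)]
       xi_batch_variance[OF k batches_pos(4)[OF k] unbiased(1) sample_variance(1)]
       xi_batch_variance[OF k batches_pos(4)[OF k] unbiased(2) sample_variance(2)])+

text \<open>The inner iterate depends on \<open>d\<close> and on earlier inner batches, all independent of the batch of step \<open>s\<close>;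
with the iterate frozen, the noise is a fixed vector multiplied by a centred matrix.\<close>

lemma inner_loop_noise:
  assumes s: "s \<le> T" and S0: "S0 \<subseteq> sources K T b" "\<And>s i. Sample (B1_inner s k) i \<notin> S0"
    and d: "d \<in> borel_measurable (info S0)"
  shows "mean_sq M (\<lambda>\<omega>. (hess22 g x y - Hin s k x y \<omega>) *v inner_iter \<gamma> (\<lambda>s. Hin s k x y \<omega>) (d \<omega>) s)
    \<le> ennreal \<tau> * mean_sq M (\<lambda>\<omega>. inner_iter \<gamma> (\<lambda>s. Hin s k x y \<omega>) (d \<omega>) s)"
proof -
  define S where "S = S0 \<union> {Sample (B1_inner s' k) i |s' i. s' < s \<and> i < b (B1_inner s' k)}"
  define S' where "S' = {Sample (B1_inner s k) i |i. i < b (B1_inner s k)}"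
  define v where "v \<omega> = inner_iter \<gamma> (\<lambda>s. Hin s k x y \<omega>) (d \<omega>) s" for \<omega>
  define h where "h p = ennreal ((norm ((hess22 g x y - Hin s k x y (snd p)) *v v (fst p)))\<^sup>2)" for p :: "'w \<times> 'w"
  have S_sub: "S \<subseteq> sources K T b"
    unfolding S_def using S0(1) Sample_in_sources(1)[OF batches_in(1)[OF k]] s by auto
  have S'_sub: "S' \<subseteq> sources K T b"
    unfolding S'_def using Sample_in_sources(1)[OF batches_in(1)[OF k s]] by auto
  have disj: "S \<inter> S' = {}" unfolding S_def S'_def using S0(2) by auto
  have vm: "v \<in> borel_measurable (info S)"
    unfolding v_def
  proof (rule inner_iter_measurable)
    show "d \<in> borel_measurable (info S)"
      by (rule measurable_info_mono[OF _ d]) (simp add: S_def)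
    fix s' assume s': "s' < s"
    show "Hin s' k x y \<in> borel_measurable (info S)"
    proof (rule Hin_measurable[where N = "info S" and x = "\<lambda>_. x" and y = "\<lambda>_. y" and u = "\<lambda>_. u" and \<pi> = "\<lambda>\<omega>. \<omega>"])
      fix i assume "i < b (B1_inner s' k)"
      then show "\<zeta> (B1_inner s' k) i \<in> measurable (info S) Dzeta"
        using s s' by (intro zeta_measurable_info batches_in k) (auto simp: S_def)
    qed simp_all
  qed
  have Hm: "(\<lambda>p. Hin s k x y (snd p)) \<in> borel_measurable (info S \<Otimes>\<^sub>M info S')"
  proof (rule Hin_measurable[where N = "info S \<Otimes>\<^sub>M info S'" and x = "\<lambda>_. x" and y = "\<lambda>_. y" and u = "\<lambda>_. u" and \<pi> = snd])
    fix i assume "i < b (B1_inner s k)"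
    then have "\<zeta> (B1_inner s k) i \<in> measurable (info S') Dzeta"
      using s by (intro zeta_measurable_info batches_in k) (auto simp: S'_def)
    then show "(\<lambda>p. \<zeta> (B1_inner s k) i (snd p)) \<in> measurable (info S \<Otimes>\<^sub>M info S') Dzeta"
      by (rule measurable_compose[OF measurable_snd])
  qed simp_all
  have hm: "h \<in> borel_measurable (info S \<Otimes>\<^sub>M info S')"
  proof -
    have "(\<lambda>p. (hess22 g x y - Hin s k x y (snd p)) *v v (fst p)) \<in> borel_measurable (info S \<Otimes>\<^sub>M info S')"
      by (intro mat_vec_measurable borel_measurable_diff borel_measurable_const Hm measurable_compose[OF measurable_fst vm])
    then show ?thesis unfolding h_def by measurable
  qed
  have "mean_sq M (\<lambda>\<omega>. (hess22 g x y - Hin s k x y \<omega>) *v v \<omega>) = (\<integral>\<^sup>+\<omega>. h (\<omega>, \<omega>) \<partial>M)"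
    by (simp add: mean_sq_def h_def)
  also have "\<dots> = (\<integral>\<^sup>+\<omega>. \<integral>\<^sup>+\<omega>'. h (\<omega>, \<omega>') \<partial>M \<partial>M)"
    by (rule nn_integral_freeze[OF S_sub S'_sub disj hm])
  also have "\<dots> \<le> (\<integral>\<^sup>+\<omega>. ennreal \<tau> * ennreal ((norm (v \<omega>))\<^sup>2) \<partial>M)"
  proof (rule nn_integral_mono)
    fix \<omega>
    have "mean_sq M (\<lambda>\<omega>'. hess22 g x y - Hin s k x y \<omega>') \<le> ennreal \<tau>"
      using order_trans[OF Hin_var[OF s] ennreal_leI[OF inner_batch[OF k s]]]
      by (simp add: mean_sq_def norm_minus_commute)
    then have "mean_sq M (\<lambda>\<omega>'. (hess22 g x y - Hin s k x y \<omega>') *v v \<omega>) \<le> ennreal (\<tau> * (norm (v \<omega>))\<^sup>2)"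
      using tau Hin_m[OF s] by (intro mean_sq_matrix_noise) auto
    then show "(\<integral>\<^sup>+\<omega>'. h (\<omega>, \<omega>') \<partial>M) \<le> ennreal \<tau> * ennreal ((norm (v \<omega>))\<^sup>2)"
      using tau by (simp add: mean_sq_def h_def ennreal_mult)
  qed
  also have "\<dots> = ennreal \<tau> * mean_sq M v"
    using measurable_info_imp[OF S_sub vm] unfolding mean_sq_def by (intro nn_integral_cmult) measurable
  finally show ?thesis by (simp add: v_def[abs_def])
qed

lemma inner_loop_error:
  assumes S0: "S0 \<subseteq> sources K T b" "\<And>s i. Sample (B1_inner s k) i \<notin> S0"
    and d: "d \<in> borel_measurable (info S0)"
  shows "mean_sq M (\<lambda>\<omega>. inner_iter \<gamma> (\<lambda>s. Hin s k x y \<omega>) (d \<omega>) (Suc T) - Ai *v d \<omega>)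
    \<le> ennreal \<delta> * mean_sq M (\<lambda>\<omega>. Ai *v d \<omega>)"
proof -
  have dm: "d \<in> borel_measurable M" by (rule measurable_info_imp[OF S0(1) d])
  have zm: "(\<lambda>\<omega>. Ai *v d \<omega>) \<in> borel_measurable M" by (intro mat_vec_measurable borel_measurable_const dm)
  have "mean_sq M (\<lambda>\<omega>. inner_iter \<gamma> (\<lambda>s. Hin s k x y \<omega>) (d \<omega>) (Suc T) - Ai *v d \<omega>)
    \<le> ennreal ((1 - \<gamma> * \<mu> / 2) ^ Suc T + 8 * \<tau> / \<mu>\<^sup>2) * mean_sq M (\<lambda>\<omega>. Ai *v d \<omega>)"
    by (rule mean_sq_inner_iter_error[OF pos(1) gamma(1) \<gamma>\<mu>_le_1 gradient_step_contraction[OF gamma] Ainv(1) _ dm zm _ tau])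
       (auto intro!: Hin_m inner_loop_noise[OF _ S0 d])
  also have "\<dots> \<le> ennreal \<delta> * mean_sq M (\<lambda>\<omega>. Ai *v d \<omega>)"
    by (intro mult_right_mono ennreal_leI delta) simp
  finally show ?thesis .
qed

lemma Ainv_noise:
  assumes "X \<in> borel_measurable M" "mean_sq M X \<le> ennreal a" "0 \<le> a"
  shows "mean_sq M (\<lambda>\<omega>. Ai *v X \<omega>) \<le> ennreal (a / \<mu>\<^sup>2)"
proof -
  have "mean_sq M (\<lambda>\<omega>. Ai *v X \<omega>) \<le> ennreal (1 / \<mu>\<^sup>2 * a + 0 * 0 + 0)"
  proof (rule mean_sq_combination[where P = X and Q = "\<lambda>_. 0 :: real"])
    show "(norm (Ai *v X \<omega>))\<^sup>2 \<le> 1 / \<mu>\<^sup>2 * (norm (X \<omega>))\<^sup>2 + 0 * (norm (0::real))\<^sup>2 + 0" for \<omega>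
      using power_mono[OF Ainv(3)[of x y "X \<omega>"], of 2] by (simp add: power_divide)
  qed (use assms in \<open>auto simp: mean_sq_def\<close>)
  then show ?thesis by simp
qed

text \<open>The error after the update is the Newton error, minus \<open>A\<^sup>-\<^sup>1\<close> times the noise of \<open>D\<^sub>y\<close>, minus the error of the inner
loop. Only the first moment is bounded: in the frozen state the inner error is relative to the Newton step,
which is at most \<open>|y - y\<^sup>*|\<close> plus the Newton error, and not merely \<open>\<kappa> |y - y\<^sup>*|\<close>. A constant accuracy
\<open>\<delta>\<close> of the inner loop is sufficient for this reason.\<close>

lemma y_update_error:
  assumes \<theta>: "0 \<le> \<theta>" "2 * \<delta> \<le> \<theta>\<^sup>2"
  shows "mean_norm M (\<lambda>\<omega>. ynext k x y \<omega> - ys x) \<le>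
    ennreal ((1 + \<theta>) * (Lg2 / \<mu> * ey\<^sup>2) + (1 + \<theta>) * sqrt (\<sigma>g1\<^sup>2 / real (b (B2 k)) / \<mu>\<^sup>2) + \<theta> * ey)"
proof -
  define V where "V = \<sigma>g1\<^sup>2 / real (b (B2 k)) / \<mu>\<^sup>2"
  define z where "z = Ai *v grad2 g x y"
  define n where "n \<omega> = Ai *v (Dy k x y \<omega> - grad2 g x y)" for \<omega>
  define e where "e \<omega> = inner_iter \<gamma> (\<lambda>s. Hin s k x y \<omega>) (Dy k x y \<omega>) (Suc T) - Ai *v Dy k x y \<omega>" for \<omega>
  define S0 where "S0 = {Sample (B2 k) i |i. i < b (B2 k)}"
  have V: "0 \<le> V" by (simp add: V_def)
  have S0: "S0 \<subseteq> sources K T b" "\<And>s i. Sample (B1_inner s k) i \<notin> S0"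
    using Sample_in_sources(1)[OF batches_in(3)[OF k]] by (auto simp: S0_def)
  have dm: "Dy k x y \<in> borel_measurable (info S0)"
    by (rule Dy_measurable[where N = "info S0" and x = "\<lambda>_. x" and y = "\<lambda>_. y" and u = "\<lambda>_. u" and \<pi> = "\<lambda>\<omega>. \<omega>"])
       (auto intro!: zeta_measurable_info batches_in k simp: S0_def)
  have nm: "n \<in> borel_measurable M" unfolding n_def by (intro mat_vec_measurable borel_measurable_const borel_measurable_diff Dy_m)
  have em: "e \<in> borel_measurable M" unfolding e_def
    by (intro borel_measurable_diff mat_vec_measurable borel_measurable_const Dy_m inner_iter_measurable Hin_m) simp
  have n_sq: "mean_sq M n \<le> ennreal V"
    unfolding n_def V_def by (rule Ainv_noise[OF _ Dy_var]) (intro borel_measurable_diff borel_measurable_const Dy_m, simp)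
  have zn: "Ai *v Dy k x y \<omega> = z + n \<omega>" for \<omega> by (simp add: z_def n_def matrix_vector_mult_diff_distrib)
  have "mean_sq M (\<lambda>\<omega>. Ai *v Dy k x y \<omega>) \<le> ennreal (2 * V + 0 * 0 + 2 * (norm z)\<^sup>2)"
  proof (rule mean_sq_combination[where P = n and Q = "\<lambda>_. 0 :: real"])
    show "(norm (Ai *v Dy k x y \<omega>))\<^sup>2 \<le> 2 * (norm (n \<omega>))\<^sup>2 + 0 * (norm (0::real))\<^sup>2 + 2 * (norm z)\<^sup>2" for \<omega>
      using power_mono[OF norm_triangle_ineq[of z "n \<omega>"], of 2] sum_squares_bound[of "norm z" "norm (n \<omega>)"]
      unfolding zn by (simp add: power2_sum)
  qed (use V nm n_sq in \<open>auto simp: mean_sq_def\<close>)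
  then have "mean_sq M e \<le> ennreal \<delta> * ennreal (2 * V + 2 * (norm z)\<^sup>2)"
    unfolding e_def using inner_loop_error[OF S0 dm] by (simp add: order_trans[OF _ mult_left_mono])
  also have "\<dots> = ennreal (\<delta> * (2 * V + 2 * (norm z)\<^sup>2))"
    using delta_nonneg V by (intro ennreal_mult[symmetric]) auto
  also have "\<dots> \<le> ennreal ((\<theta> * (sqrt V + norm z))\<^sup>2)"
  proof (rule ennreal_leI)
    have "\<delta> * (2 * V + 2 * (norm z)\<^sup>2) = (2 * \<delta>) * (V + (norm z)\<^sup>2)" by (simp add: algebra_simps)
    also have "\<dots> \<le> \<theta>\<^sup>2 * (V + (norm z)\<^sup>2)" using V by (intro mult_right_mono \<theta>) auto
    also have "\<dots> \<le> \<theta>\<^sup>2 * (sqrt V + norm z)\<^sup>2" using V by (intro mult_left_mono) (auto simp: power2_sum)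
    finally show "\<delta> * (2 * V + 2 * (norm z)\<^sup>2) \<le> (\<theta> * (sqrt V + norm z))\<^sup>2" by (simp add: power_mult_distrib)
  qed
  finally have e_norm: "mean_norm M e \<le> ennreal (\<theta> * (sqrt V + norm z))"
    using mean_norm_le_sqrt[OF em, of "(\<theta> * (sqrt V + norm z))\<^sup>2"] \<theta> V by simp
  have n_norm: "mean_norm M n \<le> ennreal (sqrt V)" by (rule mean_norm_le_sqrt[OF nm V n_sq])
  have newton: "norm (y - z - ys x) \<le> Lg2 / \<mu> * ey\<^sup>2" unfolding z_def by (rule newton_step_error)
  have z_le: "norm z \<le> ey + Lg2 / \<mu> * ey\<^sup>2"
  proof -
    have "z = (y - ys x) - (y - z - ys x)" by simp
    then have "norm z \<le> ey + norm (y - z - ys x)" by (metis norm_triangle_ineq4)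
    then show ?thesis using newton by simp
  qed
  have "mean_norm M (\<lambda>\<omega>. ynext k x y \<omega> - ys x) \<le>
      (\<integral>\<^sup>+\<omega>. ennreal (Lg2 / \<mu> * ey\<^sup>2) + ennreal (norm (n \<omega>)) + ennreal (norm (e \<omega>)) \<partial>M)"
    unfolding mean_norm_def
  proof (rule nn_integral_mono)
    fix \<omega>
    have eq: "ynext k x y \<omega> - ys x = (y - z - ys x) - n \<omega> - e \<omega>"
      using zn[of \<omega>] by (simp add: ynext_def e_def)
    have "norm (ynext k x y \<omega> - ys x) \<le> norm (y - z - ys x) + norm (n \<omega>) + norm (e \<omega>)"
      unfolding eq using norm_triangle_ineq4[of "y - z - ys x - n \<omega>" "e \<omega>"] norm_triangle_ineq4[of "y - z - ys x" "n \<omega>"] by linarith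
    then have "norm (ynext k x y \<omega> - ys x) \<le> Lg2 / \<mu> * ey\<^sup>2 + norm (n \<omega>) + norm (e \<omega>)"
      using newton by linarith
    from ennreal_leI[OF this]
    show "ennreal (norm (ynext k x y \<omega> - ys x)) \<le> ennreal (Lg2 / \<mu> * ey\<^sup>2) + ennreal (norm (n \<omega>)) + ennreal (norm (e \<omega>))"
      using pos by (simp add: ennreal_plus)
  qed
  also have "\<dots> = ennreal (Lg2 / \<mu> * ey\<^sup>2) + mean_norm M n + mean_norm M e"
    using nm em by (simp add: mean_norm_def nn_integral_add emeasure_space_1)
  also have "\<dots> \<le> ennreal (Lg2 / \<mu> * ey\<^sup>2) + ennreal (sqrt V) + ennreal (\<theta> * (sqrt V + norm z))"
    by (intro add_mono order_refl n_norm e_norm)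
  also have "\<dots> = ennreal (Lg2 / \<mu> * ey\<^sup>2 + sqrt V + \<theta> * (sqrt V + norm z))"
    using pos \<theta> V by (simp add: ennreal_plus)
  also have "\<dots> \<le> ennreal ((1 + \<theta>) * (Lg2 / \<mu> * ey\<^sup>2) + (1 + \<theta>) * sqrt V + \<theta> * ey)"
  proof (rule ennreal_leI)
    have "c + sqrt V + \<theta> * (sqrt V + norm z) \<le> (1 + \<theta>) * c + (1 + \<theta>) * sqrt V + \<theta> * ey" if "norm z \<le> ey + c" for c
      using mult_left_mono[OF that \<theta>(1)] by (simp add: algebra_simps)
    from this[OF z_le]
    show "Lg2 / \<mu> * ey\<^sup>2 + sqrt V + \<theta> * (sqrt V + norm z) \<le> (1 + \<theta>) * (Lg2 / \<mu> * ey\<^sup>2) + (1 + \<theta>) * sqrt V + \<theta> * ey" .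
  qed
  finally show ?thesis by (simp add: V_def)
qed

text \<open>An exact update would replace \<open>u\<close> by \<open>A\<^sup>-\<^sup>1 \<nabla>\<^sub>2 f (x, y)\<close>, independently of the old \<open>u\<close>. The old error
\<open>|u - u\<^sup>*|\<close> reappears only through the relative error of the inner loop and through the noise of the Hessian
that multiplies \<open>u\<close>.\<close>

lemma u_update_error:
  assumes \<delta>: "9 * \<delta> \<le> 1 / 16"
  shows "mean_sq M (\<lambda>\<omega>. unext k x y u \<omega> - us x) \<le>
    ennreal (4 * (L1 / \<mu> * ey)\<^sup>2 + 4 * ((2 * (\<sigma>g2\<^sup>2 / real (b (B1 k)) * (norm u)\<^sup>2) + 2 * (\<sigma>f1\<^sup>2 / real (b (B3 k)))) / \<mu>\<^sup>2) + eu\<^sup>2 / 16)"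
proof -
  define W where "W = 2 * (\<sigma>g2\<^sup>2 / real (b (B1 k)) * (norm u)\<^sup>2) + 2 * (\<sigma>f1\<^sup>2 / real (b (B3 k)))"
  define ub where "ub = Ai *v grad2 f x y"
  define r where "r = L1 / \<mu> * ey"
  define m where "m \<omega> = Du k x y u \<omega> - (hess22 g x y *v u - grad2 f x y)" for \<omega>
  define n where "n \<omega> = Ai *v m \<omega>" for \<omega>
  define e where "e \<omega> = inner_iter \<gamma> (\<lambda>s. Hin s k x y \<omega>) (Du k x y u \<omega>) (Suc T) - Ai *v Du k x y u \<omega>" for \<omega>
  define S0 where "S0 = {Sample (B1 k) i |i. i < b (B1 k)} \<union> {Sample (B3 k) i |i. i < b (B3 k)}"
  have W: "0 \<le> W" by (simp add: W_def)
  have S0: "S0 \<subseteq> sources K T b" "\<And>s i. Sample (B1_inner s k) i \<notin> S0"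
    using Sample_in_sources(1)[OF batches_in(2)[OF k]] Sample_in_sources(2)[OF k] by (auto simp: S0_def)
  have dm: "Du k x y u \<in> borel_measurable (info S0)"
    by (rule Du_measurable[where N = "info S0" and x = "\<lambda>_. x" and y = "\<lambda>_. y" and u = "\<lambda>_. u" and \<pi> = "\<lambda>\<omega>. \<omega>"])
       (auto intro!: zeta_measurable_info xi_measurable_info batches_in k simp: S0_def)
  have dM: "Du k x y u \<in> borel_measurable M" by (rule measurable_info_imp[OF S0(1) dm])
  have mm: "m \<in> borel_measurable M" unfolding m_def by (intro borel_measurable_diff borel_measurable_const dM)
  have nm: "n \<in> borel_measurable M" unfolding n_def by (intro mat_vec_measurable borel_measurable_const mm)
  have em: "e \<in> borel_measurable M" unfolding e_def
    by (intro borel_measurable_diff mat_vec_measurable borel_measurable_const dM inner_iter_measurable Hin_m) simp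
  have "mean_sq M m \<le> ennreal (2 * (\<sigma>g2\<^sup>2 / real (b (B1 k)) * (norm u)\<^sup>2) + 2 * (\<sigma>f1\<^sup>2 / real (b (B3 k))) + 0)"
  proof (rule mean_sq_combination[where P = "\<lambda>\<omega>. (Hu k x y \<omega> - hess22 g x y) *v u" and Q = "\<lambda>\<omega>. Fy k x y \<omega> - grad2 f x y"])
    show "mean_sq M (\<lambda>\<omega>. (Hu k x y \<omega> - hess22 g x y) *v u) \<le> ennreal (\<sigma>g2\<^sup>2 / real (b (B1 k)) * (norm u)\<^sup>2)"
      by (rule mean_sq_matrix_noise[OF _ Hu_var]) (intro borel_measurable_diff borel_measurable_const Hu_m, simp)
    show "(\<lambda>\<omega>. (Hu k x y \<omega> - hess22 g x y) *v u) \<in> borel_measurable M"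
      by (intro mat_vec_measurable borel_measurable_diff borel_measurable_const Hu_m)
    show "(\<lambda>\<omega>. Fy k x y \<omega> - grad2 f x y) \<in> borel_measurable M"
      by (intro borel_measurable_diff borel_measurable_const Fy_m)
    show "mean_sq M (\<lambda>\<omega>. Fy k x y \<omega> - grad2 f x y) \<le> ennreal (\<sigma>f1\<^sup>2 / real (b (B3 k)))" by (rule Fy_var)
    show "(norm (m \<omega>))\<^sup>2 \<le> 2 * (norm ((Hu k x y \<omega> - hess22 g x y) *v u))\<^sup>2 + 2 * (norm (Fy k x y \<omega> - grad2 f x y))\<^sup>2 + 0" for \<omega>
    proof -
      have "m \<omega> = (Hu k x y \<omega> - hess22 g x y) *v u - (Fy k x y \<omega> - grad2 f x y)"
        by (simp add: m_def Du_def matrix_vector_mult_diff_rdistrib)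
      then show ?thesis
        using power_mono[OF norm_triangle_ineq4[of "(Hu k x y \<omega> - hess22 g x y) *v u" "Fy k x y \<omega> - grad2 f x y"], of 2]
          sum_squares_bound[of "norm ((Hu k x y \<omega> - hess22 g x y) *v u)" "norm (Fy k x y \<omega> - grad2 f x y)"]
        by (simp add: power2_sum)
    qed
  qed simp_all
  then have "mean_sq M m \<le> ennreal W" by (simp add: W_def)
  then have n_sq: "mean_sq M n \<le> ennreal (W / \<mu>\<^sup>2)" unfolding n_def by (intro Ainv_noise mm W)
  have ub: "norm (ub - us x) \<le> r"
    using adjoint_solution_error[of x y x] by (simp add: ub_def r_def)
  have zn: "Ai *v Du k x y u \<omega> = u - ub + n \<omega>" for \<omega>
    by (simp add: n_def m_def ub_def matrix_vector_mult_diff_distrib Ainv(2))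
  have "mean_sq M (\<lambda>\<omega>. Ai *v Du k x y u \<omega>) \<le> ennreal (3 * (W / \<mu>\<^sup>2) + 0 * 0 + (3 * eu\<^sup>2 + 3 * r\<^sup>2))"
  proof (rule mean_sq_combination[where P = n and Q = "\<lambda>_. 0 :: real"])
    fix \<omega>
    have "u - ub + n \<omega> = (u - us x) - (ub - us x) + n \<omega>" by simp
    then have "norm (Ai *v Du k x y u \<omega>) \<le> eu + norm (ub - us x) + norm (n \<omega>)"
      using norm_triangle_ineq[of "(u - us x) - (ub - us x)" "n \<omega>"] norm_triangle_ineq4[of "u - us x" "ub - us x"]
      unfolding zn by simp
    then have "norm (Ai *v Du k x y u \<omega>) \<le> eu + r + norm (n \<omega>)" using ub by linarith
    from norm_sum3_sq_le[OF this]
    show "(norm (Ai *v Du k x y u \<omega>))\<^sup>2 \<le> 3 * (norm (n \<omega>))\<^sup>2 + 0 * (norm (0::real))\<^sup>2 + (3 * eu\<^sup>2 + 3 * r\<^sup>2)" by simp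
  qed (use W nm n_sq in \<open>auto simp: mean_sq_def\<close>)
  then have "mean_sq M e \<le> ennreal \<delta> * ennreal (3 * (W / \<mu>\<^sup>2) + (3 * eu\<^sup>2 + 3 * r\<^sup>2))"
    unfolding e_def using inner_loop_error[OF S0 dm] by (simp add: order_trans[OF _ mult_left_mono])
  also have "\<dots> = ennreal (\<delta> * (3 * (W / \<mu>\<^sup>2) + (3 * eu\<^sup>2 + 3 * r\<^sup>2)))"
    using delta_nonneg W by (intro ennreal_mult[symmetric] add_nonneg_nonneg mult_nonneg_nonneg divide_nonneg_nonneg) auto
  finally have e_sq: "mean_sq M e \<le> ennreal (\<delta> * (3 * (W / \<mu>\<^sup>2) + (3 * eu\<^sup>2 + 3 * r\<^sup>2)))" .
  have "mean_sq M (\<lambda>\<omega>. unext k x y u \<omega> - us x) \<le>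
    ennreal (3 * (W / \<mu>\<^sup>2) + 3 * (\<delta> * (3 * (W / \<mu>\<^sup>2) + (3 * eu\<^sup>2 + 3 * r\<^sup>2))) + 3 * r\<^sup>2)"
  proof (rule mean_sq_combination[OF nm n_sq _ em e_sq])
    fix \<omega>
    have eq: "unext k x y u \<omega> - us x = (ub - us x) - n \<omega> - e \<omega>"
      using zn[of \<omega>] by (simp add: unext_def e_def)
    have "norm (unext k x y u \<omega> - us x) \<le> r + norm (n \<omega>) + norm (e \<omega>)"
      unfolding eq
      using norm_triangle_ineq4[of "ub - us x - n \<omega>" "e \<omega>"] norm_triangle_ineq4[of "ub - us x" "n \<omega>"] ub by linarith
    from norm_sum3_sq_le[OF this]
    show "(norm (unext k x y u \<omega> - us x))\<^sup>2 \<le> 3 * (norm (n \<omega>))\<^sup>2 + 3 * (norm (e \<omega>))\<^sup>2 + 3 * r\<^sup>2" by simp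
  qed (use W delta_nonneg in auto)
  also have "\<dots> \<le> ennreal (4 * r\<^sup>2 + 4 * (W / \<mu>\<^sup>2) + eu\<^sup>2 / 16)"
  proof (rule ennreal_leI)
    have "3 * w + 3 * (\<delta> * (3 * w + (3 * p + 3 * q))) + 3 * q \<le> 4 * q + 4 * w + p / 16"
      if "0 \<le> w" "0 \<le> p" "0 \<le> q" for w p q
    proof -
      have "9 * \<delta> * (w + p + q) \<le> 1 / 16 * (w + p + q)" using that by (intro mult_right_mono \<delta>) auto
      then show ?thesis using that by (simp add: algebra_simps)
    qed
    from this[of "W / \<mu>\<^sup>2" "eu\<^sup>2" "r\<^sup>2"] W
    show "3 * (W / \<mu>\<^sup>2) + 3 * (\<delta> * (3 * (W / \<mu>\<^sup>2) + (3 * eu\<^sup>2 + 3 * r\<^sup>2))) + 3 * r\<^sup>2 \<le> 4 * r\<^sup>2 + 4 * (W / \<mu>\<^sup>2) + eu\<^sup>2 / 16"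
      by simp
  qed
  finally show ?thesis by (simp add: r_def W_def)
qed

lemma x_direction_error:
  "mean_sq M (\<lambda>\<omega>. Dx k x y u \<omega> - gradPhi x) \<le>
    ennreal (4 * (\<sigma>f1\<^sup>2 / real (b (B3 k))) + 4 * (\<sigma>g2\<^sup>2 / real (b (B4 k)) * (norm u)\<^sup>2) + (4 * (L1 * ey)\<^sup>2 + 4 * (Lg1 * eu)\<^sup>2))"
proof (rule mean_sq_combination[where P = "\<lambda>\<omega>. Fx k x y \<omega> - grad1 f x y" and Q = "\<lambda>\<omega>. (Jx k x y \<omega> - hess12 g x y) *v u"])
  show "(\<lambda>\<omega>. Fx k x y \<omega> - grad1 f x y) \<in> borel_measurable M"
    by (intro borel_measurable_diff borel_measurable_const Fx_m)
  show "mean_sq M (\<lambda>\<omega>. Fx k x y \<omega> - grad1 f x y) \<le> ennreal (\<sigma>f1\<^sup>2 / real (b (B3 k)))" by (rule Fx_var)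
  show "(\<lambda>\<omega>. (Jx k x y \<omega> - hess12 g x y) *v u) \<in> borel_measurable M"
    by (intro mat_vec_measurable borel_measurable_diff borel_measurable_const Jx_m)
  show "mean_sq M (\<lambda>\<omega>. (Jx k x y \<omega> - hess12 g x y) *v u) \<le> ennreal (\<sigma>g2\<^sup>2 / real (b (B4 k)) * (norm u)\<^sup>2)"
    by (rule mean_sq_matrix_noise[OF _ Jx_var]) (intro borel_measurable_diff borel_measurable_const Jx_m, simp)
  fix \<omega>
  let ?f = "Fx k x y \<omega> - grad1 f x y" and ?j = "(Jx k x y \<omega> - hess12 g x y) *v u"
  have eq: "Dx k x y u \<omega> - gradPhi x = ?f - ?j + ((grad1 f x y - hess12 g x y *v u) - gradPhi x)"
    by (simp add: Dx_def matrix_vector_mult_diff_rdistrib)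
  have "norm (Dx k x y u \<omega> - gradPhi x) \<le> norm ?f + norm ?j + norm ((grad1 f x y - hess12 g x y *v u) - gradPhi x)"
    unfolding eq
    using norm_triangle_ineq[of "?f - ?j" "(grad1 f x y - hess12 g x y *v u) - gradPhi x"] norm_triangle_ineq4[of ?f ?j] by linarith
  then have "norm (Dx k x y u \<omega> - gradPhi x) \<le> norm ?f + norm ?j + L1 * ey + Lg1 * eu"
    using hypergradient_error[of x y u x] by simp
  from power_mono[OF this, of 2] sum4_sq_le[of "norm ?f" "norm ?j" "L1 * ey" "Lg1 * eu"]
  show "(norm (Dx k x y u \<omega> - gradPhi x))\<^sup>2 \<le> 4 * (norm ?f)\<^sup>2 + 4 * (norm ?j)\<^sup>2 + (4 * (L1 * ey)\<^sup>2 + 4 * (Lg1 * eu)\<^sup>2)"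
    by simp
qed simp_all

end

end

section \<open>The random iterates\<close>

context nsbo
begin

text \<open>The iterates as functions on the sample space, written with the estimators above.\<close>

primrec Z :: "nat \<Rightarrow> 'w \<Rightarrow> (real^'m) \<times> (real^'n) \<times> (real^'n)" where
  "Z 0 \<omega> = Z0 \<omega>"
| "Z (Suc k) \<omega> = (fst (Z k \<omega>) - \<alpha> *\<^sub>R Dx k (fst (Z k \<omega>)) (fst (snd (Z k \<omega>))) (snd (snd (Z k \<omega>))) \<omega>,
     ynext k (fst (Z k \<omega>)) (fst (snd (Z k \<omega>))) \<omega>,
     unext k (fst (Z k \<omega>)) (fst (snd (Z k \<omega>))) (snd (snd (Z k \<omega>))) \<omega>)"

lemma nsbo_sgd_eq_Z:
  "nsbo_sgd F G (\<lambda>_. \<alpha>) (\<lambda>_. \<gamma>) T b (\<lambda>k i. \<xi> k i \<omega>) (\<lambda>B i. \<zeta> B i \<omega>) (Z0 \<omega>) k = Z k \<omega>"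
proof (induction k)
  case (Suc k)
  then show ?case
    by (simp add: nsbo_step_def Let_def case_prod_beta Dx_def ynext_def unext_def Du_def Hu_def Fx_def Fy_def Jx_def
        Dy_def Hin_def del: inner_iter.simps)
qed simp

definition "X k \<omega> = fst (Z k \<omega>)"
definition "Y k \<omega> = fst (snd (Z k \<omega>))"
definition "U k \<omega> = snd (snd (Z k \<omega>))"
definition "D k \<omega> = Dx k (X k \<omega>) (Y k \<omega>) (U k \<omega>) \<omega>"

lemma X_Suc: "X (Suc k) \<omega> = X k \<omega> - \<alpha> *\<^sub>R D k \<omega>"
  and Y_Suc: "Y (Suc k) \<omega> = ynext k (X k \<omega>) (Y k \<omega>) \<omega>"
  and U_Suc: "U (Suc k) \<omega> = unext k (X k \<omega>) (Y k \<omega>) (U k \<omega>) \<omega>"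
  by (simp_all add: X_def Y_def U_def D_def)

text \<open>Iterate \<open>k\<close> is a function of \<open>past k\<close>, and the step leading to iterate \<open>k + 1\<close> uses in addition only the
samples of \<open>present k\<close>.\<close>

definition past :: "nat \<Rightarrow> source set" where
  "past k = insert Init {Sample B i |B i. Sample B i \<in> sources K T b \<and> outer_index B < k}"

definition present :: "nat \<Rightarrow> source set" where
  "present k = {Sample B i |B i. Sample B i \<in> sources K T b \<and> outer_index B = k}"

lemma past_sources: "past k \<subseteq> sources K T b" and present_sources: "present k \<subseteq> sources K T b"
  and past_present: "past k \<inter> present k = {}" and past_mono: "past k \<subseteq> past (Suc k)"
  and present_past: "present k \<subseteq> past (Suc k)"
  by (auto simp: past_def present_def sources_def)

lemma zeta_present: "B \<in> zeta_batches K T \<Longrightarrow> outer_index B = k \<Longrightarrow> i < b B \<Longrightarrow> \<zeta> B i \<in> measurable (info (present k)) Dzeta"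
  and xi_present: "k < K \<Longrightarrow> i < b (B3 k) \<Longrightarrow> \<xi> k i \<in> measurable (info (present k)) Dxi"
proof -
  show "B \<in> zeta_batches K T \<Longrightarrow> outer_index B = k \<Longrightarrow> i < b B \<Longrightarrow> \<zeta> B i \<in> measurable (info (present k)) Dzeta"
    using Sample_in_sources(1) by (intro zeta_measurable_info) (auto simp: present_def)
  show "k < K \<Longrightarrow> i < b (B3 k) \<Longrightarrow> \<xi> k i \<in> measurable (info (present k)) Dxi"
    using Sample_in_sources(2) by (intro xi_measurable_info) (auto simp: present_def)
qed

lemma iterates_measurable_past:
  "k \<le> K \<Longrightarrow> X k \<in> borel_measurable (info (past k)) \<and> Y k \<in> borel_measurable (info (past k)) \<and> U k \<in> borel_measurable (info (past k))"
proof (induction k)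
  case 0
  have Z0: "Z0 \<in> measurable (info (past 0)) (borel \<Otimes>\<^sub>M (borel \<Otimes>\<^sub>M borel))"
    using Z0_measurable_info[of "past 0"] by (simp add: borel_prod past_def)
  show ?case unfolding X_def Y_def U_def Z.simps
    using measurable_compose[OF Z0 measurable_fst] measurable_compose[OF measurable_compose[OF Z0 measurable_snd] measurable_fst]
      measurable_compose[OF measurable_compose[OF Z0 measurable_snd] measurable_snd] by simp
next
  case (Suc k)
  then have k: "k < K" by simp
  let ?N = "info (past (Suc k))"
  have m: "X k \<in> borel_measurable ?N" "Y k \<in> borel_measurable ?N" "U k \<in> borel_measurable ?N"
    using Suc by (auto intro: measurable_info_mono[OF past_mono])
  have z: "\<zeta> B i \<in> measurable ?N Dzeta" if "B \<in> zeta_batches K T" "outer_index B = k" "i < b B" for B i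
    by (rule measurable_info_mono[OF present_past zeta_present[OF that]])
  have x: "\<xi> k i \<in> measurable ?N Dxi" if "i < b (B3 k)" for i
    by (rule measurable_info_mono[OF present_past xi_present[OF k that]])
  have "D k \<in> borel_measurable ?N" unfolding D_def[abs_def]
    by (rule Dx_measurable[OF m, where \<pi> = "\<lambda>\<omega>. \<omega>"]) (auto intro!: z x batches_in k)
  then have "X (Suc k) \<in> borel_measurable ?N" unfolding X_Suc[abs_def] using m by simp
  moreover have "Y (Suc k) \<in> borel_measurable ?N" unfolding Y_Suc[abs_def]
    by (rule ynext_measurable[OF m, where \<pi> = "\<lambda>\<omega>. \<omega>", OF z k])
  moreover have "U (Suc k) \<in> borel_measurable ?N" unfolding U_Suc[abs_def]
    by (rule unext_measurable[OF m, where \<pi> = "\<lambda>\<omega>. \<omega>", OF z x k])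
  ultimately show ?case by simp
qed

lemma iterates_measurable:
  assumes "k \<le> K"
  shows "X k \<in> borel_measurable M" "Y k \<in> borel_measurable M" "U k \<in> borel_measurable M"
  using iterates_measurable_past[OF assms] measurable_info_imp[OF past_sources] by blast+

lemma D_measurable: "k < K \<Longrightarrow> D k \<in> borel_measurable M"
  unfolding D_def[abs_def]
  by (rule Dx_measurable[OF iterates_measurable, where \<pi> = "\<lambda>\<omega>. \<omega>"])
     (auto intro!: zeta_measurable xi_measurable batches_in)

lemma ys_measurable: "ys \<in> borel_measurable borel" and us_measurable: "us \<in> borel_measurable borel"
  and gradPhi_measurable: "gradPhi \<in> borel_measurable borel" and Phi_measurable: "Phi f g \<in> borel_measurable borel"
proof -
  have lip_cont: "continuous_on UNIV h" if "\<And>a b. norm (h a - h b) \<le> C * norm (a - b)" for h :: "'a::real_normed_vector \<Rightarrow> 'b::real_normed_vector" and C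
  proof -
    have "\<bar>C\<bar>-lipschitz_on UNIV h"
      by (intro lipschitz_onI)
         (auto simp: dist_norm intro: order_trans[OF that mult_right_mono[OF abs_ge_self norm_ge_zero]])
    then show ?thesis by (rule lipschitz_on_continuous_on)
  qed
  show "ys \<in> borel_measurable borel"
    by (intro borel_measurable_continuous_onI lip_cont[OF ystar_lipschitz])
  show "us \<in> borel_measurable borel"
    by (intro borel_measurable_continuous_onI lip_cont[OF ustar_lipschitz])
  show "gradPhi \<in> borel_measurable borel"
    by (intro borel_measurable_continuous_onI lip_cont[OF gradPhi_lipschitz])
  show "Phi f g \<in> borel_measurable borel"
    using GDERIV_Phi unfolding gderiv_def
    by (intro borel_measurable_continuous_onI) (meson continuous_at_imp_continuous_on has_derivative_continuous)
qed

context
  fixes k assumes k: "k < K"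
begin

lemma state_measurable:
  "X k \<in> borel_measurable M" "Y k \<in> borel_measurable M" "U k \<in> borel_measurable M"
  "(\<lambda>\<omega>. ys (X k \<omega>)) \<in> borel_measurable M" "(\<lambda>\<omega>. us (X k \<omega>)) \<in> borel_measurable M"
  "(\<lambda>\<omega>. gradPhi (X k \<omega>)) \<in> borel_measurable M" "(\<lambda>\<omega>. Phi f g (X k \<omega>)) \<in> borel_measurable M"
  using iterates_measurable[of k] k ys_measurable us_measurable gradPhi_measurable Phi_measurable
  by (auto intro: measurable_compose)

text \<open>If the cost of one step is at most \<open>q\<close> for every fixed state, its expectation along the iterates is at most the
expectation of \<open>q\<close>. The first assumption is the measurability of the cost, in the generality in which it is
available for the estimators.\<close>

lemma freeze_step:
  assumes c: "\<And>N x y u \<pi>. x \<in> borel_measurable N \<Longrightarrow> y \<in> borel_measurable N \<Longrightarrow> u \<in> borel_measurable N \<Longrightarrow>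
      (\<And>B i. B \<in> zeta_batches K T \<Longrightarrow> outer_index B = k \<Longrightarrow> i < b B \<Longrightarrow> (\<lambda>\<nu>. \<zeta> B i (\<pi> \<nu>)) \<in> measurable N Dzeta) \<Longrightarrow>
      (\<And>i. i < b (B3 k) \<Longrightarrow> (\<lambda>\<nu>. \<xi> k i (\<pi> \<nu>)) \<in> measurable N Dxi) \<Longrightarrow>
      (\<lambda>\<nu>. c (x \<nu>) (y \<nu>) (u \<nu>) (\<pi> \<nu>)) \<in> borel_measurable (N :: ('w \<times> 'w) measure)"
    and le: "\<And>x y u. (\<integral>\<^sup>+\<omega>'. c x y u \<omega>' \<partial>M) \<le> q x y u"
  shows "(\<integral>\<^sup>+\<omega>. c (X k \<omega>) (Y k \<omega>) (U k \<omega>) \<omega> \<partial>M) \<le> (\<integral>\<^sup>+\<omega>. q (X k \<omega>) (Y k \<omega>) (U k \<omega>) \<partial>M)"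
proof -
  let ?N = "info (past k) \<Otimes>\<^sub>M info (present k)"
  have m: "(\<lambda>p. X k (fst p)) \<in> borel_measurable ?N" "(\<lambda>p. Y k (fst p)) \<in> borel_measurable ?N" "(\<lambda>p. U k (fst p)) \<in> borel_measurable ?N"
    using iterates_measurable_past[of k] k by (auto intro: measurable_compose[OF measurable_fst])
  have "(\<lambda>p. c (X k (fst p)) (Y k (fst p)) (U k (fst p)) (snd p)) \<in> borel_measurable ?N"
    by (rule c[OF m]) (auto intro!: measurable_compose[OF measurable_snd] zeta_present xi_present k)
  from nn_integral_freeze[OF past_sources present_sources past_present this]
  have "(\<integral>\<^sup>+\<omega>. c (X k \<omega>) (Y k \<omega>) (U k \<omega>) \<omega> \<partial>M) = (\<integral>\<^sup>+\<omega>. \<integral>\<^sup>+\<omega>'. c (X k \<omega>) (Y k \<omega>) (U k \<omega>) \<omega>' \<partial>M \<partial>M)"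
    by simp
  also have "\<dots> \<le> (\<integral>\<^sup>+\<omega>. q (X k \<omega>) (Y k \<omega>) (U k \<omega>) \<partial>M)"
    by (intro nn_integral_mono le)
  finally show ?thesis .
qed

lemma ustar_sq: "(norm u)\<^sup>2 \<le> 2 * (norm (u - us x))\<^sup>2 + 2 * (Lf0 / \<mu>)\<^sup>2"
proof -
  have "norm u \<le> norm (u - us x) + Lf0 / \<mu>"
    using norm_triangle_ineq[of "u - us x" "us x"] ustar_bound[of x] by simp
  from power_mono[OF this, of 2] show ?thesis
    using sum_squares_bound[of "norm (u - us x)" "Lf0 / \<mu>"] by (simp add: power2_sum)
qed

context
  fixes p q :: real
  assumes p: "0 \<le> p" "mean_sq M (\<lambda>\<omega>. Y k \<omega> - ys (X k \<omega>)) \<le> ennreal p"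
    and q: "0 \<le> q" "mean_sq M (\<lambda>\<omega>. U k \<omega> - us (X k \<omega>)) \<le> ennreal q"
begin

lemma error_measurable:
  "(\<lambda>\<omega>. Y k \<omega> - ys (X k \<omega>)) \<in> borel_measurable M" "(\<lambda>\<omega>. U k \<omega> - us (X k \<omega>)) \<in> borel_measurable M"
  by (intro borel_measurable_diff state_measurable)+

text \<open>First moment on the left, second moment \<open>p\<close> on the right: the Newton error is quadratic.\<close>

lemma lower_level_step:
  assumes \<theta>: "0 \<le> \<theta>" "2 * \<delta> \<le> \<theta>\<^sup>2" and V: "\<sigma>g1\<^sup>2 / real (b (B2 k)) / \<mu>\<^sup>2 \<le> V"
  shows "mean_norm M (\<lambda>\<omega>. Y (Suc k) \<omega> - ys (X k \<omega>)) \<le>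
    ennreal ((1 + \<theta>) * (Lg2 / \<mu> * p) + (1 + \<theta>) * sqrt V + \<theta> * sqrt p)"
proof -
  let ?e = "\<lambda>\<omega>. Y k \<omega> - ys (X k \<omega>)"
  have "mean_norm M (\<lambda>\<omega>. Y (Suc k) \<omega> - ys (X k \<omega>)) =
      (\<integral>\<^sup>+\<omega>. ennreal (norm (ynext k (X k \<omega>) (Y k \<omega>) \<omega> - ys (X k \<omega>))) \<partial>M)"
    by (simp add: mean_norm_def Y_Suc)
  also have "\<dots> \<le> (\<integral>\<^sup>+\<omega>. ennreal ((1 + \<theta>) * (Lg2 / \<mu> * (norm (?e \<omega>))\<^sup>2) + (1 + \<theta>) * sqrt (\<sigma>g1\<^sup>2 / real (b (B2 k)) / \<mu>\<^sup>2) + \<theta> * norm (?e \<omega>)) \<partial>M)"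
  proof (rule freeze_step[where c = "\<lambda>x y u \<omega>'. ennreal (norm (ynext k x y \<omega>' - ys x))" and
      q = "\<lambda>x y u. ennreal ((1 + \<theta>) * (Lg2 / \<mu> * (norm (y - ys x))\<^sup>2) + (1 + \<theta>) * sqrt (\<sigma>g1\<^sup>2 / real (b (B2 k)) / \<mu>\<^sup>2) + \<theta> * norm (y - ys x))"])
    fix N :: "('w \<times> 'w) measure" and x :: "'w \<times> 'w \<Rightarrow> real^'m" and y u :: "'w \<times> 'w \<Rightarrow> real^'n" and \<pi> :: "'w \<times> 'w \<Rightarrow> 'w"
    assume m: "x \<in> borel_measurable N" "y \<in> borel_measurable N" "u \<in> borel_measurable N"
      and z: "\<And>B i. B \<in> zeta_batches K T \<Longrightarrow> outer_index B = k \<Longrightarrow> i < b B \<Longrightarrow> (\<lambda>\<nu>. \<zeta> B i (\<pi> \<nu>)) \<in> measurable N Dzeta"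
    have "(\<lambda>\<nu>. ynext k (x \<nu>) (y \<nu>) (\<pi> \<nu>)) \<in> borel_measurable N" by (rule ynext_measurable[OF m z k])
    moreover have "(\<lambda>\<nu>. ys (x \<nu>)) \<in> borel_measurable N" by (rule measurable_compose[OF m(1) ys_measurable])
    ultimately show "(\<lambda>\<nu>. ennreal (norm (ynext k (x \<nu>) (y \<nu>) (\<pi> \<nu>) - ys (x \<nu>)))) \<in> borel_measurable N"
      by measurable
  next
    fix x y u
    show "(\<integral>\<^sup>+\<omega>'. ennreal (norm (ynext k x y \<omega>' - ys x)) \<partial>M) \<le>
      ennreal ((1 + \<theta>) * (Lg2 / \<mu> * (norm (y - ys x))\<^sup>2) + (1 + \<theta>) * sqrt (\<sigma>g1\<^sup>2 / real (b (B2 k)) / \<mu>\<^sup>2) + \<theta> * norm (y - ys x))"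
      using y_update_error[OF k \<theta>, of x y] by (simp add: mean_norm_def)
  qed
  also have "\<dots> \<le> (\<integral>\<^sup>+\<omega>. ennreal ((1 + \<theta>) * (Lg2 / \<mu>)) * ennreal ((norm (?e \<omega>))\<^sup>2) + ennreal ((1 + \<theta>) * sqrt V) + ennreal \<theta> * ennreal (norm (?e \<omega>)) \<partial>M)"
  proof (rule nn_integral_mono)
    fix \<omega>
    have "(1 + \<theta>) * sqrt (\<sigma>g1\<^sup>2 / real (b (B2 k)) / \<mu>\<^sup>2) \<le> (1 + \<theta>) * sqrt V"
      using \<theta> V by (intro mult_left_mono real_sqrt_le_mono) auto
    then have "(1 + \<theta>) * (Lg2 / \<mu> * (norm (?e \<omega>))\<^sup>2) + (1 + \<theta>) * sqrt (\<sigma>g1\<^sup>2 / real (b (B2 k)) / \<mu>\<^sup>2) + \<theta> * norm (?e \<omega>)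
       \<le> (1 + \<theta>) * (Lg2 / \<mu>) * (norm (?e \<omega>))\<^sup>2 + (1 + \<theta>) * sqrt V + \<theta> * norm (?e \<omega>)"
      by (simp add: mult.assoc)
    from ennreal_leI[OF this]
    show "ennreal ((1 + \<theta>) * (Lg2 / \<mu> * (norm (?e \<omega>))\<^sup>2) + (1 + \<theta>) * sqrt (\<sigma>g1\<^sup>2 / real (b (B2 k)) / \<mu>\<^sup>2) + \<theta> * norm (?e \<omega>))
       \<le> ennreal ((1 + \<theta>) * (Lg2 / \<mu>)) * ennreal ((norm (?e \<omega>))\<^sup>2) + ennreal ((1 + \<theta>) * sqrt V) + ennreal \<theta> * ennreal (norm (?e \<omega>))"
    proof -
      have "0 \<le> sqrt V" using V by (intro real_sqrt_ge_zero order_trans[OF _ V]) auto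
      then have nn: "0 \<le> (1 + \<theta>) * sqrt V" "0 \<le> (1 + \<theta>) * (Lg2 / \<mu>)" "0 \<le> (1 + \<theta>) * (Lg2 / \<mu>) * (norm (?e \<omega>))\<^sup>2"
        "0 \<le> (1 + \<theta>) * (Lg2 / \<mu>) * (norm (?e \<omega>))\<^sup>2 + (1 + \<theta>) * sqrt V" "0 \<le> \<theta> * norm (?e \<omega>)"
        using \<theta> pos by simp_all
      have "ennreal ((1 + \<theta>) * (Lg2 / \<mu>) * (norm (?e \<omega>))\<^sup>2 + (1 + \<theta>) * sqrt V + \<theta> * norm (?e \<omega>)) =
        ennreal ((1 + \<theta>) * (Lg2 / \<mu>)) * ennreal ((norm (?e \<omega>))\<^sup>2) + ennreal ((1 + \<theta>) * sqrt V) + ennreal \<theta> * ennreal (norm (?e \<omega>))"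
        by (simp only: nn \<theta>(1) ennreal_plus ennreal_mult zero_le_power2 norm_ge_zero)
      with \<open>ennreal _ \<le> ennreal _\<close> show ?thesis by simp
    qed
  qed
  also have "\<dots> = ennreal ((1 + \<theta>) * (Lg2 / \<mu>)) * mean_sq M ?e + ennreal ((1 + \<theta>) * sqrt V) + ennreal \<theta> * mean_norm M ?e"
    unfolding mean_sq_def mean_norm_def using error_measurable(1)
    by (simp add: nn_integral_add nn_integral_cmult emeasure_space_1)
  also have "\<dots> \<le> ennreal ((1 + \<theta>) * (Lg2 / \<mu>)) * ennreal p + ennreal ((1 + \<theta>) * sqrt V) + ennreal \<theta> * ennreal (sqrt p)"
    by (intro add_mono mult_left_mono order_refl p mean_norm_le_sqrt[OF error_measurable(1) p]) auto
  also have "\<dots> = ennreal ((1 + \<theta>) * (Lg2 / \<mu> * p) + (1 + \<theta>) * sqrt V + \<theta> * sqrt p)"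
  proof -
    have "0 \<le> sqrt V" using V by (intro real_sqrt_ge_zero order_trans[OF _ V]) auto
    then have nn: "0 \<le> (1 + \<theta>) * sqrt V" "0 \<le> (1 + \<theta>) * (Lg2 / \<mu>)" "0 \<le> (1 + \<theta>) * (Lg2 / \<mu>) * p"
        "0 \<le> (1 + \<theta>) * (Lg2 / \<mu>) * p + (1 + \<theta>) * sqrt V" "0 \<le> \<theta> * sqrt p" "0 \<le> sqrt p"
      using \<theta> pos p(1) by simp_all
    show ?thesis
      by (simp only: mult.assoc[symmetric]) (simp only: nn \<theta>(1) p(1) ennreal_plus ennreal_mult)
  qed
  finally show ?thesis .
qed

lemma adjoint_step:
  assumes \<delta>: "9 * \<delta> \<le> 1 / 16" and v1: "\<sigma>g2\<^sup>2 / real (b (B1 k)) \<le> v1" and v3: "\<sigma>f1\<^sup>2 / real (b (B3 k)) \<le> v3"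
  shows "mean_sq M (\<lambda>\<omega>. U (Suc k) \<omega> - us (X k \<omega>)) \<le>
    ennreal (4 * (L1 / \<mu>)\<^sup>2 * p + (16 * v1 / \<mu>\<^sup>2 + 1 / 16) * q + (16 * v1 * (Lf0 / \<mu>)\<^sup>2 + 8 * v3) / \<mu>\<^sup>2)"
proof -
  let ?v1 = "\<sigma>g2\<^sup>2 / real (b (B1 k))" and ?v3 = "\<sigma>f1\<^sup>2 / real (b (B3 k))"
  let ?q = "\<lambda>x y u. ennreal (4 * (L1 / \<mu> * norm (y - ys x))\<^sup>2 + 4 * ((2 * (?v1 * (norm u)\<^sup>2) + 2 * ?v3) / \<mu>\<^sup>2) + (norm (u - us x))\<^sup>2 / 16)"
  have nn: "0 \<le> v1" "0 \<le> v3" using order_trans[OF _ v1] order_trans[OF _ v3] by auto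
  have "mean_sq M (\<lambda>\<omega>. U (Suc k) \<omega> - us (X k \<omega>)) =
      (\<integral>\<^sup>+\<omega>. ennreal ((norm (unext k (X k \<omega>) (Y k \<omega>) (U k \<omega>) \<omega> - us (X k \<omega>)))\<^sup>2) \<partial>M)"
    by (simp add: mean_sq_def U_Suc)
  also have "\<dots> \<le> (\<integral>\<^sup>+\<omega>. ?q (X k \<omega>) (Y k \<omega>) (U k \<omega>) \<partial>M)"
  proof (rule freeze_step[where c = "\<lambda>x y u \<omega>'. ennreal ((norm (unext k x y u \<omega>' - us x))\<^sup>2)" and q = ?q])
    fix N :: "('w \<times> 'w) measure" and x :: "'w \<times> 'w \<Rightarrow> real^'m" and y u :: "'w \<times> 'w \<Rightarrow> real^'n" and \<pi> :: "'w \<times> 'w \<Rightarrow> 'w"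
    assume m: "x \<in> borel_measurable N" "y \<in> borel_measurable N" "u \<in> borel_measurable N"
      and z: "\<And>B i. B \<in> zeta_batches K T \<Longrightarrow> outer_index B = k \<Longrightarrow> i < b B \<Longrightarrow> (\<lambda>\<nu>. \<zeta> B i (\<pi> \<nu>)) \<in> measurable N Dzeta"
      and xi: "\<And>i. i < b (B3 k) \<Longrightarrow> (\<lambda>\<nu>. \<xi> k i (\<pi> \<nu>)) \<in> measurable N Dxi"
    have "(\<lambda>\<nu>. unext k (x \<nu>) (y \<nu>) (u \<nu>) (\<pi> \<nu>)) \<in> borel_measurable N" by (rule unext_measurable[OF m z xi k])
    moreover have "(\<lambda>\<nu>. us (x \<nu>)) \<in> borel_measurable N" by (rule measurable_compose[OF m(1) us_measurable])
    ultimately show "(\<lambda>\<nu>. ennreal ((norm (unext k (x \<nu>) (y \<nu>) (u \<nu>) (\<pi> \<nu>) - us (x \<nu>)))\<^sup>2)) \<in> borel_measurable N"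
      by measurable
  next
    fix x y u
    show "(\<integral>\<^sup>+\<omega>'. ennreal ((norm (unext k x y u \<omega>' - us x))\<^sup>2) \<partial>M) \<le> ?q x y u"
      using u_update_error[OF k \<delta>, of x y u] by (simp add: mean_sq_def)
  qed
  also have "\<dots> \<le> ennreal (4 * (L1 / \<mu>)\<^sup>2 * p + (16 * v1 / \<mu>\<^sup>2 + 1 / 16) * q + (16 * v1 * (Lf0 / \<mu>)\<^sup>2 + 8 * v3) / \<mu>\<^sup>2)"
  proof (rule nn_integral_sq_combination[OF error_measurable(1) p(2,1) error_measurable(2) q(2,1)])
    fix \<omega>
    let ?y = "(norm (Y k \<omega> - ys (X k \<omega>)))\<^sup>2" and ?u = "(norm (U k \<omega> - us (X k \<omega>)))\<^sup>2"
    have "?v1 * (norm (U k \<omega>))\<^sup>2 \<le> v1 * (2 * ?u + 2 * (Lf0 / \<mu>)\<^sup>2)"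
      by (intro mult_mono v1 ustar_sq nn) auto
    then have "2 * (?v1 * (norm (U k \<omega>))\<^sup>2) + 2 * ?v3 \<le> v1 * (4 * ?u + 4 * (Lf0 / \<mu>)\<^sup>2) + 2 * v3"
      using v3 by (simp add: algebra_simps)
    then have "4 * ((2 * (?v1 * (norm (U k \<omega>))\<^sup>2) + 2 * ?v3) / \<mu>\<^sup>2) \<le> 4 * ((v1 * (4 * ?u + 4 * (Lf0 / \<mu>)\<^sup>2) + 2 * v3) / \<mu>\<^sup>2)"
      by (intro mult_left_mono divide_right_mono) auto
    also have "\<dots> = 16 * v1 / \<mu>\<^sup>2 * ?u + (16 * v1 * (Lf0 / \<mu>)\<^sup>2 + 8 * v3) / \<mu>\<^sup>2"
      by (simp add: algebra_simps add_divide_distrib)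
    finally show "?q (X k \<omega>) (Y k \<omega>) (U k \<omega>) \<le> ennreal (4 * (L1 / \<mu>)\<^sup>2 * ?y + (16 * v1 / \<mu>\<^sup>2 + 1 / 16) * ?u + (16 * v1 * (Lf0 / \<mu>)\<^sup>2 + 8 * v3) / \<mu>\<^sup>2)"
      by (intro ennreal_leI) (simp add: power_mult_distrib power_divide distrib_right)
  qed (use nn in auto)
  finally show ?thesis .
qed

lemma direction_step:
  assumes v3: "\<sigma>f1\<^sup>2 / real (b (B3 k)) \<le> v3" and v4: "\<sigma>g2\<^sup>2 / real (b (B4 k)) \<le> v4"
  shows "mean_sq M (\<lambda>\<omega>. D k \<omega> - gradPhi (X k \<omega>)) \<le>
    ennreal (4 * L1\<^sup>2 * p + (8 * v4 + 4 * Lg1\<^sup>2) * q + (4 * v3 + 8 * v4 * (Lf0 / \<mu>)\<^sup>2))"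
proof -
  let ?v3 = "\<sigma>f1\<^sup>2 / real (b (B3 k))" and ?v4 = "\<sigma>g2\<^sup>2 / real (b (B4 k))"
  let ?q = "\<lambda>x y u. ennreal (4 * ?v3 + 4 * (?v4 * (norm u)\<^sup>2) + (4 * (L1 * norm (y - ys x))\<^sup>2 + 4 * (Lg1 * norm (u - us x))\<^sup>2))"
  have nn: "0 \<le> v3" "0 \<le> v4" using order_trans[OF _ v3] order_trans[OF _ v4] by auto
  have "mean_sq M (\<lambda>\<omega>. D k \<omega> - gradPhi (X k \<omega>)) =
      (\<integral>\<^sup>+\<omega>. ennreal ((norm (Dx k (X k \<omega>) (Y k \<omega>) (U k \<omega>) \<omega> - gradPhi (X k \<omega>)))\<^sup>2) \<partial>M)"
    by (simp add: mean_sq_def D_def)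
  also have "\<dots> \<le> (\<integral>\<^sup>+\<omega>. ?q (X k \<omega>) (Y k \<omega>) (U k \<omega>) \<partial>M)"
  proof (rule freeze_step[where c = "\<lambda>x y u \<omega>'. ennreal ((norm (Dx k x y u \<omega>' - gradPhi x))\<^sup>2)" and q = ?q])
    fix N :: "('w \<times> 'w) measure" and x :: "'w \<times> 'w \<Rightarrow> real^'m" and y u :: "'w \<times> 'w \<Rightarrow> real^'n" and \<pi> :: "'w \<times> 'w \<Rightarrow> 'w"
    assume m: "x \<in> borel_measurable N" "y \<in> borel_measurable N" "u \<in> borel_measurable N"
      and z: "\<And>B i. B \<in> zeta_batches K T \<Longrightarrow> outer_index B = k \<Longrightarrow> i < b B \<Longrightarrow> (\<lambda>\<nu>. \<zeta> B i (\<pi> \<nu>)) \<in> measurable N Dzeta"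
      and xi: "\<And>i. i < b (B3 k) \<Longrightarrow> (\<lambda>\<nu>. \<xi> k i (\<pi> \<nu>)) \<in> measurable N Dxi"
    have "(\<lambda>\<nu>. Dx k (x \<nu>) (y \<nu>) (u \<nu>) (\<pi> \<nu>)) \<in> borel_measurable N"
      by (rule Dx_measurable[OF m z[OF batches_in(4)[OF k]] xi]) simp_all
    moreover have "(\<lambda>\<nu>. gradPhi (x \<nu>)) \<in> borel_measurable N" by (rule measurable_compose[OF m(1) gradPhi_measurable])
    ultimately show "(\<lambda>\<nu>. ennreal ((norm (Dx k (x \<nu>) (y \<nu>) (u \<nu>) (\<pi> \<nu>) - gradPhi (x \<nu>)))\<^sup>2)) \<in> borel_measurable N"
      by measurable
  next
    fix x y u
    show "(\<integral>\<^sup>+\<omega>'. ennreal ((norm (Dx k x y u \<omega>' - gradPhi x))\<^sup>2) \<partial>M) \<le> ?q x y u"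
      using x_direction_error[OF k, of x y u] by (simp add: mean_sq_def)
  qed
  also have "\<dots> \<le> ennreal (4 * L1\<^sup>2 * p + (8 * v4 + 4 * Lg1\<^sup>2) * q + (4 * v3 + 8 * v4 * (Lf0 / \<mu>)\<^sup>2))"
  proof (rule nn_integral_sq_combination[OF error_measurable(1) p(2,1) error_measurable(2) q(2,1)])
    fix \<omega>
    let ?y = "(norm (Y k \<omega> - ys (X k \<omega>)))\<^sup>2" and ?u = "(norm (U k \<omega> - us (X k \<omega>)))\<^sup>2"
    have "?v4 * (norm (U k \<omega>))\<^sup>2 \<le> v4 * (2 * ?u + 2 * (Lf0 / \<mu>)\<^sup>2)"
      by (intro mult_mono v4 ustar_sq nn) auto
    then show "?q (X k \<omega>) (Y k \<omega>) (U k \<omega>) \<le> ennreal (4 * L1\<^sup>2 * ?y + (8 * v4 + 4 * Lg1\<^sup>2) * ?u + (4 * v3 + 8 * v4 * (Lf0 / \<mu>)\<^sup>2))"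
      using v3 by (intro ennreal_leI) (simp add: power_mult_distrib algebra_simps)
  qed (use nn in auto)
  finally show ?thesis .
qed

end

end

end

section \<open>Recursions for the mean square errors\<close>

text \<open>The numbers \<open>V\<close>, \<open>v1\<close>, \<open>v3\<close>, \<open>v4\<close> bound the variances of the batches used in \<open>D\<^sub>y\<close>, in the matrix of \<open>D\<^sub>u\<close>, in the
gradient of \<open>F\<close> and in the mixed block; \<open>V\<close> includes the factor \<open>1 / \<mu>\<^sup>2\<close>.\<close>

locale nsbo_analysis =
  nsbo f g \<mu> Lf0 Lf1 Lg1 Lg2 Cf0 F G Dxi Dzeta \<sigma>f1 \<sigma>g1 \<sigma>g2 M Z0 K T b \<xi> \<zeta> \<alpha> \<gamma> \<tau> \<delta>
  for f g :: "real^'m \<Rightarrow> real^'n \<Rightarrow> real" and \<mu> Lf0 Lf1 Lg1 Lg2 Cf0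
    and F :: "'xi \<Rightarrow> real^'m \<Rightarrow> real^'n \<Rightarrow> real" and G :: "'zeta \<Rightarrow> real^'m \<Rightarrow> real^'n \<Rightarrow> real"
    and Dxi Dzeta \<sigma>f1 \<sigma>g1 \<sigma>g2 and M :: "'w measure"
    and Z0 :: "'w \<Rightarrow> (real^'m) \<times> (real^'n) \<times> (real^'n)" and K T :: nat and b :: "batch \<Rightarrow> nat"
    and \<xi> :: "nat \<Rightarrow> nat \<Rightarrow> 'w \<Rightarrow> 'xi" and \<zeta> :: "batch \<Rightarrow> nat \<Rightarrow> 'w \<Rightarrow> 'zeta" and \<alpha> \<gamma> \<tau> \<delta> +
  fixes \<theta> V v1 v3 v4 r \<Delta> p0 q0 :: real
  assumes theta: "0 \<le> \<theta>" "2 * \<delta> \<le> \<theta>\<^sup>2" and delta9: "9 * \<delta> \<le> 1 / 16"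
    and alpha: "0 \<le> \<alpha>" "\<alpha> * LPhi \<le> 1 / 4"
    and V: "\<And>k. k < K \<Longrightarrow> \<sigma>g1\<^sup>2 / real (b (B2 k)) / \<mu>\<^sup>2 \<le> V"
    and v1: "\<And>k. k < K \<Longrightarrow> \<sigma>g2\<^sup>2 / real (b (B1 k)) \<le> v1"
    and v3: "\<And>k. k < K \<Longrightarrow> \<sigma>f1\<^sup>2 / real (b (B3 k)) \<le> v3"
    and v4: "\<And>k. k < K \<Longrightarrow> \<sigma>g2\<^sup>2 / real (b (B4 k)) \<le> v4"
    and moment: "moment_assumption M g r K X Y"
    and init_y: "mean_sq M (\<lambda>\<omega>. Y 0 \<omega> - ys (X 0 \<omega>)) \<le> ennreal p0"
    and init_u: "mean_sq M (\<lambda>\<omega>. U 0 \<omega> - us (X 0 \<omega>)) \<le> ennreal q0"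
    and init_nonneg: "0 \<le> p0" "0 \<le> q0"
    and init_gap: "initial_gap_le M f g (X 0) \<Delta>"
begin

text \<open>Mean squares with values in the extended nonnegative reals; they are shown to be finite and then replaced by
the real sequences \<open>\<phi>\<close>, \<open>\<psi>\<close>, \<open>dd\<close>, \<open>ee\<close>, \<open>nn\<close>, \<open>gg\<close>.\<close>

definition "mY k = mean_sq M (\<lambda>\<omega>. Y k \<omega> - ys (X k \<omega>))"
definition "mU k = mean_sq M (\<lambda>\<omega>. U k \<omega> - us (X k \<omega>))"
definition "mD k = mean_sq M (D k)"
definition "mE k = mean_sq M (\<lambda>\<omega>. D k \<omega> - gradPhi (X k \<omega>))"
definition "mG k = mean_sq M (\<lambda>\<omega>. gradPhi (X k \<omega>))"
definition "gap k = (\<integral>\<^sup>+\<omega>. ennreal (Phi f g (X k \<omega>) - Phi_opt f g) \<partial>M)"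

lemma Phi_opt_le: "Phi_opt f g \<le> Phi f g x"
  using init_gap unfolding Phi_opt_def initial_gap_le_def by (intro cINF_lower) auto

lemma mG_le: "mG k \<le> ennreal ((Cf0 + Lg1 * Lf0 / \<mu>)\<^sup>2)"
proof -
  have "mG k \<le> (\<integral>\<^sup>+\<omega>. ennreal ((Cf0 + Lg1 * Lf0 / \<mu>)\<^sup>2) \<partial>M)"
    unfolding mG_def mean_sq_def
    by (intro nn_integral_mono ennreal_leI power_mono gradPhi_bound) simp
  then show ?thesis by (simp add: emeasure_space_1)
qed

lemma direction_bound:
  assumes k: "k < K" and e: "0 \<le> e" "mE k \<le> ennreal e"
  shows "mD k \<le> ennreal (2 * e + 2 * (Cf0 + Lg1 * Lf0 / \<mu>)\<^sup>2)"
proof -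
  have "mD k \<le> ennreal (2 * e + 0 * 0 + 2 * (Cf0 + Lg1 * Lf0 / \<mu>)\<^sup>2)"
    unfolding mD_def
  proof (rule mean_sq_combination[where P = "\<lambda>\<omega>. D k \<omega> - gradPhi (X k \<omega>)" and Q = "\<lambda>_. 0 :: real"])
    show "(\<lambda>\<omega>. D k \<omega> - gradPhi (X k \<omega>)) \<in> borel_measurable M"
      by (intro borel_measurable_diff D_measurable state_measurable k)
    fix \<omega>
    have "norm (D k \<omega>) \<le> norm (D k \<omega> - gradPhi (X k \<omega>)) + norm (gradPhi (X k \<omega>))"
      using norm_triangle_ineq[of "D k \<omega> - gradPhi (X k \<omega>)" "gradPhi (X k \<omega>)"] by simp
    then have "norm (D k \<omega>) \<le> norm (D k \<omega> - gradPhi (X k \<omega>)) + (Cf0 + Lg1 * Lf0 / \<mu>)"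
      using gradPhi_bound[of "X k \<omega>"] by linarith
    from power_mono[OF this, of 2]
    show "(norm (D k \<omega>))\<^sup>2 \<le> 2 * (norm (D k \<omega> - gradPhi (X k \<omega>)))\<^sup>2 + 0 * (norm (0::real))\<^sup>2 + 2 * (Cf0 + Lg1 * Lf0 / \<mu>)\<^sup>2"
      using sum_squares_bound[of "norm (D k \<omega> - gradPhi (X k \<omega>))" "Cf0 + Lg1 * Lf0 / \<mu>"]
      by (simp add: power2_sum[of "norm (D k \<omega> - gradPhi (X k \<omega>))"])
  qed (use e in \<open>auto simp: mE_def mean_sq_def\<close>)
  then show ?thesis by simp
qed

text \<open>The update was compared with \<open>y\<^sup>*\<close> at the old \<open>x\<close>; the Lipschitz continuity of \<open>y\<^sup>*\<close> accounts for the step of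
\<open>x\<close>. The next lemma does the same for \<open>u\<^sup>*\<close>.\<close>

lemma y_moving_target:
  assumes k: "k < K" and m: "0 \<le> m" "mean_norm M (\<lambda>\<omega>. Y (Suc k) \<omega> - ys (X k \<omega>)) \<le> ennreal m"
    and d: "0 \<le> d" "mD k \<le> ennreal d"
  shows "mean_norm M (\<lambda>\<omega>. Y (Suc k) \<omega> - ys (X (Suc k) \<omega>)) \<le> ennreal (m + Lg1 / \<mu> * \<alpha> * sqrt d)"
proof -
  let ?c = "Lg1 / \<mu> * \<alpha>"
  have c: "0 \<le> ?c" using pos alpha by simp
  have meas: "(\<lambda>\<omega>. Y (Suc k) \<omega> - ys (X k \<omega>)) \<in> borel_measurable M"
    using k by (intro borel_measurable_diff iterates_measurable state_measurable) auto
  have "mean_norm M (\<lambda>\<omega>. Y (Suc k) \<omega> - ys (X (Suc k) \<omega>)) \<le>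
      (\<integral>\<^sup>+\<omega>. ennreal (norm (Y (Suc k) \<omega> - ys (X k \<omega>))) + ennreal ?c * ennreal (norm (D k \<omega>)) \<partial>M)"
    unfolding mean_norm_def
  proof (rule nn_integral_mono)
    fix \<omega>
    have "norm (ys (X k \<omega>) - ys (X (Suc k) \<omega>)) \<le> Lg1 / \<mu> * norm (X k \<omega> - X (Suc k) \<omega>)" by (rule ystar_lipschitz)
    also have "\<dots> = ?c * norm (D k \<omega>)" using alpha by (simp add: X_Suc)
    finally have "norm (Y (Suc k) \<omega> - ys (X (Suc k) \<omega>)) \<le> norm (Y (Suc k) \<omega> - ys (X k \<omega>)) + ?c * norm (D k \<omega>)"
      using norm_triangle_ineq[of "Y (Suc k) \<omega> - ys (X k \<omega>)" "ys (X k \<omega>) - ys (X (Suc k) \<omega>)"] by simp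
    from ennreal_leI[OF this]
    show "ennreal (norm (Y (Suc k) \<omega> - ys (X (Suc k) \<omega>))) \<le> ennreal (norm (Y (Suc k) \<omega> - ys (X k \<omega>))) + ennreal ?c * ennreal (norm (D k \<omega>))"
      using c by (simp add: ennreal_plus ennreal_mult del: times_divide_eq_left)
  qed
  also have "\<dots> = mean_norm M (\<lambda>\<omega>. Y (Suc k) \<omega> - ys (X k \<omega>)) + ennreal ?c * mean_norm M (D k)"
    using meas D_measurable[OF k] by (simp add: mean_norm_def nn_integral_add nn_integral_cmult)
  also have "\<dots> \<le> ennreal m + ennreal ?c * ennreal (sqrt d)"
    using d by (intro add_mono mult_left_mono m mean_norm_le_sqrt D_measurable k) (auto simp: mD_def)
  also have "\<dots> = ennreal (m + ?c * sqrt d)"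
    using c m(1) d(1) by (simp add: ennreal_plus ennreal_mult del: times_divide_eq_left)
  finally show ?thesis .
qed

lemma u_moving_target:
  assumes k: "k < K" and s: "0 \<le> s" "mean_sq M (\<lambda>\<omega>. U (Suc k) \<omega> - us (X k \<omega>)) \<le> ennreal s"
    and d: "0 \<le> d" "mD k \<le> ennreal d"
  shows "mU (Suc k) \<le> ennreal (2 * s + 2 * (L1 / \<mu> * (1 + Lg1 / \<mu>))\<^sup>2 * \<alpha>\<^sup>2 * d)"
proof -
  let ?l = "L1 / \<mu> * (1 + Lg1 / \<mu>)"
  have "mU (Suc k) \<le> ennreal (2 * s + (2 * ?l\<^sup>2 * \<alpha>\<^sup>2) * d + 0)"
    unfolding mU_def
  proof (rule mean_sq_combination[where P = "\<lambda>\<omega>. U (Suc k) \<omega> - us (X k \<omega>)" and Q = "D k"])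
    show "(\<lambda>\<omega>. U (Suc k) \<omega> - us (X k \<omega>)) \<in> borel_measurable M"
      using k by (intro borel_measurable_diff iterates_measurable state_measurable) auto
    fix \<omega>
    have "norm (us (X k \<omega>) - us (X (Suc k) \<omega>)) \<le> ?l * norm (X k \<omega> - X (Suc k) \<omega>)" by (rule ustar_lipschitz)
    also have "\<dots> = ?l * \<alpha> * norm (D k \<omega>)" using alpha by (simp add: X_Suc)
    finally have "norm (U (Suc k) \<omega> - us (X (Suc k) \<omega>)) \<le> norm (U (Suc k) \<omega> - us (X k \<omega>)) + ?l * \<alpha> * norm (D k \<omega>)"
      using norm_triangle_ineq[of "U (Suc k) \<omega> - us (X k \<omega>)" "us (X k \<omega>) - us (X (Suc k) \<omega>)"] by simp
    from power_mono[OF this, of 2]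
    have "(norm (U (Suc k) \<omega> - us (X (Suc k) \<omega>)))\<^sup>2 \<le> 2 * (norm (U (Suc k) \<omega> - us (X k \<omega>)))\<^sup>2 + 2 * (?l * \<alpha> * norm (D k \<omega>))\<^sup>2"
      using sum_squares_bound[of "norm (U (Suc k) \<omega> - us (X k \<omega>))" "?l * \<alpha> * norm (D k \<omega>)"]
      by (simp add: power2_sum[of "norm (U (Suc k) \<omega> - us (X k \<omega>))"])
    then show "(norm (U (Suc k) \<omega> - us (X (Suc k) \<omega>)))\<^sup>2 \<le> 2 * (norm (U (Suc k) \<omega> - us (X k \<omega>)))\<^sup>2 + 2 * ?l\<^sup>2 * \<alpha>\<^sup>2 * (norm (D k \<omega>))\<^sup>2 + 0"
      by (simp only: power_mult_distrib mult.assoc add_0_right)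
  qed (use s d D_measurable[OF k] in \<open>auto simp: mD_def\<close>)
  then show ?thesis by simp
qed

text \<open>The descent inequality holds pointwise. Subtracting the infimum of \<open>\<Phi>\<close> makes all terms nonnegative, so it may be
integrated without knowing integrability in advance.\<close>

lemma gap_step:
  assumes k: "k < K"
  shows "gap (Suc k) + ennreal (\<alpha> / 2) * mG k + ennreal (\<alpha> / 4) * mD k \<le> gap k + ennreal (\<alpha> / 2) * mE k"
proof -
  have m: "(\<lambda>\<omega>. ennreal (Phi f g (X (Suc k) \<omega>) - Phi_opt f g)) \<in> borel_measurable M"
    "(\<lambda>\<omega>. ennreal (Phi f g (X k \<omega>) - Phi_opt f g)) \<in> borel_measurable M"
    "D k \<in> borel_measurable M" "(\<lambda>\<omega>. gradPhi (X k \<omega>)) \<in> borel_measurable M"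
    using iterates_measurable(1)[of "Suc k"] k Phi_measurable state_measurable[OF k] D_measurable[OF k]
    by (auto intro!: measurable_compose[OF _ measurable_ennreal] borel_measurable_diff intro: measurable_compose)
  have "gap (Suc k) + ennreal (\<alpha> / 2) * mG k + ennreal (\<alpha> / 4) * mD k =
     (\<integral>\<^sup>+\<omega>. ennreal (Phi f g (X (Suc k) \<omega>) - Phi_opt f g) + ennreal (\<alpha> / 2) * ennreal ((norm (gradPhi (X k \<omega>)))\<^sup>2)
        + ennreal (\<alpha> / 4) * ennreal ((norm (D k \<omega>))\<^sup>2) \<partial>M)"
    using m by (simp add: gap_def mG_def mD_def mean_sq_def nn_integral_add nn_integral_cmult)
  also have "\<dots> \<le> (\<integral>\<^sup>+\<omega>. ennreal (Phi f g (X k \<omega>) - Phi_opt f g) + ennreal (\<alpha> / 2) * ennreal ((norm (D k \<omega> - gradPhi (X k \<omega>)))\<^sup>2) \<partial>M)"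
  proof (rule nn_integral_mono)
    fix \<omega>
    let ?a = "Phi f g (X (Suc k) \<omega>) - Phi_opt f g" and ?c = "Phi f g (X k \<omega>) - Phi_opt f g"
    have nn: "0 \<le> ?a" "0 \<le> ?c" "0 \<le> \<alpha> / 2" "0 \<le> \<alpha> / 4" using Phi_opt_le alpha by simp_all
    have nn2: "0 \<le> \<alpha> / 2 * (norm (gradPhi (X k \<omega>)))\<^sup>2" "0 \<le> \<alpha> / 4 * (norm (D k \<omega>))\<^sup>2"
      "0 \<le> \<alpha> / 2 * (norm (D k \<omega> - gradPhi (X k \<omega>)))\<^sup>2" using nn by simp_all
    have nn3: "0 \<le> ?a + \<alpha> / 2 * (norm (gradPhi (X k \<omega>)))\<^sup>2" using nn nn2 by linarith
    have "?a + \<alpha> / 2 * (norm (gradPhi (X k \<omega>)))\<^sup>2 + \<alpha> / 4 * (norm (D k \<omega>))\<^sup>2 \<le> ?c + \<alpha> / 2 * (norm (D k \<omega> - gradPhi (X k \<omega>)))\<^sup>2"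
      using gradient_descent_step[OF alpha, of "X k \<omega>" "D k \<omega>"] by (simp add: X_Suc)
    from ennreal_leI[OF this]
    show "ennreal ?a + ennreal (\<alpha> / 2) * ennreal ((norm (gradPhi (X k \<omega>)))\<^sup>2) + ennreal (\<alpha> / 4) * ennreal ((norm (D k \<omega>))\<^sup>2)
       \<le> ennreal ?c + ennreal (\<alpha> / 2) * ennreal ((norm (D k \<omega> - gradPhi (X k \<omega>)))\<^sup>2)"
      by (simp only: nn nn2 nn3 ennreal_plus ennreal_mult zero_le_power2)
  qed
  also have "\<dots> = gap k + ennreal (\<alpha> / 2) * mE k"
    using m by (simp add: gap_def mE_def mean_sq_def nn_integral_add nn_integral_cmult)
  finally show ?thesis .
qed

lemma gap_0: "gap 0 \<le> ennreal \<Delta>" and Delta_nonneg: "0 \<le> \<Delta>"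
proof -
  have int: "integrable M (\<lambda>\<omega>. Phi f g (X 0 \<omega>) - Phi_opt f g)"
    and le: "(\<integral>\<omega>. Phi f g (X 0 \<omega>) - Phi_opt f g \<partial>M) \<le> \<Delta>"
    using init_gap by (auto simp: initial_gap_le_def prob_space)
  have "gap 0 = ennreal (\<integral>\<omega>. Phi f g (X 0 \<omega>) - Phi_opt f g \<partial>M)"
    unfolding gap_def using Phi_opt_le by (intro nn_integral_eq_integral int) auto
  then show "gap 0 \<le> ennreal \<Delta>" using le by (simp add: ennreal_leI)
  have "0 \<le> (\<integral>\<omega>. Phi f g (X 0 \<omega>) - Phi_opt f g \<partial>M)"
    using Phi_opt_le by (intro integral_nonneg_AE) auto
  then show "0 \<le> \<Delta>" using le by simp
qed

lemma r_ge_1: "1 \<le> r" using moment by (simp add: moment_assumption_def)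

context
  fixes k p q assumes k: "k < K" and p: "0 \<le> p" "mY k \<le> ennreal p" and q: "0 \<le> q" "mU k \<le> ennreal q"
begin

lemma mE_le: "mE k \<le> ennreal (4 * L1\<^sup>2 * p + (8 * v4 + 4 * Lg1\<^sup>2) * q + (4 * v3 + 8 * v4 * (Lf0 / \<mu>)\<^sup>2))"
  unfolding mE_def by (rule direction_step[OF k p[unfolded mY_def] q[unfolded mU_def] v3[OF k] v4[OF k]])

lemma mU_Suc_le:
  assumes d: "0 \<le> d" "mD k \<le> ennreal d"
  shows "mU (Suc k) \<le> ennreal (2 * (4 * (L1 / \<mu>)\<^sup>2 * p + (16 * v1 / \<mu>\<^sup>2 + 1 / 16) * q + (16 * v1 * (Lf0 / \<mu>)\<^sup>2 + 8 * v3) / \<mu>\<^sup>2)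
      + 2 * (L1 / \<mu> * (1 + Lg1 / \<mu>))\<^sup>2 * \<alpha>\<^sup>2 * d)"
proof (rule u_moving_target[OF k _ adjoint_step[OF k p[unfolded mY_def] q[unfolded mU_def] delta9 v1[OF k] v3[OF k]] d])
  have "0 \<le> v1" "0 \<le> v3" using order_trans[OF _ v1[OF k]] order_trans[OF _ v3[OF k]] by auto
  then show "0 \<le> 4 * (L1 / \<mu>)\<^sup>2 * p + (16 * v1 / \<mu>\<^sup>2 + 1 / 16) * q + (16 * v1 * (Lf0 / \<mu>)\<^sup>2 + 8 * v3) / \<mu>\<^sup>2"
    using p q by simp
qed

text \<open>The moment assumption turns the first moment bounded in \<open>lower_level_step\<close> into a second moment.\<close>

lemma mY_Suc_le:
  assumes d: "0 \<le> d" "mD k \<le> ennreal d"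
  shows "mY (Suc k) \<le> ennreal (r * ((1 + \<theta>) * (Lg2 / \<mu> * p) + (1 + \<theta>) * sqrt V + \<theta> * sqrt p + Lg1 / \<mu> * \<alpha> * sqrt d)\<^sup>2)"
proof -
  let ?m = "(1 + \<theta>) * (Lg2 / \<mu> * p) + (1 + \<theta>) * sqrt V + \<theta> * sqrt p"
  have "0 \<le> V" using order_trans[OF _ V[OF k]] by simp
  then have m: "0 \<le> ?m" using p theta pos by simp
  have m': "0 \<le> ?m + Lg1 / \<mu> * \<alpha> * sqrt d" using m d pos alpha by simp
  have "mY (Suc k) \<le> ennreal r * (mean_norm M (\<lambda>\<omega>. Y (Suc k) \<omega> - ys (X (Suc k) \<omega>)))\<^sup>2"
    using moment k by (auto simp: moment_assumption_def mY_def)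
  also have "\<dots> \<le> ennreal r * (ennreal (?m + Lg1 / \<mu> * \<alpha> * sqrt d))\<^sup>2"
    by (intro mult_left_mono power_mono y_moving_target[OF k m lower_level_step[OF k p[unfolded mY_def] q[unfolded mU_def] theta V[OF k]] d]) auto
  also have "\<dots> = ennreal (r * (?m + Lg1 / \<mu> * \<alpha> * sqrt d)\<^sup>2)"
    using r_ge_1 m' by (subst ennreal_power[OF m'], subst ennreal_mult) auto
  finally show ?thesis .
qed

end

text \<open>Finiteness of the moments of iterate \<open>k\<close> bounds \<open>E |D\<^sub>x|\<^sup>2\<close> and hence all moments of iterate \<open>k + 1\<close>.\<close>

lemma finite_moments: "k \<le> K \<Longrightarrow> mY k < \<top> \<and> mU k < \<top> \<and> gap k < \<top>"
proof (induction k)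
  case 0
  then show ?case
    using init_y init_u gap_0 unfolding mY_def mU_def by (auto intro: le_less_trans)
next
  case (Suc k)
  then have k: "k < K" by simp
  define p q where "p = enn2real (mY k)" and "q = enn2real (mU k)"
  have p: "0 \<le> p" "mY k \<le> ennreal p" and q: "0 \<le> q" "mU k \<le> ennreal q"
    using Suc by (simp_all add: p_def q_def)
  have fin: "mE k < \<top>" using mE_le[OF k p q] by (rule le_less_trans) simp
  define e where "e = enn2real (mE k)"
  have e: "0 \<le> e" "mE k \<le> ennreal e" using fin by (simp_all add: e_def)
  define d where "d = 2 * e + 2 * (Cf0 + Lg1 * Lf0 / \<mu>)\<^sup>2"
  have d: "0 \<le> d" "mD k \<le> ennreal d" using direction_bound[OF k e] e(1) by (simp_all add: d_def)
  have "gap (Suc k) \<le> gap k + ennreal (\<alpha> / 2) * mE k"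
    using gap_step[OF k] by (auto intro: order_trans[rotated] simp: add.assoc)
  also have "\<dots> < \<top>" using Suc fin by (simp add: ennreal_mult_less_top)
  finally show ?case
    using le_less_trans[OF mY_Suc_le[OF k p q d] ennreal_less_top] le_less_trans[OF mU_Suc_le[OF k p q d] ennreal_less_top] by simp
qed

definition "\<phi> k = enn2real (mY k)"
definition "\<psi> k = enn2real (mU k)"
definition "dd k = enn2real (mD k)"
definition "ee k = enn2real (mE k)"
definition "nn k = enn2real (mG k)"
definition "gg k = enn2real (gap k)"

lemma real_nonneg: "0 \<le> \<phi> k" "0 \<le> \<psi> k" "0 \<le> dd k" "0 \<le> ee k" "0 \<le> nn k" "0 \<le> gg k"
  by (simp_all add: \<phi>_def \<psi>_def dd_def ee_def nn_def gg_def)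

lemma init_real: "\<phi> 0 \<le> p0" "\<psi> 0 \<le> q0" "gg 0 \<le> \<Delta>"
  using init_y init_u gap_0 init_nonneg Delta_nonneg
  by (simp_all add: \<phi>_def \<psi>_def gg_def mY_def mU_def enn2real_leI)

lemma mG_real: "mG k = ennreal (nn k)"
  using le_less_trans[OF mG_le[of k] ennreal_less_top] by (simp add: nn_def)

context
  fixes k assumes k: "k < K"
begin

lemma mY_real: "mY k \<le> ennreal (\<phi> k)" and mU_real: "mU k \<le> ennreal (\<psi> k)"
  using finite_moments[of k] k by (simp_all add: \<phi>_def \<psi>_def)

lemma v_nonneg: "0 \<le> v1" "0 \<le> v3" "0 \<le> v4" "0 \<le> V"
  using order_trans[OF _ v1[OF k]] order_trans[OF _ v3[OF k]] order_trans[OF _ v4[OF k]] order_trans[OF _ V[OF k]] by auto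

lemma ee_le: "ee k \<le> 4 * L1\<^sup>2 * \<phi> k + (8 * v4 + 4 * Lg1\<^sup>2) * \<psi> k + (4 * v3 + 8 * v4 * (Lf0 / \<mu>)\<^sup>2)"
  unfolding ee_def using v_nonneg real_nonneg
  by (intro enn2real_leI mE_le[OF k _ mY_real _ mU_real]) auto

lemma mE_real: "mE k = ennreal (ee k)"
  using le_less_trans[OF mE_le[OF k real_nonneg(1) mY_real real_nonneg(2) mU_real] ennreal_less_top]
  by (simp add: ee_def)

lemma dd_le: "dd k \<le> 2 * ee k + 2 * (Cf0 + Lg1 * Lf0 / \<mu>)\<^sup>2"
  unfolding dd_def using real_nonneg mE_real
  by (intro enn2real_leI direction_bound[OF k]) auto

lemma mD_real: "mD k = ennreal (dd k)"
  using le_less_trans[OF direction_bound[OF k real_nonneg(4) eq_refl[OF mE_real]] ennreal_less_top]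
  by (simp add: dd_def)

lemma \<psi>_Suc_le: "\<psi> (Suc k) \<le> 2 * (4 * (L1 / \<mu>)\<^sup>2 * \<phi> k + (16 * v1 / \<mu>\<^sup>2 + 1 / 16) * \<psi> k + (16 * v1 * (Lf0 / \<mu>)\<^sup>2 + 8 * v3) / \<mu>\<^sup>2)
      + 2 * (L1 / \<mu> * (1 + Lg1 / \<mu>))\<^sup>2 * \<alpha>\<^sup>2 * dd k"
proof -
  have "0 \<le> 2 * (4 * (L1 / \<mu>)\<^sup>2 * \<phi> k + (16 * v1 / \<mu>\<^sup>2 + 1 / 16) * \<psi> k + (16 * v1 * (Lf0 / \<mu>)\<^sup>2 + 8 * v3) / \<mu>\<^sup>2)
      + 2 * (L1 / \<mu> * (1 + Lg1 / \<mu>))\<^sup>2 * \<alpha>\<^sup>2 * dd k"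
    using v_nonneg real_nonneg by simp
  then show ?thesis unfolding \<psi>_def[of "Suc k"]
    by (rule enn2real_leI) (rule mU_Suc_le[OF k real_nonneg(1) mY_real real_nonneg(2) mU_real real_nonneg(3) eq_refl[OF mD_real]])
qed

lemma \<phi>_Suc_le: "\<phi> (Suc k) \<le> r * ((1 + \<theta>) * (Lg2 / \<mu> * \<phi> k) + (1 + \<theta>) * sqrt V + \<theta> * sqrt (\<phi> k) + Lg1 / \<mu> * \<alpha> * sqrt (dd k))\<^sup>2"
proof -
  have "0 \<le> r * ((1 + \<theta>) * (Lg2 / \<mu> * \<phi> k) + (1 + \<theta>) * sqrt V + \<theta> * sqrt (\<phi> k) + Lg1 / \<mu> * \<alpha> * sqrt (dd k))\<^sup>2"
    using r_ge_1 by simp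
  then show ?thesis unfolding \<phi>_def[of "Suc k"]
    by (rule enn2real_leI) (rule mY_Suc_le[OF k real_nonneg(1) mY_real real_nonneg(2) mU_real real_nonneg(3) eq_refl[OF mD_real]])
qed

lemma gg_step: "gg (Suc k) + \<alpha> / 2 * nn k + \<alpha> / 4 * dd k \<le> gg k + \<alpha> / 2 * ee k"
proof -
  have g: "gap (Suc k) = ennreal (gg (Suc k))" "gap k = ennreal (gg k)"
    using finite_moments[of k] finite_moments[of "Suc k"] k by (simp_all add: gg_def)
  have nn: "0 \<le> \<alpha> / 2" "0 \<le> \<alpha> / 4" "0 \<le> \<alpha> / 2 * nn k" "0 \<le> \<alpha> / 4 * dd k" "0 \<le> \<alpha> / 2 * ee k"
    "0 \<le> gg (Suc k) + \<alpha> / 2 * nn k" "0 \<le> gg k + \<alpha> / 2 * ee k"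
    using alpha real_nonneg by simp_all
  have "ennreal (gg (Suc k) + \<alpha> / 2 * nn k + \<alpha> / 4 * dd k) \<le> ennreal (gg k + \<alpha> / 2 * ee k)"
    using gap_step[OF k] unfolding g mG_real mD_real mE_real
    by (simp only: nn real_nonneg ennreal_plus ennreal_mult)
  then show ?thesis using nn by (subst (asm) ennreal_le_iff) auto
qed

end

end

section \<open>Solving the recursions\<close>

text \<open>The recursions after removing the powers of \<open>\<kappa>\<close>: \<open>\<phi>\<close> is \<open>\<kappa>\<^sup>2 E |y - y\<^sup>*|\<^sup>2\<close>, while \<open>s\<close>, \<open>t\<close> and \<open>w\<close> are
\<open>E |u - u\<^sup>*|\<^sup>2\<close>, \<open>E |D\<^sub>x|\<^sup>2\<close> and \<open>E |D\<^sub>x - \<nabla>\<Phi>|\<^sup>2\<close> divided by \<open>\<kappa>\<^sup>2\<close>; \<open>a2\<close> is \<open>(\<alpha> \<kappa>\<^sup>3)\<^sup>2\<close>, and \<open>m\<close> is the common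
size of the variances. The bounds \<open>\<phi> \<le> P0\<close> and \<open>s \<le> S0\<close>, which imply \<open>t \<le> T0\<close>, are invariant. They
make the first recursion available for all \<open>k\<close>; summing the geometric recursions then bounds the sum of \<open>w\<close>
by \<open>O(\<kappa>)\<close> plus a multiple of \<open>a2\<close> times the sum of \<open>t\<close>.\<close>

lemma scaled_recursion:
  fixes \<phi> s t w :: "nat \<Rightarrow> real"
  assumes nonneg: "\<And>k. 0 \<le> \<phi> k" "\<And>k. 0 \<le> s k" "\<And>k. 0 \<le> t k" "\<And>k. 0 \<le> w k"
    and m: "0 \<le> m" "m \<le> 1" "m * real K \<le> \<kappa>" "1 \<le> \<kappa>"
    and h1: "\<And>k. k < K \<Longrightarrow> \<phi> k \<le> P0 \<Longrightarrow> \<phi> (Suc k) \<le> \<phi> k / 8 + P0 / 4 * m + beta2 * a2 * t k"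
    and h2: "\<And>k. k < K \<Longrightarrow> s (Suc k) \<le> s k / 4 + beta3 * \<phi> k + beta4 * m + beta3 * a2 * t k"
    and h3: "\<And>k. k < K \<Longrightarrow> w k \<le> C1 * \<phi> k + C2 * s k + C3 * m"
    and h4: "\<And>k. k < K \<Longrightarrow> t k \<le> 2 * w k + C5"
    and init: "\<phi> 0 \<le> P0" "s 0 \<le> S0" "s 0 \<le> Q1 * \<kappa>"
    and pos: "0 \<le> P0" "0 \<le> beta2" "0 \<le> beta3" "0 \<le> beta4" "0 \<le> C1" "0 \<le> C2" "0 \<le> C3" "0 \<le> a2" "0 \<le> S0"
    and T0: "T0 = 2 * (C1 * P0 + C2 * S0 + C3) + C5"
    and small: "beta2 * a2 * T0 \<le> P0 / 4" "beta3 * a2 * T0 \<le> 1" "beta3 * P0 + beta4 + 1 \<le> S0 / 2"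
  shows "(\<Sum>k<K. w k) \<le> (C1 * (5 / 2 * P0) + C2 * (2 * Q1 + 5 * beta3 * P0 + 2 * beta4) + C3) * \<kappa>
    + (2 * C1 * beta2 + C2 * (4 * beta3 * beta2 + 2 * beta3)) * a2 * (\<Sum>k<K. t k)"
proof -
  have t_bound: "t k \<le> T0" if k: "k < K" and b: "\<phi> k \<le> P0" "s k \<le> S0" for k
  proof -
    have "C1 * \<phi> k \<le> C1 * P0" "C2 * s k \<le> C2 * S0" "C3 * m \<le> C3 * 1"
      using b pos m by (auto intro: mult_left_mono mult_left_le)
    then show ?thesis using h3[OF k] h4[OF k] by (simp add: T0)
  qed
  have inv: "k \<le> K \<Longrightarrow> \<phi> k \<le> P0 \<and> s k \<le> S0" for k
  proof (induction k)
    case 0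
    then show ?case using init by simp
  next
    case (Suc k)
    then have k: "k < K" and IH: "\<phi> k \<le> P0" "s k \<le> S0" by auto
    note t = t_bound[OF k IH]
    have "beta2 * a2 * t k \<le> beta2 * a2 * T0" "beta3 * a2 * t k \<le> beta3 * a2 * T0" "beta3 * \<phi> k \<le> beta3 * P0"
      "P0 / 4 * m \<le> P0 / 4 * 1" "beta4 * m \<le> beta4 * 1"
      using t IH pos m by (auto intro: mult_left_mono mult_nonneg_nonneg mult_left_le)
    then show ?case using h1[OF k IH(1)] h2[OF k] IH small pos by linarith
  qed
  define S where "S = (\<Sum>k<K. t k)"
  \<comment> \<open>Adding the nonnegative term \<open>f K\<close> allows to shift the index and insert the recursion.\<close>
  have shift: "(\<Sum>k<K. f k) \<le> f 0 + (\<Sum>k<K. f (Suc k))" if "\<And>k. 0 \<le> f k" for f :: "nat \<Rightarrow> real"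
  proof -
    have "(\<Sum>k<K. f k) \<le> (\<Sum>k<Suc K. f k)" using that by simp
    also have "\<dots> = f 0 + (\<Sum>k<K. f (Suc k))" by (rule sum.lessThan_Suc_shift)
    finally show ?thesis .
  qed
  have S\<phi>: "(\<Sum>k<K. \<phi> k) \<le> 2 * P0 + P0 / 2 * \<kappa> + 2 * beta2 * a2 * S"
  proof -
    have "(\<Sum>k<K. \<phi> (Suc k)) \<le> (\<Sum>k<K. \<phi> k / 8 + P0 / 4 * m + beta2 * a2 * t k)"
      by (intro sum_mono h1) (use inv in auto)
    also have "\<dots> = (\<Sum>k<K. \<phi> k) / 8 + P0 / 4 * (m * real K) + beta2 * a2 * S"
      by (simp add: sum.distrib sum_distrib_left sum_divide_distrib S_def)
    finally have step: "(\<Sum>k<K. \<phi> (Suc k)) \<le> (\<Sum>k<K. \<phi> k) / 8 + P0 / 4 * (m * real K) + beta2 * a2 * S" .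
    have "P0 / 4 * (m * real K) \<le> P0 / 4 * \<kappa>" using m pos by (intro mult_left_mono) auto
    with step have "(\<Sum>k<K. \<phi> k) \<le> P0 + (\<Sum>k<K. \<phi> k) / 8 + P0 / 4 * \<kappa> + beta2 * a2 * S"
      using shift[of \<phi>, OF nonneg(1)] init by linarith
    moreover have "0 \<le> (\<Sum>k<K. \<phi> k)" by (intro sum_nonneg nonneg)
    ultimately show ?thesis by linarith
  qed
  have Ss: "(\<Sum>k<K. s k) \<le> 2 * Q1 * \<kappa> + 2 * beta3 * (\<Sum>k<K. \<phi> k) + 2 * beta4 * \<kappa> + 2 * beta3 * a2 * S"
  proof -
    have "(\<Sum>k<K. s (Suc k)) \<le> (\<Sum>k<K. s k / 4 + beta3 * \<phi> k + beta4 * m + beta3 * a2 * t k)"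
      by (intro sum_mono h2) auto
    also have "\<dots> = (\<Sum>k<K. s k) / 4 + beta3 * (\<Sum>k<K. \<phi> k) + beta4 * (m * real K) + beta3 * a2 * S"
      by (simp add: sum.distrib sum_distrib_left sum_divide_distrib S_def)
    finally have step: "(\<Sum>k<K. s (Suc k)) \<le> (\<Sum>k<K. s k) / 4 + beta3 * (\<Sum>k<K. \<phi> k) + beta4 * (m * real K) + beta3 * a2 * S" .
    have "beta4 * (m * real K) \<le> beta4 * \<kappa>" using m pos by (intro mult_left_mono) auto
    with step have "(\<Sum>k<K. s k) \<le> Q1 * \<kappa> + (\<Sum>k<K. s k) / 4 + beta3 * (\<Sum>k<K. \<phi> k) + beta4 * \<kappa> + beta3 * a2 * S"
      using shift[of s, OF nonneg(2)] init by linarith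
    moreover have "0 \<le> (\<Sum>k<K. s k)" by (intro sum_nonneg nonneg)
    ultimately show ?thesis by linarith
  qed
  have "(\<Sum>k<K. w k) \<le> (\<Sum>k<K. C1 * \<phi> k + C2 * s k + C3 * m)" by (intro sum_mono h3) auto
  also have "\<dots> = C1 * (\<Sum>k<K. \<phi> k) + C2 * (\<Sum>k<K. s k) + C3 * (m * real K)"
    by (simp add: sum.distrib sum_distrib_left)
  also have "\<dots> \<le> C1 * (\<Sum>k<K. \<phi> k) + C2 * (2 * Q1 * \<kappa> + 2 * beta3 * (\<Sum>k<K. \<phi> k) + 2 * beta4 * \<kappa> + 2 * beta3 * a2 * S) + C3 * \<kappa>"
    using Ss m pos by (intro add_mono mult_left_mono) auto
  also have "\<dots> = (C1 + 2 * C2 * beta3) * (\<Sum>k<K. \<phi> k) + (C2 * (2 * Q1 + 2 * beta4) + C3) * \<kappa> + C2 * (2 * beta3) * a2 * S"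
    by (simp add: algebra_simps)
  also have "\<dots> \<le> (C1 + 2 * C2 * beta3) * (5 / 2 * P0 * \<kappa> + 2 * beta2 * a2 * S) + (C2 * (2 * Q1 + 2 * beta4) + C3) * \<kappa> + C2 * (2 * beta3) * a2 * S"
  proof (intro add_right_mono mult_left_mono)
    have "2 * P0 \<le> 2 * P0 * \<kappa>" using pos(1) m(4) by (simp add: mult_le_cancel_left1)
    then show "(\<Sum>k<K. \<phi> k) \<le> 5 / 2 * P0 * \<kappa> + 2 * beta2 * a2 * S" using S\<phi> by linarith
    show "0 \<le> C1 + 2 * C2 * beta3" using pos by simp
  qed
  also have "\<dots> = (C1 * (5 / 2 * P0) + C2 * (2 * Q1 + 5 * beta3 * P0 + 2 * beta4) + C3) * \<kappa>
    + (2 * C1 * beta2 + C2 * (4 * beta3 * beta2 + 2 * beta3)) * a2 * S"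
    by (simp add: algebra_simps)
  finally show ?thesis by (simp add: S_def)
qed

text \<open>The constants of the theorem, as functions of the quantities that are regarded as fixed; \<open>\<mu>\<close> and \<open>\<kappa>\<close> do
not occur. Their origin:
 \<^item> \<open>L\<close> is \<open>max L\<^sub>g\<^sub>1 L\<^sub>f\<^sub>1\<close>, so that \<open>\<mu> = L / \<kappa>\<close>, and \<open>ell\<close> satisfies \<open>L\<^sub>1 \<le> ell \<kappa>\<close>;
 \<^item> \<open>P0\<close>, \<open>Q0\<close>, \<open>Q1\<close> rewrite the bounds on the initial iterate in scaled quantities;
 \<^item> \<open>delta0\<close> is the accuracy required of the inner loop. Its two halves are provided by \<open>c0\<close> (batch size) and \<open>cT\<close>
   (number of steps), and \<open>theta0\<close> is the corresponding first-moment factor;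
 \<^item> \<open>c1\<close> and \<open>c2\<close> are batch sizes that keep the noise terms of the recursions below the contraction and \<open>P0 / 4\<close>;
 \<^item> \<open>beta2\<close>, \<open>beta3\<close>, \<open>beta4\<close>, \<open>C1\<close>, \<open>C2\<close>, \<open>C3\<close>, \<open>C5\<close> are the coefficients of \<open>scaled_recursion\<close>, \<open>S0\<close> and
   \<open>T0\<close> its invariants, and \<open>E0\<close>, \<open>E1\<close> the coefficients in its conclusion;
 \<^item> \<open>a\<close> is the scaled step size \<open>\<alpha> \<kappa>\<^sup>3\<close>; its denominator collects all smallness requirements listed in
   \<open>a_le\<close>;
 \<^item> \<open>Ctot \<kappa>\<^sup>3\<close> bounds the sum of \<open>E |\<nabla>\<Phi>|\<^sup>2\<close> over a run.\<close>

locale rate_constants =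
  fixes Lf0 Lf1 Lg1 Lg2 Cf0 \<sigma>f1 \<sigma>g1 \<sigma>g2 r \<gamma> \<Delta> :: real
  assumes cpos: "0 < Lf0" "0 < Lf1" "0 < Lg1" "0 < Lg2" "0 < Cf0" "0 < \<sigma>f1" "0 < \<sigma>g1" "0 < \<sigma>g2" "0 < \<gamma>"
    and r1: "1 \<le> r"
begin

definition "L = max Lg1 Lf1"
definition "ell = Lf1 + Lg2 * Lf0 / L"
definition "P0 = L\<^sup>2 / (20 * r * Lg2\<^sup>2)"
definition "theta0 = 1 / (100 * sqrt r)"
definition "delta0 = 1 / (20000 * r)"
definition "c0 = 16 * \<sigma>g2\<^sup>2 / (delta0 * L\<^sup>2)"
definition "cT = 4 / (delta0 * \<gamma> * L)"
definition "c1 = 256 * \<sigma>g2\<^sup>2 / L\<^sup>2"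
definition "c2 = 64 * r * \<sigma>g1\<^sup>2 / (L\<^sup>2 * P0)"
definition "beta2 = 4 * r"
definition "beta3 = 8 * ell\<^sup>2 / L\<^sup>2"
definition "beta4 = 32 * \<sigma>g2\<^sup>2 * Lf0\<^sup>2 / (c1 * L^4) + 32 * \<sigma>f1\<^sup>2 / L\<^sup>2"
definition "C1 = 4 * ell\<^sup>2"
definition "C2 = 16 * \<sigma>g2\<^sup>2 + 4 * L\<^sup>2"
definition "C3 = 8 * \<sigma>f1\<^sup>2 + 16 * \<sigma>g2\<^sup>2 * Lf0\<^sup>2 / L\<^sup>2"
definition "C5 = 2 * (Cf0 + Lf0)\<^sup>2"
definition "Q0 = 4 * ell\<^sup>2 / (5 * r * Lg2\<^sup>2)"
definition "Q1 = ell / L\<^sup>2"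
definition "S0 = 2 * (beta3 * P0 + beta4 + 1) + Q0"
definition "T0 = 2 * (C1 * P0 + C2 * S0 + C3) + C5"
definition "E0 = C1 * (5 / 2 * P0) + C2 * (2 * Q1 + 5 * beta3 * P0 + 2 * beta4) + C3"
definition "E1 = 2 * C1 * beta2 + C2 * (4 * beta3 * beta2 + 2 * beta3)"
definition "a = 1 / (1 + 16 * ell + 4 * beta2 * T0 / P0 + beta3 * T0 + 2 * E1)"
definition "Ctot = 2 * \<bar>\<Delta>\<bar> / a + E0 + 1"

lemma const_pos:
  "0 < L" "0 < ell" "0 < P0" "0 < theta0" "0 < delta0" "0 < c0" "0 < cT" "0 < c1" "0 < c2" "0 < beta2" "0 < beta3" "0 < beta4"
  "0 < C1" "0 < C2" "0 < C3" "0 < C5" "0 < Q0" "0 < Q1" "0 < S0" "0 < T0" "0 < E0" "0 < E1" "0 < a" "0 < Ctot"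
proof -
  have r: "0 < r" using r1 by simp
  show L: "0 < L" using cpos by (simp add: L_def)
  show ell: "0 < ell" using L cpos by (simp add: ell_def add_pos_pos)
  show P0: "0 < P0" using L r cpos by (simp add: P0_def)
  show "0 < theta0" using r by (simp add: theta0_def)
  show delta0: "0 < delta0" using r by (simp add: delta0_def)
  show "0 < c0" "0 < cT" using delta0 L cpos by (simp_all add: c0_def cT_def)
  show c1: "0 < c1" using L cpos by (simp add: c1_def)
  show "0 < c2" using L P0 r cpos by (simp add: c2_def)
  show beta2: "0 < beta2" using r by (simp add: beta2_def)
  show beta3: "0 < beta3" using L ell by (simp add: beta3_def)
  show beta4: "0 < beta4" using L c1 cpos by (simp add: beta4_def add_pos_pos)
  show C1: "0 < C1" using ell by (simp add: C1_def)
  show C2: "0 < C2" using L cpos by (simp add: C2_def add_pos_pos)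
  show C3: "0 < C3" using L cpos by (simp add: C3_def add_pos_pos)
  show C5: "0 < C5" using cpos by (simp add: C5_def)
  show Q0: "0 < Q0" using ell r cpos by (simp add: Q0_def)
  show Q1: "0 < Q1" using ell L by (simp add: Q1_def)
  show S0: "0 < S0" using beta3 P0 beta4 Q0 by (simp add: S0_def add_pos_pos)
  show T0: "0 < T0" using C1 C2 C3 C5 S0 P0 by (simp add: T0_def add_pos_pos)
  show E0: "0 < E0" using C1 C2 C3 P0 Q1 beta3 beta4 by (simp add: E0_def add_pos_pos)
  show E1: "0 < E1" using C1 C2 beta2 beta3 by (simp add: E1_def add_pos_pos)
  show a: "0 < a" using ell beta2 T0 P0 beta3 E1 by (simp add: a_def add_pos_pos)
  show "0 < Ctot" using a E0 by (simp add: Ctot_def add_nonneg_pos)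
qed

lemma a_le: "a \<le> 1" "16 * ell * a \<le> 1" "beta2 * T0 * a\<^sup>2 \<le> P0 / 4" "beta3 * T0 * a\<^sup>2 \<le> 1" "2 * E1 * a\<^sup>2 \<le> 1"
proof -
  note p = const_pos
  define S where "S = 1 + 16 * ell + 4 * beta2 * T0 / P0 + beta3 * T0 + 2 * E1"
  have nn: "0 < 16 * ell" "0 < 4 * beta2 * T0 / P0" "0 < beta3 * T0" "0 < 2 * E1" using p by simp_all
  have S: "1 \<le> S" "16 * ell \<le> S" "4 * beta2 * T0 / P0 \<le> S" "beta3 * T0 \<le> S" "2 * E1 \<le> S"
    unfolding S_def using nn by linarith+
  have a: "a = 1 / S" by (simp add: a_def S_def)
  show a1: "a \<le> 1" using S by (simp add: a)
  have le: "x * a \<le> 1" if "x \<le> S" for x using that S by (simp add: a divide_le_eq)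
  have le2: "x * a\<^sup>2 \<le> 1" if "x \<le> S" "0 < x" for x
  proof -
    have "x * a\<^sup>2 = (x * a) * a" by (simp add: power2_eq_square)
    also have "\<dots> \<le> 1 * 1" using le[OF that(1)] a1 p(23) that by (intro mult_mono) auto
    finally show ?thesis by simp
  qed
  show "16 * ell * a \<le> 1" by (rule le[OF S(2)])
  show "beta3 * T0 * a\<^sup>2 \<le> 1" "2 * E1 * a\<^sup>2 \<le> 1" by (intro le2 S nn)+
  have "4 * beta2 * T0 / P0 * a\<^sup>2 \<le> 1" by (intro le2 S nn)
  then show "beta2 * T0 * a\<^sup>2 \<le> P0 / 4" using p(3) by (simp add: field_simps)
qed

lemma r_pos: "0 < r" using r1 by simp

text \<open>The last inequality is the contraction factor of the lower level: \<open>sqrt 20\<close> stems from the constant \<open>20\<close> in the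
bound on the initial iterate.\<close>

lemma theta_facts: "2 * delta0 \<le> theta0\<^sup>2" "9 * delta0 \<le> 1 / 16" "theta0 \<le> 1" "(1 + theta0) / sqrt 20 + theta0 * sqrt r \<le> 1 / 4"
proof -
  have "theta0\<^sup>2 = 1 / (10000 * r)" using r1 by (simp add: theta0_def power_divide power_mult_distrib)
  then show "2 * delta0 \<le> theta0\<^sup>2" using r_pos by (simp add: delta0_def)
  show "9 * delta0 \<le> 1 / 16" using r1 by (simp add: delta0_def field_simps)
  have s1: "1 \<le> sqrt r" using r1 by simp
  then have theta0: "theta0 \<le> 1 / 100" by (simp add: theta0_def field_simps)
  then show "theta0 \<le> 1" by simp
  have "theta0 * sqrt r = 1 / 100" using s1 by (simp add: theta0_def)
  moreover have "(4.4 :: real) \<le> sqrt 20" by (rule real_le_rsqrt) (simp add: power2_eq_square)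
  then have "(1 + theta0) / sqrt 20 \<le> 1.01 / 4.4" using theta0 by (intro frac_le) (auto simp: theta0_def)
  moreover have "x + y \<le> 1 / 4" if "x \<le> 1.01 / 4.4" "y = 1 / 100" for x y :: real using that by simp
  ultimately show "(1 + theta0) / sqrt 20 + theta0 * sqrt r \<le> 1 / 4" by blast
qed

lemma smoothness_scaling:
  assumes \<kappa>: "1 \<le> \<kappa>" and mu: "\<mu> = L / \<kappa>"
  shows "Lg1 / \<mu> \<le> \<kappa>" "L1_const Lf0 Lf1 Lg2 \<mu> \<le> ell * \<kappa>"
proof -
  have k0: "0 < \<kappa>" using \<kappa> by simp
  have "Lg1 / L \<le> 1" using const_pos(1) by (simp add: L_def)
  then show "Lg1 / \<mu> \<le> \<kappa>" using mult_right_mono[of "Lg1 / L" 1 \<kappa>] k0 by (simp add: mu)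
  have "L1_const Lf0 Lf1 Lg2 \<mu> = Lf1 + Lg2 * Lf0 / L * \<kappa>" by (simp add: L1_const_def mu)
  also have "\<dots> \<le> Lf1 * \<kappa> + Lg2 * Lf0 / L * \<kappa>" using \<kappa> cpos by simp
  finally show "L1_const Lf0 Lf1 Lg2 \<mu> \<le> ell * \<kappa>" by (simp add: ell_def distrib_right)
qed

text \<open>The hypotheses are the recursions for the mean square errors, with the variances that the batch sizes of the theorem
provide. With \<open>m = \<kappa> / (K + \<kappa>)\<close>, which is at most \<open>1\<close> and at most \<open>\<kappa> / K\<close>, one expression serves both the
invariants, for which the variances must be bounded, and the summation over \<open>K\<close> iterations, for which they must
be of order \<open>1 / K\<close>.\<close>

lemma sum_gradient_bound:
  fixes \<phi> \<psi> d e n g :: "nat \<Rightarrow> real" and \<mu> \<kappa> m \<alpha> V v1 v3 v4 ll :: real and K :: nat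
  assumes \<kappa>: "1 \<le> \<kappa>" and mu: "\<mu> = L / \<kappa>" and m: "m = \<kappa> / (real K + \<kappa>)" and \<alpha>: "\<alpha> = a / \<kappa>^3"
    and V: "V = \<sigma>g1\<^sup>2 * m / (L\<^sup>2 * c2 * \<kappa>\<^sup>2)" and v1: "v1 = \<sigma>g2\<^sup>2 * m / (c1 * \<kappa>\<^sup>2)"
    and v3: "v3 = 2 * \<sigma>f1\<^sup>2 * m" and v4: "v4 = 2 * \<sigma>g2\<^sup>2 * m" and l: "ll = L1_const Lf0 Lf1 Lg2 \<mu>"
    and nonneg: "\<And>k. 0 \<le> \<phi> k" "\<And>k. 0 \<le> \<psi> k" "\<And>k. 0 \<le> d k" "\<And>k. 0 \<le> e k" "\<And>k. 0 \<le> g k"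
    and h\<phi>: "\<And>k. k < K \<Longrightarrow> \<phi> (Suc k) \<le> r * ((1 + theta0) * (Lg2 / \<mu> * \<phi> k) + (1 + theta0) * sqrt V + theta0 * sqrt (\<phi> k) + Lg1 / \<mu> * \<alpha> * sqrt (d k))\<^sup>2"
    and h\<psi>: "\<And>k. k < K \<Longrightarrow> \<psi> (Suc k) \<le> 2 * (4 * (ll / \<mu>)\<^sup>2 * \<phi> k + (16 * v1 / \<mu>\<^sup>2 + 1 / 16) * \<psi> k + (16 * v1 * (Lf0 / \<mu>)\<^sup>2 + 8 * v3) / \<mu>\<^sup>2)
      + 2 * (ll / \<mu> * (1 + Lg1 / \<mu>))\<^sup>2 * \<alpha>\<^sup>2 * d k"
    and he: "\<And>k. k < K \<Longrightarrow> e k \<le> 4 * ll\<^sup>2 * \<phi> k + (8 * v4 + 4 * Lg1\<^sup>2) * \<psi> k + (4 * v3 + 8 * v4 * (Lf0 / \<mu>)\<^sup>2)"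
    and hd: "\<And>k. k < K \<Longrightarrow> d k \<le> 2 * e k + 2 * (Cf0 + Lg1 * Lf0 / \<mu>)\<^sup>2"
    and hg: "\<And>k. k < K \<Longrightarrow> g (Suc k) + \<alpha> / 2 * n k + \<alpha> / 4 * d k \<le> g k + \<alpha> / 2 * e k"
    and init: "\<phi> 0 \<le> \<mu>\<^sup>2 / (20 * r * Lg2\<^sup>2)" "\<psi> 0 \<le> 4 * ll\<^sup>2 / (5 * r * Lg2\<^sup>2)" "\<psi> 0 \<le> ll / \<mu>\<^sup>2" "g 0 \<le> \<Delta>"
  shows "(\<Sum>k<K. n k) \<le> Ctot * \<kappa>^3"
proof -
  note p = const_pos
  have k0: "0 < \<kappa>" using \<kappa> by simp
  have mu_pos: "0 < \<mu>" using p(1) k0 by (simp add: mu)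
  have m01: "0 < m" "m \<le> 1" "m * real K \<le> \<kappa>"
    using k0 by (simp_all add: m divide_le_eq field_simps add_nonneg_pos)
  have Lg1: "Lg1 \<le> L" "0 < Lg1" using cpos by (simp_all add: L_def)
  have div_mu: "x / \<mu> = x / L * \<kappa>" for x using k0 p(1) by (simp add: mu)
  have Lg1_mu: "Lg1 / \<mu> \<le> \<kappa>" "0 \<le> Lg1 / \<mu>"
    using smoothness_scaling(1)[OF \<kappa> mu] Lg1 mu_pos by simp_all
  have l_pos: "0 < ll" using cpos mu_pos by (simp add: l L1_const_def add_pos_pos)
  have l_le: "ll \<le> ell * \<kappa>" unfolding l by (rule smoothness_scaling(2)[OF \<kappa> mu])
  have l_sq: "ll\<^sup>2 \<le> ell\<^sup>2 * \<kappa>\<^sup>2" using power_mono[OF l_le, of 2] l_pos by (simp add: power_mult_distrib)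
  have l_mu_sq: "(ll / \<mu>)\<^sup>2 \<le> ell\<^sup>2 / L\<^sup>2 * \<kappa>^4"
  proof -
    have "(ll / \<mu>)\<^sup>2 = ll\<^sup>2 / L\<^sup>2 * \<kappa>\<^sup>2" by (simp add: div_mu power_mult_distrib power_divide)
    also have "\<dots> \<le> (ell\<^sup>2 * \<kappa>\<^sup>2) / L\<^sup>2 * \<kappa>\<^sup>2" by (intro mult_right_mono divide_right_mono l_sq) auto
    finally show ?thesis by (simp add: power_numeral_reduce mult_ac)
  qed
  have drift_sq: "(ll / \<mu> * (1 + Lg1 / \<mu>))\<^sup>2 * \<alpha>\<^sup>2 \<le> 4 * ell\<^sup>2 / L\<^sup>2 * a\<^sup>2"
  proof -
    have "(1 + Lg1 / \<mu>)\<^sup>2 \<le> (2 * \<kappa>)\<^sup>2" using Lg1_mu \<kappa> by (intro power_mono) auto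
    then have "(ll / \<mu>)\<^sup>2 * (1 + Lg1 / \<mu>)\<^sup>2 * \<alpha>\<^sup>2 \<le> (ell\<^sup>2 / L\<^sup>2 * \<kappa>^4) * (2 * \<kappa>)\<^sup>2 * \<alpha>\<^sup>2"
      using l_mu_sq by (intro mult_right_mono mult_mono) auto
    also have "\<dots> = 4 * ell\<^sup>2 / L\<^sup>2 * a\<^sup>2"
      using k0 by (simp add: \<alpha> power_divide power_mult_distrib field_simps flip: power_mult power_add)
    finally show ?thesis by (simp only: power_mult_distrib)
  qed
  have a_pos: "0 < \<alpha>" using p(23) k0 by (simp add: \<alpha>)
  define \<phi>' s t w where "\<phi>' k = \<kappa>\<^sup>2 * \<phi> k" and "s k = \<psi> k / \<kappa>\<^sup>2" and "t k = d k / \<kappa>\<^sup>2" and "w k = e k / \<kappa>\<^sup>2" for k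
  have ksq: "1 \<le> \<kappa>\<^sup>2" using \<kappa> by simp
  have sum_w: "(\<Sum>k<K. w k) \<le> E0 * \<kappa> + E1 * a\<^sup>2 * (\<Sum>k<K. t k)"
    unfolding E0_def E1_def
  proof (rule scaled_recursion[where \<phi> = \<phi>' and s = s and m = m and ?P0.0 = P0 and ?S0.0 = S0 and ?T0.0 = T0 and ?C5.0 = C5])
    show "0 \<le> \<phi>' k" "0 \<le> s k" "0 \<le> t k" "0 \<le> w k" for k
      using nonneg by (simp_all add: \<phi>'_def s_def t_def w_def)
    show "0 \<le> m" "m \<le> 1" "m * real K \<le> \<kappa>" "1 \<le> \<kappa>" using m01 \<kappa> by auto
    show "0 \<le> P0" "0 \<le> beta2" "0 \<le> beta3" "0 \<le> beta4" "0 \<le> C1" "0 \<le> C2" "0 \<le> C3" "0 \<le> a\<^sup>2" "0 \<le> S0"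
      using p by simp_all
    show "T0 = 2 * (C1 * P0 + C2 * S0 + C3) + C5" by (rule T0_def)
    show "beta2 * a\<^sup>2 * T0 \<le> P0 / 4" "beta3 * a\<^sup>2 * T0 \<le> 1" using a_le(3,4) by (simp_all add: mult_ac)
    show "beta3 * P0 + beta4 + 1 \<le> S0 / 2" using p(17) by (simp add: S0_def)
    show "\<phi>' 0 \<le> P0"
    proof -
      have "\<phi>' 0 \<le> \<kappa>\<^sup>2 * (\<mu>\<^sup>2 / (20 * r * Lg2\<^sup>2))" unfolding \<phi>'_def by (intro mult_left_mono init) auto
      also have "\<dots> = P0" using k0 by (simp add: P0_def mu power_divide)
      finally show ?thesis .
    qed
    show "s 0 \<le> S0"
    proof -
      have "s 0 \<le> (4 * ll\<^sup>2 / (5 * r * Lg2\<^sup>2)) / \<kappa>\<^sup>2" unfolding s_def by (intro divide_right_mono init) auto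
      also have "\<dots> \<le> (4 * (ell\<^sup>2 * \<kappa>\<^sup>2) / (5 * r * Lg2\<^sup>2)) / \<kappa>\<^sup>2"
        using l_sq r_pos by (intro divide_right_mono mult_left_mono) auto
      also have "\<dots> = Q0" using k0 by (simp add: Q0_def)
      also have "\<dots> \<le> S0" using p(3,11,12) by (simp add: S0_def)
      finally show ?thesis .
    qed
    show "s 0 \<le> Q1 * \<kappa>"
    proof -
      have "s 0 \<le> (ll / \<mu>\<^sup>2) / \<kappa>\<^sup>2" unfolding s_def by (intro divide_right_mono init) auto
      also have "\<dots> \<le> (ell * \<kappa> / \<mu>\<^sup>2) / \<kappa>\<^sup>2" by (intro divide_right_mono l_le) auto
      also have "\<dots> = Q1 * \<kappa>" using k0 p(1) by (simp add: Q1_def mu power_divide)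
      finally show ?thesis .
    qed
    fix k assume k: "k < K"
    show "t k \<le> 2 * w k + C5"
    proof -
      have "Lg1 * Lf0 / \<mu> \<le> \<kappa> * Lf0" using mult_right_mono[OF Lg1_mu(1), of Lf0] cpos by (simp add: mult_ac)
      moreover have "Cf0 \<le> Cf0 * \<kappa>" using \<kappa> cpos by simp
      ultimately have "Cf0 + Lg1 * Lf0 / \<mu> \<le> (Cf0 + Lf0) * \<kappa>" by (simp add: algebra_simps)
      then have "(Cf0 + Lg1 * Lf0 / \<mu>)\<^sup>2 \<le> ((Cf0 + Lf0) * \<kappa>)\<^sup>2" using cpos mu_pos by (intro power_mono) auto
      then have "d k \<le> 2 * e k + C5 * \<kappa>\<^sup>2" using hd[OF k] by (simp add: C5_def power_mult_distrib)
      then have "t k \<le> (2 * e k + C5 * \<kappa>\<^sup>2) / \<kappa>\<^sup>2" unfolding t_def by (intro divide_right_mono) auto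
      then show ?thesis using k0 by (simp add: w_def add_divide_distrib)
    qed
    show "w k \<le> C1 * \<phi>' k + C2 * s k + C3 * m"
    proof -
      have "4 * ll\<^sup>2 * \<phi> k \<le> 4 * (ell\<^sup>2 * \<kappa>\<^sup>2) * \<phi> k" using l_sq nonneg by (intro mult_right_mono) auto
      moreover have "(8 * v4 + 4 * Lg1\<^sup>2) * \<psi> k \<le> C2 * \<psi> k"
      proof (intro mult_right_mono nonneg)
        have "Lg1\<^sup>2 \<le> L\<^sup>2" using Lg1 by (intro power_mono) auto
        moreover have "\<sigma>g2\<^sup>2 * m \<le> \<sigma>g2\<^sup>2" using m01 by (intro mult_left_le) auto
        ultimately show "8 * v4 + 4 * Lg1\<^sup>2 \<le> C2" by (simp add: v4 C2_def)
      qed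
      moreover have "4 * v3 + 8 * v4 * (Lf0 / \<mu>)\<^sup>2 \<le> C3 * m * \<kappa>\<^sup>2"
      proof -
        have "4 * v3 \<le> 8 * \<sigma>f1\<^sup>2 * m * \<kappa>\<^sup>2" using ksq m01 cpos by (simp add: v3)
        moreover have "8 * v4 * (Lf0 / \<mu>)\<^sup>2 = 16 * \<sigma>g2\<^sup>2 * Lf0\<^sup>2 / L\<^sup>2 * m * \<kappa>\<^sup>2"
          by (simp add: v4 div_mu power_mult_distrib power_divide)
        ultimately show ?thesis by (simp add: C3_def algebra_simps)
      qed
      ultimately have "e k \<le> 4 * (ell\<^sup>2 * \<kappa>\<^sup>2) * \<phi> k + C2 * \<psi> k + C3 * m * \<kappa>\<^sup>2" using he[OF k] by linarith
      then have "w k \<le> (4 * (ell\<^sup>2 * \<kappa>\<^sup>2) * \<phi> k + C2 * \<psi> k + C3 * m * \<kappa>\<^sup>2) / \<kappa>\<^sup>2"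
        unfolding w_def by (intro divide_right_mono) auto
      also have "\<dots> = 4 * ell\<^sup>2 * \<phi> k + C2 * s k + C3 * m" using k0 by (simp add: s_def add_divide_distrib)
      finally have "w k \<le> 4 * ell\<^sup>2 * \<phi> k + C2 * s k + C3 * m" .
      moreover have "4 * ell\<^sup>2 * \<phi> k \<le> C1 * \<phi>' k"
        using mult_right_mono[OF ksq nonneg(1)[of k]] by (simp add: C1_def \<phi>'_def mult_left_mono)
      ultimately show ?thesis by simp
    qed
    show "s (Suc k) \<le> s k / 4 + beta3 * \<phi>' k + beta4 * m + beta3 * a\<^sup>2 * t k"
    proof -
      have "8 * (ll / \<mu>)\<^sup>2 * \<phi> k \<le> 8 * (ell\<^sup>2 / L\<^sup>2 * \<kappa>^4) * \<phi> k"
        using l_mu_sq nonneg by (intro mult_right_mono) auto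
      moreover have "8 * (ell\<^sup>2 / L\<^sup>2 * \<kappa>^4) * \<phi> k = beta3 * \<phi>' k * \<kappa>\<^sup>2"
        by (simp add: beta3_def \<phi>'_def power_numeral_reduce mult_ac)
      moreover have v1_mu: "16 * v1 / \<mu>\<^sup>2 = m / 16"
        using k0 p(1) cpos by (simp add: v1 mu c1_def power_divide)
      have "2 * (16 * v1 / \<mu>\<^sup>2 + 1 / 16) \<le> 1 / 4" unfolding v1_mu using m01 by simp
      then have "2 * (16 * v1 / \<mu>\<^sup>2 + 1 / 16) * \<psi> k \<le> 1 / 4 * \<psi> k" by (intro mult_right_mono nonneg)
      moreover have "2 * ((16 * v1 * (Lf0 / \<mu>)\<^sup>2 + 8 * v3) / \<mu>\<^sup>2) = beta4 * m * \<kappa>\<^sup>2"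
        using k0 p(1,8) by (simp add: beta4_def v1 v3 mu power_divide power_mult_distrib field_simps power_numeral_reduce)
      moreover have "2 * ((ll / \<mu> * (1 + Lg1 / \<mu>))\<^sup>2 * \<alpha>\<^sup>2) * d k \<le> 2 * (4 * ell\<^sup>2 / L\<^sup>2 * a\<^sup>2) * d k"
        using drift_sq nonneg by (intro mult_right_mono) auto
      moreover have "2 * (4 * ell\<^sup>2 / L\<^sup>2 * a\<^sup>2) * d k = beta3 * a\<^sup>2 * t k * \<kappa>\<^sup>2"
        using k0 by (simp add: beta3_def t_def)
      moreover have "\<psi> k = s k * \<kappa>\<^sup>2" using k0 by (simp add: s_def)
      moreover have "\<psi> (Suc k) \<le> 8 * (ll / \<mu>)\<^sup>2 * \<phi> k + 2 * (16 * v1 / \<mu>\<^sup>2 + 1 / 16) * \<psi> k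
          + 2 * ((16 * v1 * (Lf0 / \<mu>)\<^sup>2 + 8 * v3) / \<mu>\<^sup>2) + 2 * ((ll / \<mu> * (1 + Lg1 / \<mu>))\<^sup>2 * \<alpha>\<^sup>2) * d k"
        using h\<psi>[OF k] by (simp only: distrib_left mult.assoc[symmetric])
      ultimately have "\<psi> (Suc k) \<le> beta3 * \<phi>' k * \<kappa>\<^sup>2 + 1 / 4 * (s k * \<kappa>\<^sup>2) + beta4 * m * \<kappa>\<^sup>2 + beta3 * a\<^sup>2 * t k * \<kappa>\<^sup>2"
        by linarith
      also have "\<dots> = (s k / 4 + beta3 * \<phi>' k + beta4 * m + beta3 * a\<^sup>2 * t k) * \<kappa>\<^sup>2" by (simp add: algebra_simps)
      finally show ?thesis using k0 by (simp add: s_def[of "Suc k"] divide_le_eq)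
    qed
    assume inv: "\<phi>' k \<le> P0"
    show "\<phi>' (Suc k) \<le> \<phi>' k / 8 + P0 / 4 * m + beta2 * a\<^sup>2 * t k"
    proof -
      define x where "x = sqrt (\<phi> k)"
      have x: "0 \<le> x" "\<phi> k = x\<^sup>2" using nonneg by (simp_all add: x_def)
      \<comment> \<open>The invariant bounds \<open>\<kappa> x\<close> by \<open>q\<close>, which makes the quadratic Newton error linear in \<open>x\<close>.\<close>
      define q where "q = L / (sqrt 20 * sqrt r * Lg2)"
      have sr: "0 < sqrt r" using r_pos by simp
      have q: "0 < q" "q\<^sup>2 = P0" using p(1) sr cpos r_pos by (simp_all add: q_def P0_def power_divide power_mult_distrib)
      have "(\<kappa> * x)\<^sup>2 \<le> q\<^sup>2" using inv q by (simp add: \<phi>'_def x power_mult_distrib)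
      then have kx: "\<kappa> * x \<le> q" by (rule power2_le_imp_le) (simp add: q less_imp_le)
      have "Lg2 / \<mu> * \<phi> k = Lg2 / L * (\<kappa> * x) * x" by (simp add: div_mu x power2_eq_square)
      also have "\<dots> \<le> Lg2 / L * q * x" using kx x cpos p(1) by (intro mult_right_mono mult_left_mono) auto
      also have "\<dots> = x / (sqrt 20 * sqrt r)" using p(1) cpos by (simp add: q_def)
      finally have "(1 + theta0) * (Lg2 / \<mu> * \<phi> k) + theta0 * x \<le> (1 + theta0) * (x / (sqrt 20 * sqrt r)) + theta0 * x"
        using p(4) by (intro add_right_mono mult_left_mono) auto
      also have "\<dots> = ((1 + theta0) / sqrt 20 + theta0 * sqrt r) * (x / sqrt r)"
      proof -
        have "(1 + theta0) * (x / (p * q)) + theta0 * x = ((1 + theta0) / p + theta0 * q) * (x / q)" if "p \<noteq> 0" "q \<noteq> 0" for p q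
          using that by (simp add: field_simps)
        from this[of "sqrt 20" "sqrt r"] sr show ?thesis by simp
      qed
      also have "\<dots> \<le> 1 / 4 * (x / sqrt r)" using theta_facts(4) x sr by (intro mult_right_mono) auto
      finally have lin: "(1 + theta0) * (Lg2 / \<mu> * \<phi> k) + theta0 * x \<le> 1 / 4 * (x / sqrt r)" .
      have V0: "0 \<le> V" using m01 p(9) by (simp add: V)
      define N where "N = 2 * sqrt V + \<kappa> * \<alpha> * sqrt (d k)"
      have N: "0 \<le> N" using V0 k0 a_pos nonneg by (simp add: N_def)
      have "(1 + theta0) * sqrt V + Lg1 / \<mu> * \<alpha> * sqrt (d k) \<le> N"
        unfolding N_def using theta_facts(3) V0 Lg1_mu a_pos nonneg by (intro add_mono mult_right_mono) auto
      with lin have le: "(1 + theta0) * (Lg2 / \<mu> * \<phi> k) + (1 + theta0) * sqrt V + theta0 * sqrt (\<phi> k) + Lg1 / \<mu> * \<alpha> * sqrt (d k)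
          \<le> 1 / 4 * (x / sqrt r) + N" by (simp add: x_def)
      have lhs0: "0 \<le> (1 + theta0) * (Lg2 / \<mu> * \<phi> k) + (1 + theta0) * sqrt V + theta0 * sqrt (\<phi> k) + Lg1 / \<mu> * \<alpha> * sqrt (d k)"
        using p(4) V0 Lg1_mu a_pos nonneg cpos mu_pos by simp
      have "\<phi> (Suc k) \<le> r * (1 / 4 * (x / sqrt r) + N)\<^sup>2"
        using h\<phi>[OF k] mult_left_mono[OF power_mono[OF le lhs0, of 2], of r] r_pos by linarith
      also have "\<dots> \<le> r * (2 * (1 / 4 * (x / sqrt r))\<^sup>2 + 2 * N\<^sup>2)"
        using sum_squares_bound[of "1 / 4 * (x / sqrt r)" N] r_pos by (intro mult_left_mono) (auto simp: power2_sum)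
      also have "\<dots> = \<phi> k / 8 + 2 * r * N\<^sup>2"
        using r_pos by (simp add: x power_divide power_mult_distrib field_simps)
      finally have step: "\<phi> (Suc k) \<le> \<phi> k / 8 + 2 * r * N\<^sup>2" .
      have "N\<^sup>2 \<le> 8 * V + 2 * (\<kappa>\<^sup>2 * \<alpha>\<^sup>2 * d k)"
        using sum_squares_bound[of "2 * sqrt V" "\<kappa> * \<alpha> * sqrt (d k)"] V0 nonneg
        by (simp add: N_def power2_sum power_mult_distrib mult_ac)
      then have "2 * r * N\<^sup>2 \<le> 2 * r * (8 * V + 2 * (\<kappa>\<^sup>2 * \<alpha>\<^sup>2 * d k))"
        using r_pos by (intro mult_left_mono) auto
      with step have "\<phi> (Suc k) \<le> \<phi> k / 8 + 2 * r * (8 * V + 2 * (\<kappa>\<^sup>2 * \<alpha>\<^sup>2 * d k))"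
        by linarith
      then have "\<phi>' (Suc k) \<le> \<kappa>\<^sup>2 * (\<phi> k / 8 + 2 * r * (8 * V + 2 * (\<kappa>\<^sup>2 * \<alpha>\<^sup>2 * d k)))"
        unfolding \<phi>'_def by (intro mult_left_mono) auto
      also have "\<dots> = \<phi>' k / 8 + 16 * r * (\<kappa>\<^sup>2 * V) + 4 * r * (\<kappa>^4 * \<alpha>\<^sup>2 * d k)"
        by (simp add: \<phi>'_def algebra_simps power_numeral_reduce)
      also have "16 * r * (\<kappa>\<^sup>2 * V) = P0 / 4 * m"
        using k0 p(1,3) r_pos cpos by (simp add: V c2_def)
      also have "\<kappa>^4 * \<alpha>\<^sup>2 * d k = a\<^sup>2 * t k"
        using k0 by (simp add: \<alpha> t_def power_divide field_simps flip: power_mult power_add)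
      finally show ?thesis by (simp add: beta2_def)
    qed
  qed
  have "(\<Sum>k<K. g (Suc k) + \<alpha> / 2 * n k + \<alpha> / 4 * d k) \<le> (\<Sum>k<K. g k + \<alpha> / 2 * e k)"
    by (intro sum_mono hg) auto
  then have "(\<Sum>k<K. g (Suc k)) + \<alpha> / 2 * (\<Sum>k<K. n k) + \<alpha> / 4 * (\<Sum>k<K. d k) \<le> (\<Sum>k<K. g k) + \<alpha> / 2 * (\<Sum>k<K. e k)"
    by (simp add: sum.distrib sum_distrib_left)
  moreover have "(\<Sum>k<K. g k) - (\<Sum>k<K. g (Suc k)) = g 0 - g K"
    using sum_lessThan_telescope'[of g K] by (simp add: sum_subtractf)
  ultimately have main: "\<alpha> / 2 * (\<Sum>k<K. n k) + \<alpha> / 4 * (\<Sum>k<K. d k) \<le> \<Delta> + \<alpha> / 2 * (\<Sum>k<K. e k)"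
    using nonneg(5)[of K] init(4) by linarith
  have sums: "(\<Sum>k<K. e k) = \<kappa>\<^sup>2 * (\<Sum>k<K. w k)" "(\<Sum>k<K. d k) = \<kappa>\<^sup>2 * (\<Sum>k<K. t k)"
    using k0 by (simp_all add: w_def t_def sum_distrib_left)
  have T: "0 \<le> (\<Sum>k<K. t k)" using nonneg by (intro sum_nonneg) (simp add: t_def)
  have "(\<Sum>k<K. w k) \<le> E0 * \<kappa> + 1 / 2 * (\<Sum>k<K. t k)"
    using sum_w mult_right_mono[of "E1 * a\<^sup>2" "1 / 2", OF _ T] a_le(5) by linarith
  then have "\<alpha> / 2 * (\<kappa>\<^sup>2 * (\<Sum>k<K. w k)) \<le> \<alpha> / 2 * (\<kappa>\<^sup>2 * (E0 * \<kappa> + 1 / 2 * (\<Sum>k<K. t k)))"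
    using a_pos by (intro mult_left_mono) auto
  also have "\<dots> = \<alpha> / 2 * (E0 * \<kappa>^3) + \<alpha> / 4 * (\<kappa>\<^sup>2 * (\<Sum>k<K. t k))"
    by (simp add: algebra_simps power_numeral_reduce)
  finally have "\<alpha> / 2 * (\<Sum>k<K. n k) \<le> \<Delta> + \<alpha> / 2 * (E0 * \<kappa>^3)" using main unfolding sums by linarith
  then have "(\<Sum>k<K. n k) \<le> 2 * \<Delta> / \<alpha> + E0 * \<kappa>^3" using a_pos by (simp add: field_simps)
  also have "2 * \<Delta> / \<alpha> = 2 * \<Delta> / a * \<kappa>^3" using k0 p(23) by (simp add: \<alpha>)
  finally have step: "(\<Sum>k<K. n k) \<le> 2 * \<Delta> / a * \<kappa>^3 + E0 * \<kappa>^3" .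
  have "2 * \<Delta> / a * \<kappa>^3 \<le> 2 * \<bar>\<Delta>\<bar> / a * \<kappa>^3" using p(23) k0 by (intro mult_right_mono divide_right_mono) auto
  moreover have "2 * \<bar>\<Delta>\<bar> / a * \<kappa>^3 + E0 * \<kappa>^3 \<le> Ctot * \<kappa>^3" using k0 by (simp add: Ctot_def distrib_right)
  ultimately show ?thesis using step by linarith
qed

end

section \<open>Counting samples\<close>

context rate_constants
begin

text \<open>For the accuracy \<open>\<epsilon>\<close>, at most \<open>k1 \<kappa>\<^sup>3 / \<epsilon>\<close> iterations are made; \<open>Cfin\<close> dominates the constants of all
complexity bounds.\<close>

definition "k1 = Ctot + 1"
definition "Cfin = Ctot + k1 * (k1 + 1) + k1 * (c2 * (k1 + 1) + 1) + k1 * (c1 * (k1 + 1) + 1 + 2 * (cT + 2) * (c0 + 1))"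

lemma Cfin_ge: "Ctot \<le> Cfin" "k1 \<le> Cfin" "k1 * (k1 + 1) \<le> Cfin" "k1 * (c2 * (k1 + 1) + 1) \<le> Cfin"
  "k1 * (c1 * (k1 + 1) + 1 + 2 * (cT + 2) * (c0 + 1)) \<le> Cfin" "0 < Cfin" "1 \<le> k1"
proof -
  note p = const_pos
  have k1: "1 \<le> k1" using p by (simp add: k1_def)
  have nn: "0 \<le> k1 * (k1 + 1)" "0 \<le> k1 * (c2 * (k1 + 1) + 1)" "0 \<le> k1 * (c1 * (k1 + 1) + 1 + 2 * (cT + 2) * (c0 + 1))"
    using k1 p by simp_all
  have "k1 * 1 \<le> k1 * (k1 + 1)" using k1 by (intro mult_left_mono) auto
  then show "Ctot \<le> Cfin" "k1 \<le> Cfin" "k1 * (k1 + 1) \<le> Cfin" "k1 * (c2 * (k1 + 1) + 1) \<le> Cfin"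
    "k1 * (c1 * (k1 + 1) + 1 + 2 * (cT + 2) * (c0 + 1)) \<le> Cfin" "0 < Cfin" "1 \<le> k1"
    using nn p(24) k1 unfolding Cfin_def by linarith+
qed

context
  fixes \<kappa> \<epsilon> :: real
  assumes \<kappa>: "1 \<le> \<kappa>" and \<epsilon>: "0 < \<epsilon>" "\<epsilon> \<le> 1"
begin

abbreviation "y \<equiv> \<kappa>^3 / \<epsilon>"

text \<open>Lower-order terms and roundings are absorbed into the leading terms, since \<open>\<kappa> \<ge> 1\<close> and \<open>\<epsilon> \<le> 1\<close>.\<close>

lemma y_ge: "\<kappa>^j \<le> \<kappa>^i * y" if "j \<le> i + 3"
proof -
  have "\<kappa>^j \<le> \<kappa>^(i + 3)" using \<kappa> that by (intro power_increasing) auto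
  also have "\<dots> \<le> \<kappa>^(i + 3) / \<epsilon>" using \<epsilon> \<kappa> by (simp add: le_divide_eq mult_left_le)
  finally show ?thesis by (simp add: power_add)
qed

lemma iterations:
  obtains K :: nat where "1 \<le> K" "Ctot * \<kappa>^3 / real K \<le> \<epsilon>" "real K \<le> k1 * y"
proof
  have y1: "1 \<le> y" using y_ge[of 0 0] by simp
  let ?K = "nat \<lceil>Ctot * y\<rceil>"
  have pos: "0 < Ctot * y" using const_pos(24) y1 by (intro mult_pos_pos) linarith+
  show "1 \<le> ?K" using pos by linarith
  have ge: "Ctot * y \<le> real ?K" by linarith
  then show "Ctot * \<kappa>^3 / real ?K \<le> \<epsilon>" using pos \<epsilon> by (simp add: field_simps)
  have "real ?K \<le> Ctot * y + 1" using pos by linarith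
  then show "real ?K \<le> k1 * y" using y1 unfolding k1_def distrib_right by linarith
qed

definition sizes :: "nat \<Rightarrow> batch \<Rightarrow> nat" where
  "sizes K B = nat \<lceil>case B of B1_inner s k \<Rightarrow> c0 * \<kappa>\<^sup>2 | B1 k \<Rightarrow> c1 * (\<kappa> * real K + \<kappa>\<^sup>2)
     | B2 k \<Rightarrow> c2 * (\<kappa>^3 * real K + \<kappa>^4) | B3 k \<Rightarrow> real K / \<kappa> | B4 k \<Rightarrow> real K / \<kappa>\<rceil>"

lemma sizes_ok: "batch_sizes_ge c0 c1 c2 1 1 \<kappa> K T (sizes K)"
  unfolding batch_sizes_ge_def sizes_def by (auto intro: real_nat_ceiling_ge)

context
  fixes K :: nat
  assumes K: "real K \<le> k1 * y"
begin

lemma sizes_le: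
  "real (sizes K (B1_inner s k)) \<le> (c0 + 1) * \<kappa>\<^sup>2"
  "real (sizes K (B1 k)) \<le> (c1 * (k1 + 1) + 1) * (\<kappa> * y)"
  "real (sizes K (B2 k)) \<le> (c2 * (k1 + 1) + 1) * (\<kappa>^3 * y)"
  "real (sizes K (B3 k)) \<le> (k1 + 1) * (y / \<kappa>)"
  "real (sizes K (B4 k)) \<le> (k1 + 1) * (y / \<kappa>)"
proof -
  note p = const_pos
  have up: "real (nat \<lceil>x\<rceil>) \<le> x + 1" if "0 \<le> x" for x using that by linarith
  have k0: "0 < \<kappa>" using \<kappa> by simp
  have "0 \<le> c0 * \<kappa>\<^sup>2" "1 \<le> \<kappa>\<^sup>2" using \<kappa> p(6) by simp_all
  then have "real (nat \<lceil>c0 * \<kappa>\<^sup>2\<rceil>) \<le> (c0 + 1) * \<kappa>\<^sup>2"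
    using up[of "c0 * \<kappa>\<^sup>2"] unfolding distrib_right by linarith
  then show "real (sizes K (B1_inner s k)) \<le> (c0 + 1) * \<kappa>\<^sup>2" by (simp only: sizes_def batch.case)
  have "c1 * (\<kappa> * real K + \<kappa>\<^sup>2) \<le> c1 * (\<kappa> * (k1 * y) + \<kappa> * y)"
    using K k0 p(8) y_ge[of 2 1] by (intro mult_left_mono add_mono) auto
  moreover have "1 \<le> \<kappa> * y" using y_ge[of 0 1] by simp
  ultimately show "real (sizes K (B1 k)) \<le> (c1 * (k1 + 1) + 1) * (\<kappa> * y)"
    using up[of "c1 * (\<kappa> * real K + \<kappa>\<^sup>2)"] p(8) k0 by (simp add: sizes_def algebra_simps)
  have "c2 * (\<kappa>^3 * real K + \<kappa>^4) \<le> c2 * (\<kappa>^3 * (k1 * y) + \<kappa>^3 * y)"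
    using K k0 p(9) y_ge[of 4 3] by (intro mult_left_mono add_mono) auto
  moreover have "1 \<le> \<kappa>^3 * y" using y_ge[of 0 3] by simp
  ultimately show "real (sizes K (B2 k)) \<le> (c2 * (k1 + 1) + 1) * (\<kappa>^3 * y)"
    using up[of "c2 * (\<kappa>^3 * real K + \<kappa>^4)"] p(9) k0 by (simp add: sizes_def algebra_simps)
  have "\<kappa> \<le> y" using y_ge[of 1 0] by (simp only: power_one_right power_0 mult_1)
  then have "\<kappa> / \<kappa> \<le> y / \<kappa>" using k0 by (intro divide_right_mono) auto
  then have "1 \<le> y / \<kappa>" using k0 by simp
  moreover have "real K / \<kappa> \<le> k1 * (y / \<kappa>)" using divide_right_mono[OF K, of \<kappa>] k0 by simp
  moreover have "0 \<le> real K / \<kappa>" using k0 by simp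
  ultimately have "real (nat \<lceil>real K / \<kappa>\<rceil>) \<le> (k1 + 1) * (y / \<kappa>)"
    using up[of "real K / \<kappa>"] unfolding distrib_right by linarith
  then show "real (sizes K (B3 k)) \<le> (k1 + 1) * (y / \<kappa>)" "real (sizes K (B4 k)) \<le> (k1 + 1) * (y / \<kappa>)"
    by (simp_all add: sizes_def)
qed

lemma complexities:
  assumes T: "real T \<le> (cT + 1) * \<kappa>"
  shows "real (grad_complexity_F K (sizes K)) \<le> Cfin * (\<kappa>^5 / \<epsilon>\<^sup>2)"
    "real (grad_complexity_G K (sizes K)) \<le> Cfin * (\<kappa>^9 / \<epsilon>\<^sup>2)"
    "real (jacobian_vector_complexity K (sizes K)) \<le> Cfin * (\<kappa>^5 / \<epsilon>\<^sup>2)"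
    "real (hessian_vector_complexity K T (sizes K)) \<le> Cfin * (\<kappa>^7 / \<epsilon>\<^sup>2)"
proof -
  note p = const_pos
  have k0: "0 < \<kappa>" using \<kappa> by simp
  have y0: "0 \<le> y" using k0 \<epsilon> by simp
  have total: "real (\<Sum>k<K. f k) \<le> k1 * y * B" if "\<And>k. real (f k) \<le> B" "0 \<le> B" for f :: "nat \<Rightarrow> nat" and B
  proof -
    have "real (\<Sum>k<K. f k) \<le> (\<Sum>k<K. B)" unfolding of_nat_sum by (intro sum_mono that)
    also have "\<dots> = real K * B" by simp
    also have "\<dots> \<le> k1 * y * B" by (intro mult_right_mono K that)
    finally show ?thesis .
  qed
  have e5: "y * (y / \<kappa>) = \<kappa>^5 / \<epsilon>\<^sup>2" and e9: "y * (\<kappa>^3 * y) = \<kappa>^9 / \<epsilon>\<^sup>2" and e7: "y * (\<kappa> * y) = \<kappa>^7 / \<epsilon>\<^sup>2"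
    using k0 \<epsilon> by (simp_all add: field_simps power_numeral_reduce)
  have pos: "0 \<le> \<kappa>^5 / \<epsilon>\<^sup>2" "0 \<le> \<kappa>^9 / \<epsilon>\<^sup>2" "0 \<le> \<kappa>^7 / \<epsilon>\<^sup>2" using k0 by simp_all
  have k1: "0 \<le> k1" using Cfin_ge(7) by simp
  have "k1 * y * ((k1 + 1) * (y / \<kappa>)) = (k1 * (k1 + 1)) * (\<kappa>^5 / \<epsilon>\<^sup>2)" unfolding e5[symmetric] by (simp only: mult_ac)
  also have "\<dots> \<le> Cfin * (\<kappa>^5 / \<epsilon>\<^sup>2)" by (intro mult_right_mono Cfin_ge pos)
  finally have F: "k1 * y * ((k1 + 1) * (y / \<kappa>)) \<le> Cfin * (\<kappa>^5 / \<epsilon>\<^sup>2)" .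
  have B: "0 \<le> (k1 + 1) * (y / \<kappa>)" "0 \<le> (c2 * (k1 + 1) + 1) * (\<kappa>^3 * y)"
    using k1 k0 y0 p(9) \<epsilon> by (auto intro!: mult_nonneg_nonneg divide_nonneg_nonneg add_nonneg_nonneg)
  show "real (grad_complexity_F K (sizes K)) \<le> Cfin * (\<kappa>^5 / \<epsilon>\<^sup>2)"
    unfolding grad_complexity_F_def by (rule order_trans[OF total[OF sizes_le(4) B(1)] F])
  show "real (jacobian_vector_complexity K (sizes K)) \<le> Cfin * (\<kappa>^5 / \<epsilon>\<^sup>2)"
    unfolding jacobian_vector_complexity_def by (rule order_trans[OF total[OF sizes_le(5) B(1)] F])
  have "k1 * y * ((c2 * (k1 + 1) + 1) * (\<kappa>^3 * y)) = (k1 * (c2 * (k1 + 1) + 1)) * (\<kappa>^9 / \<epsilon>\<^sup>2)"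
    unfolding e9[symmetric] by (simp only: mult_ac)
  also have "\<dots> \<le> Cfin * (\<kappa>^9 / \<epsilon>\<^sup>2)" by (intro mult_right_mono Cfin_ge pos)
  finally show "real (grad_complexity_G K (sizes K)) \<le> Cfin * (\<kappa>^9 / \<epsilon>\<^sup>2)"
    unfolding grad_complexity_G_def by (rule order_trans[OF total[OF sizes_le(3) B(2)]])
  let ?h = "(c1 * (k1 + 1) + 1 + 2 * (cT + 2) * (c0 + 1)) * (\<kappa> * y)"
  have per: "real (sizes K (B1 k) + (\<Sum>s\<le>T. 2 * sizes K (B1_inner s k))) \<le> ?h" for k
  proof -
    have "real (\<Sum>s\<le>T. 2 * sizes K (B1_inner s k)) \<le> (\<Sum>s\<le>T. 2 * ((c0 + 1) * \<kappa>\<^sup>2))"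
      unfolding of_nat_sum using sizes_le(1) by (intro sum_mono) simp
    also have "\<dots> = (real T + 1) * (2 * (c0 + 1) * \<kappa>\<^sup>2)" by simp
    also have "\<dots> \<le> ((cT + 2) * \<kappa>) * (2 * (c0 + 1) * \<kappa>\<^sup>2)"
      using T \<kappa> p(6) by (intro mult_right_mono) (auto simp: distrib_right)
    also have "\<dots> = 2 * (cT + 2) * (c0 + 1) * \<kappa>^3" by (simp add: power3_eq_cube power2_eq_square algebra_simps)
    also have "\<dots> \<le> 2 * (cT + 2) * (c0 + 1) * (\<kappa> * y)" using y_ge[of 3 1] p(6,7) by (intro mult_left_mono) auto
    finally show ?thesis using sizes_le(2)[of k] unfolding of_nat_add distrib_right[of _ _ "\<kappa> * y"] by linarith
  qed
  have "k1 * y * ?h = (k1 * (c1 * (k1 + 1) + 1 + 2 * (cT + 2) * (c0 + 1))) * (\<kappa>^7 / \<epsilon>\<^sup>2)"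
    unfolding e7[symmetric] by (simp only: mult_ac)
  also have "\<dots> \<le> Cfin * (\<kappa>^7 / \<epsilon>\<^sup>2)" by (intro mult_right_mono Cfin_ge pos)
  finally have H: "k1 * y * ?h \<le> Cfin * (\<kappa>^7 / \<epsilon>\<^sup>2)" .
  have "0 \<le> ?h" using k1 k0 y0 p(6,7,8) by (intro mult_nonneg_nonneg add_nonneg_nonneg) auto
  from order_trans[OF total[OF per this] H]
  show "real (hessian_vector_complexity K T (sizes K)) \<le> Cfin * (\<kappa>^7 / \<epsilon>\<^sup>2)"
    unfolding hessian_vector_complexity_def .
qed

end

end

end

section \<open>Rate and complexity of NSBO-SGD\<close>

text \<open>A run with the prescribed batch sizes satisfies the hypotheses of \<open>sum_gradient_bound\<close>, and some iterate is at
most the average.\<close>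

lemma (in rate_constants) nsbo_rate:
  fixes f g :: "real^'m \<Rightarrow> real^'n \<Rightarrow> real"
    and F :: "'xi \<Rightarrow> real^'m \<Rightarrow> real^'n \<Rightarrow> real" and G :: "'zeta \<Rightarrow> real^'m \<Rightarrow> real^'n \<Rightarrow> real"
    and M :: "'w measure"
  assumes gamma: "\<gamma> \<le> 1 / Lg1"
    and setting: "bilevel_setting f g F G Dxi Dzeta"
    and basic: "basic_assumption f g \<mu> Lf0 Lf1 Lg1 Lg2 Cf0"
    and variance: "variance_assumption f g F G Dxi Dzeta \<sigma>f1 \<sigma>g1 \<sigma>g2"
    and prob: "prob_space M"
    and init: "initial_iterate M f g x0 y0 u0 \<mu> Lf0 Lf1 Lg2 r"
    and gap: "initial_gap_le M f g x0 \<Delta>"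
    and \<kappa>_def: "\<kappa> = kappa Lf1 Lg1 \<mu>" and T: "cT * \<kappa> \<le> real T" and K: "1 \<le> K"
    and sizes: "batch_sizes_ge c0 c1 c2 1 1 \<kappa> K T b"
    and run: "nsbo_run M Dxi Dzeta F G x0 y0 u0 (\<lambda>_. a / \<kappa>^3) (\<lambda>_. \<gamma>) K T b X Y U"
    and moment: "moment_assumption M g r K X Y"
  shows "\<exists>k<K. mean_sq M (\<lambda>\<omega>. grad (Phi f g) (X k \<omega>)) \<le> ennreal (Ctot * \<kappa>^3 / real K)"
proof -
  note p = const_pos
  interpret B: bilevel_problem f g \<mu> Lf0 Lf1 Lg1 Lg2 Cf0
    using basic setting by unfold_locales (auto simp: bilevel_setting_def)
  interpret prob_space M by (rule prob)
  have mu0: "0 < \<mu>" by (rule B.pos)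
  have \<kappa>: "1 \<le> \<kappa>" "\<mu> = L / \<kappa>"
  proof -
    have "\<mu> \<le> L" using B.\<mu>_le_Lg1 by (simp add: L_def)
    then show "1 \<le> \<kappa>" using mu0 by (simp add: \<kappa>_def kappa_def L_def)
    show "\<mu> = L / \<kappa>" using mu0 p(1) by (simp add: \<kappa>_def kappa_def L_def)
  qed
  have k0: "0 < \<kappa>" using \<kappa> by simp
  obtain \<xi> \<zeta> where fresh: "fresh_samples M Dxi Dzeta (\<lambda>\<omega>. (x0 \<omega>, y0 \<omega>, u0 \<omega>)) K T b \<xi> \<zeta>"
    and iter: "\<And>k \<omega>. k \<le> K \<Longrightarrow> \<omega> \<in> space M \<Longrightarrow> (X k \<omega>, Y k \<omega>, U k \<omega>) =
      nsbo_sgd F G (\<lambda>_. a / \<kappa>^3) (\<lambda>_. \<gamma>) T b (\<lambda>k i. \<xi> k i \<omega>) (\<lambda>B i. \<zeta> B i \<omega>) (x0 \<omega>, y0 \<omega>, u0 \<omega>) k"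
    using run unfolding nsbo_run_def by blast
  define Z0 where "Z0 \<omega> = (x0 \<omega>, y0 \<omega>, u0 \<omega>)" for \<omega>
  define m where "m = \<kappa> / (real K + \<kappa>)"
  define \<tau> where "\<tau> = \<sigma>g2\<^sup>2 / (c0 * \<kappa>\<^sup>2)"
  have s0: "\<And>k s. k < K \<Longrightarrow> s \<le> T \<Longrightarrow> c0 * \<kappa>\<^sup>2 \<le> real (b (B1_inner s k))"
    and s1: "\<And>k. k < K \<Longrightarrow> c1 * (\<kappa> * real K + \<kappa>\<^sup>2) \<le> real (b (B1 k))"
    and s2: "\<And>k. k < K \<Longrightarrow> c2 * (\<kappa>^3 * real K + \<kappa>^4) \<le> real (b (B2 k))"
    and s3: "\<And>k. k < K \<Longrightarrow> real K / \<kappa> \<le> real (b (B3 k))"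
    and s4: "\<And>k. k < K \<Longrightarrow> real K / \<kappa> \<le> real (b (B4 k))"
    using sizes by (simp_all add: batch_sizes_ge_def)
  have K0: "0 < real K" using K by simp
  have low: "0 < c0 * \<kappa>\<^sup>2" "0 < c1 * (\<kappa> * real K + \<kappa>\<^sup>2)" "0 < c2 * (\<kappa>^3 * real K + \<kappa>^4)" "0 < real K / \<kappa>"
    using p k0 K0 by (simp_all add: add_pos_pos)
  have bpos: "\<And>k s. k < K \<Longrightarrow> s \<le> T \<Longrightarrow> 0 < b (B1_inner s k)" "\<And>k. k < K \<Longrightarrow> 0 < b (B1 k)"
    "\<And>k. k < K \<Longrightarrow> 0 < b (B2 k)" "\<And>k. k < K \<Longrightarrow> 0 < b (B3 k)" "\<And>k. k < K \<Longrightarrow> 0 < b (B4 k)"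
    using less_le_trans[OF low(1) s0] less_le_trans[OF low(2) s1] less_le_trans[OF low(3) s2]
      less_le_trans[OF low(4) s3] less_le_trans[OF low(4) s4] by simp_all
  have tau: "8 * \<tau> / \<mu>\<^sup>2 = delta0 / 2"
    using p k0 cpos by (simp add: \<tau>_def c0_def \<kappa>(2) power_divide)
  have dl1: "delta0 \<le> 1" using theta_facts(2) by simp
  have \<gamma>\<mu>: "\<gamma> * \<mu> \<le> 1"
  proof -
    have "\<gamma> * \<mu> \<le> 1 / Lg1 * Lg1" using gamma B.\<mu>_le_Lg1 cpos mu0 by (intro mult_mono) auto
    then show ?thesis using cpos by simp
  qed
  \<comment> \<open>From \<open>(1 - x)\<^sup>n \<le> exp (- n x) \<le> 1 / (1 + n x)\<close>; the definition of \<open>cT\<close> makes \<open>n x\<close> at least \<open>2 / delta0\<close>.\<close>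
  have geometric: "(1 - \<gamma> * \<mu> / 2) ^ Suc T \<le> delta0 / 2"
  proof -
    define x where "x = \<gamma> * \<mu> / 2"
    have x: "0 < x" "x \<le> 1" using cpos mu0 \<gamma>\<mu> by (simp_all add: x_def)
    have "cT * \<kappa> * x = 2 / delta0" using k0 p(1,5) cpos by (simp add: x_def cT_def \<kappa>(2))
    moreover have "cT * \<kappa> * x \<le> real (Suc T) * x" using T x by (intro mult_right_mono) auto
    ultimately have n: "2 / delta0 \<le> 1 + real (Suc T) * x" by simp
    have "(1 - x) ^ Suc T \<le> exp (- x) ^ Suc T"
      using x exp_ge_add_one_self[of "- x"] by (intro power_mono) auto
    also have "\<dots> = exp (real (Suc T) * - x)" by (rule exp_of_nat_mult[symmetric])
    also have "\<dots> = 1 / exp (real (Suc T) * x)" by (simp only: mult_minus_right exp_minus inverse_eq_divide)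
    also have "\<dots> \<le> 1 / (2 / delta0)"
    proof (intro divide_left_mono)
      show "2 / delta0 \<le> exp (real (Suc T) * x)" using n exp_ge_add_one_self[of "real (Suc T) * x"] by linarith
    qed (use p(5) in auto)
    finally show ?thesis by (simp add: x_def)
  qed
  interpret N: nsbo f g \<mu> Lf0 Lf1 Lg1 Lg2 Cf0 F G Dxi Dzeta \<sigma>f1 \<sigma>g1 \<sigma>g2 M Z0 K T b \<xi> \<zeta> "a / \<kappa>^3" \<gamma> \<tau> delta0
  proof unfold_locales
    show "bilevel_setting f g F G Dxi Dzeta" "variance_assumption f g F G Dxi Dzeta \<sigma>f1 \<sigma>g1 \<sigma>g2" by fact+
    show "fresh_samples M Dxi Dzeta Z0 K T b \<xi> \<zeta>" using fresh by (simp add: Z0_def[abs_def])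
    show "Z0 \<in> borel_measurable M" using init by (auto simp: Z0_def[abs_def] initial_iterate_def)
    show "0 < \<gamma>" "\<gamma> \<le> 1 / Lg1" using cpos gamma by auto
    show "0 < b B" if "B \<in> zeta_batches K T \<union> xi_batches K" for B
      using that bpos by (auto simp: zeta_batches_def xi_batches_def)
    show "0 \<le> \<tau>" using p by (simp add: \<tau>_def)
    have "8 * \<tau> = delta0 / 2 * \<mu>\<^sup>2" using tau mu0 by (simp add: field_simps)
    also have "\<dots> \<le> 1 * \<mu>\<^sup>2" using dl1 by (intro mult_right_mono) auto
    finally show "8 * \<tau> \<le> \<mu>\<^sup>2" by simp
    show "\<sigma>g2\<^sup>2 / real (b (B1_inner s k)) \<le> \<tau>" if "k < K" "s \<le> T" for s k
      unfolding \<tau>_def using s0[OF that] low(1) by (intro divide_left_mono) auto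
    show "(1 - \<gamma> * \<mu> / 2) ^ Suc T + 8 * \<tau> / \<mu>\<^sup>2 \<le> delta0" using geometric tau by linarith
  qed
  have same: "X k \<omega> = N.X k \<omega>" "Y k \<omega> = N.Y k \<omega>" "U k \<omega> = N.U k \<omega>" if "k \<le> K" "\<omega> \<in> space M" for k \<omega>
  proof -
    have "(X k \<omega>, Y k \<omega>, U k \<omega>) = N.Z k \<omega>"
      using iter[OF that] N.nsbo_sgd_eq_Z[of \<omega> k] by (simp add: Z0_def)
    then show "X k \<omega> = N.X k \<omega>" "Y k \<omega> = N.Y k \<omega>" "U k \<omega> = N.U k \<omega>"
      unfolding N.X_def N.Y_def N.U_def by (metis fst_conv snd_conv)+
  qed
  have mean_cong: "mean_sq M P = mean_sq M Q" "mean_norm M P = mean_norm M Q"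
    if "\<And>\<omega>. \<omega> \<in> space M \<Longrightarrow> P \<omega> = Q \<omega>" for P Q :: "'w \<Rightarrow> 'v::real_normed_vector"
    unfolding mean_sq_def mean_norm_def using that by (auto intro: nn_integral_cong)
  have start: "N.X 0 = x0" "N.Y 0 = y0" "N.U 0 = u0"
    by (auto simp: N.X_def N.Y_def N.U_def Z0_def fun_eq_iff)
  \<comment> \<open>A batch is nonempty and has at least \<open>K / \<kappa>\<close> elements, hence at least half of \<open>1 + K / \<kappa> = 1 / m\<close>.\<close>
  have half: "\<sigma> / real n \<le> 2 * \<sigma> * m" if n: "0 < n" "real K / \<kappa> \<le> real n" and "0 \<le> \<sigma>" for \<sigma> n
  proof -
    have "(real K + \<kappa>) / \<kappa> = real K / \<kappa> + 1" using k0 by (simp add: add_divide_distrib)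
    moreover have "1 \<le> real n" using n by simp
    ultimately have "(real K + \<kappa>) / \<kappa> \<le> 2 * real n" using n(2) by linarith
    then have "real K + \<kappa> \<le> 2 * real n * \<kappa>" using k0 by (simp add: divide_le_eq)
    then have "1 / real n \<le> 2 * m"
      using n k0 K0 by (simp add: m_def divide_le_eq le_divide_eq mult_ac)
    from mult_left_mono[OF this \<open>0 \<le> \<sigma>\<close>] show ?thesis by (simp add: mult_ac)
  qed
  interpret A: nsbo_analysis f g \<mu> Lf0 Lf1 Lg1 Lg2 Cf0 F G Dxi Dzeta \<sigma>f1 \<sigma>g1 \<sigma>g2 M Z0 K T b \<xi> \<zeta> "a / \<kappa>^3" \<gamma> \<tau> delta0
    theta0 "\<sigma>g1\<^sup>2 * m / (L\<^sup>2 * c2 * \<kappa>\<^sup>2)" "\<sigma>g2\<^sup>2 * m / (c1 * \<kappa>\<^sup>2)" "2 * \<sigma>f1\<^sup>2 * m" "2 * \<sigma>g2\<^sup>2 * m" r \<Delta>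
    "\<mu>\<^sup>2 / (20 * r * Lg2\<^sup>2)" "min (4 * (L1_const Lf0 Lf1 Lg2 \<mu>)\<^sup>2 / (5 * r * Lg2\<^sup>2)) (L1_const Lf0 Lf1 Lg2 \<mu> / \<mu>\<^sup>2)"
  proof unfold_locales
    show "0 \<le> theta0" "2 * delta0 \<le> theta0\<^sup>2" "9 * delta0 \<le> 1 / 16" using p(4) theta_facts by auto
    show "0 \<le> a / \<kappa>^3" using p(23) k0 by simp
    show "a / \<kappa>^3 * B.LPhi \<le> 1 / 4"
    proof -
      have "(1 + Lg1 / \<mu>)\<^sup>2 \<le> (2 * \<kappa>)\<^sup>2"
        using smoothness_scaling(1)[OF \<kappa>] \<kappa>(1) cpos mu0 by (intro power_mono) auto
      then have "B.LPhi \<le> (ell * \<kappa>) * (2 * \<kappa>)\<^sup>2"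
        unfolding B.LPhi_def using smoothness_scaling(2)[OF \<kappa>] p(2) k0 by (intro mult_mono) auto
      also have "\<dots> = 4 * ell * \<kappa>^3" by (simp add: power_numeral_reduce mult_ac)
      finally have "a / \<kappa>^3 * B.LPhi \<le> a / \<kappa>^3 * (4 * ell * \<kappa>^3)" using p(23) k0 by (intro mult_left_mono) auto
      also have "\<dots> = 4 * ell * a" using k0 by simp
      finally show ?thesis using a_le(2) by linarith
    qed
    fix k assume k: "k < K"
    have "\<sigma>g1\<^sup>2 / real (b (B2 k)) / \<mu>\<^sup>2 \<le> \<sigma>g1\<^sup>2 / (c2 * (\<kappa>^3 * real K + \<kappa>^4)) / \<mu>\<^sup>2"
      using s2[OF k] low(3) by (intro divide_right_mono divide_left_mono) auto
    also have "c2 * (\<kappa>^3 * real K + \<kappa>^4) = c2 * \<kappa>^3 * (real K + \<kappa>)" by (simp add: power_numeral_reduce algebra_simps)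
    also have "\<sigma>g1\<^sup>2 / (c2 * \<kappa>^3 * (real K + \<kappa>)) / \<mu>\<^sup>2 = \<sigma>g1\<^sup>2 * m / (L\<^sup>2 * c2 * \<kappa>\<^sup>2)"
      using k0 p(1,9) by (simp add: m_def \<kappa>(2) power_divide power_numeral_reduce mult_ac)
    finally show "\<sigma>g1\<^sup>2 / real (b (B2 k)) / \<mu>\<^sup>2 \<le> \<sigma>g1\<^sup>2 * m / (L\<^sup>2 * c2 * \<kappa>\<^sup>2)" .
    have "\<sigma>g2\<^sup>2 / real (b (B1 k)) \<le> \<sigma>g2\<^sup>2 / (c1 * (\<kappa> * real K + \<kappa>\<^sup>2))"
      using s1[OF k] low(2) by (intro divide_left_mono) auto
    also have "c1 * (\<kappa> * real K + \<kappa>\<^sup>2) = c1 * \<kappa> * (real K + \<kappa>)" by (simp add: power2_eq_square algebra_simps)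
    also have "\<sigma>g2\<^sup>2 / (c1 * \<kappa> * (real K + \<kappa>)) = \<sigma>g2\<^sup>2 * m / (c1 * \<kappa>\<^sup>2)"
      using k0 p(8) by (simp add: m_def power2_eq_square mult_ac)
    finally show "\<sigma>g2\<^sup>2 / real (b (B1 k)) \<le> \<sigma>g2\<^sup>2 * m / (c1 * \<kappa>\<^sup>2)" .
    show "\<sigma>f1\<^sup>2 / real (b (B3 k)) \<le> 2 * \<sigma>f1\<^sup>2 * m" by (rule half[OF bpos(4)[OF k] s3[OF k]]) simp
    show "\<sigma>g2\<^sup>2 / real (b (B4 k)) \<le> 2 * \<sigma>g2\<^sup>2 * m" by (rule half[OF bpos(5)[OF k] s4[OF k]]) simp
  next
    have "mean_sq M (\<lambda>\<omega>. Y k \<omega> - ystar g (X k \<omega>)) = mean_sq M (\<lambda>\<omega>. N.Y k \<omega> - ystar g (N.X k \<omega>))"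
      "mean_norm M (\<lambda>\<omega>. Y k \<omega> - ystar g (X k \<omega>)) = mean_norm M (\<lambda>\<omega>. N.Y k \<omega> - ystar g (N.X k \<omega>))" if "k \<le> K" for k
      using same[OF that] by (auto intro!: mean_cong)
    then show "moment_assumption M g r K N.X N.Y"
      using moment by (auto simp: moment_assumption_def)
    show "mean_sq M (\<lambda>\<omega>. N.Y 0 \<omega> - ystar g (N.X 0 \<omega>)) \<le> ennreal (\<mu>\<^sup>2 / (20 * r * Lg2\<^sup>2))"
      using init unfolding initial_iterate_def start
      by (meson ennreal_leI min.cobounded1 order_trans)
    show "mean_sq M (\<lambda>\<omega>. N.U 0 \<omega> - ustar f g (N.X 0 \<omega>)) \<le>
        ennreal (min (4 * (L1_const Lf0 Lf1 Lg2 \<mu>)\<^sup>2 / (5 * r * Lg2\<^sup>2)) (L1_const Lf0 Lf1 Lg2 \<mu> / \<mu>\<^sup>2))"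
      using init unfolding initial_iterate_def start by blast
    show "0 \<le> \<mu>\<^sup>2 / (20 * r * Lg2\<^sup>2)" using r_pos by simp
    show "0 \<le> min (4 * (L1_const Lf0 Lf1 Lg2 \<mu>)\<^sup>2 / (5 * r * Lg2\<^sup>2)) (L1_const Lf0 Lf1 Lg2 \<mu> / \<mu>\<^sup>2)"
      using r_pos B.L1_pos by simp
    show "initial_gap_le M f g (N.X 0) \<Delta>" using gap by (simp add: start)
  qed
  have bound: "(\<Sum>k<K. A.nn k) \<le> Ctot * \<kappa>^3"
  proof (rule sum_gradient_bound[OF \<kappa> m_def refl refl refl refl refl refl, where \<phi> = A.\<phi> and \<psi> = A.\<psi> and d = A.dd and e = A.ee and g = A.gg])
    show "A.\<psi> 0 \<le> 4 * (L1_const Lf0 Lf1 Lg2 \<mu>)\<^sup>2 / (5 * r * Lg2\<^sup>2)" "A.\<psi> 0 \<le> L1_const Lf0 Lf1 Lg2 \<mu> / \<mu>\<^sup>2"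
      using A.init_real(2) by auto
  qed (rule A.real_nonneg A.\<phi>_Suc_le A.\<psi>_Suc_le A.ee_le A.dd_le A.gg_step A.init_real; assumption?)+
  obtain k where k: "k < K" "A.nn k \<le> Ctot * \<kappa>^3 / real K"
  proof (rule ccontr)
    assume "\<not> thesis"
    then have "\<And>k. k < K \<Longrightarrow> Ctot * \<kappa>^3 / real K < A.nn k" using that by (meson not_le)
    then have "(\<Sum>k<K. Ctot * \<kappa>^3 / real K) < (\<Sum>k<K. A.nn k)" 
      using K by (intro sum_strict_mono) (auto simp: lessThan_empty_iff)
    then show False using bound K by simp
  qed
  have "mean_sq M (\<lambda>\<omega>. grad (Phi f g) (X k \<omega>)) = A.mG k"
    unfolding A.mG_def using same(1)[of k] k(1) by (intro mean_cong) (simp add: B.grad_Phi)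
  also have "\<dots> \<le> ennreal (Ctot * \<kappa>^3 / real K)" unfolding A.mG_real by (rule ennreal_leI[OF k(2)])
  finally show ?thesis using k(1) by blast
qed

lemma (in rate_constants) nsbo_complexity:
  fixes f g :: "real^'m \<Rightarrow> real^'n \<Rightarrow> real"
    and F :: "'xi \<Rightarrow> real^'m \<Rightarrow> real^'n \<Rightarrow> real" and G :: "'zeta \<Rightarrow> real^'m \<Rightarrow> real^'n \<Rightarrow> real"
    and M :: "'w measure"
  assumes gamma: "\<gamma> \<le> 1 / Lg1"
    and setting: "bilevel_setting f g F G Dxi Dzeta"
    and basic: "basic_assumption f g \<mu> Lf0 Lf1 Lg1 Lg2 Cf0"
    and variance: "variance_assumption f g F G Dxi Dzeta \<sigma>f1 \<sigma>g1 \<sigma>g2"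
    and M: "prob_space M"
    and init: "initial_iterate M f g x0 y0 u0 \<mu> Lf0 Lf1 Lg2 r"
    and gap: "initial_gap_le M f g x0 \<Delta>"
    and \<kappa>_def: "\<kappa> = kappa Lf1 Lg1 \<mu>"
  shows "\<exists>(\<alpha>::real) (T::nat).
        a * (1 / \<kappa>^3) \<le> \<alpha> \<and> \<alpha> \<le> a * (1 / \<kappa>^3) \<and> cT * \<kappa> \<le> real T \<and>
        (\<forall>K\<ge>1. \<forall>b X Y U.
           batch_sizes_ge c0 c1 c2 1 1 \<kappa> K T b \<and>
           nsbo_run M Dxi Dzeta F G x0 y0 u0 (\<lambda>_. \<alpha>) (\<lambda>_. \<gamma>) K T b X Y U \<and>
           moment_assumption M g r K X Y \<longrightarrow>
           (MIN k\<in>{..<K}. mean_sq M (\<lambda>\<omega>. grad (Phi f g) (X k \<omega>))) \<le> ennreal (Cfin * (\<kappa>^3 / real K))) \<and>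
        (\<forall>\<epsilon>::real. 0 < \<epsilon> \<and> \<epsilon> \<le> 1 \<longrightarrow>
           (\<exists>K\<ge>1. real K \<le> Cfin * (\<kappa>^3 / \<epsilon>) \<and>
              (\<forall>b X Y U.
                 batch_sizes_ge c0 c1 c2 1 1 \<kappa> K T b \<and>
                 nsbo_run M Dxi Dzeta F G x0 y0 u0 (\<lambda>_. \<alpha>) (\<lambda>_. \<gamma>) K T b X Y U \<and>
                 moment_assumption M g r K X Y \<longrightarrow>
                 (\<exists>k<K. mean_sq M (\<lambda>\<omega>. grad (Phi f g) (X k \<omega>)) \<le> ennreal \<epsilon>)))) \<and>
        (\<forall>\<epsilon>::real. 0 < \<epsilon> \<and> \<epsilon> \<le> 1 \<longrightarrow>
           (\<exists>K\<ge>1. \<exists>b.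
              real K \<le> Cfin * (\<kappa>^3 / \<epsilon>) \<and>
              batch_sizes_ge c0 c1 c2 1 1 \<kappa> K T b \<and>
              real (grad_complexity_F K b) \<le> Cfin * (\<kappa>^5 / \<epsilon>^2) \<and>
              real (grad_complexity_G K b) \<le> Cfin * (\<kappa>^9 / \<epsilon>^2) \<and>
              real (jacobian_vector_complexity K b) \<le> Cfin * (\<kappa>^5 / \<epsilon>^2) \<and>
              real (hessian_vector_complexity K T b) \<le> Cfin * (\<kappa>^7 / \<epsilon>^2) \<and>
              (\<forall>X Y U.
                 nsbo_run M Dxi Dzeta F G x0 y0 u0 (\<lambda>_. \<alpha>) (\<lambda>_. \<gamma>) K T b X Y U \<and>
                 moment_assumption M g r K X Y \<longrightarrow>
                 (\<exists>k<K. mean_sq M (\<lambda>\<omega>. grad (Phi f g) (X k \<omega>)) \<le> ennreal \<epsilon>))))"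
proof -
  note p = const_pos
  define T where "T = nat \<lceil>cT * \<kappa>\<rceil>"
  interpret B: bilevel_problem f g \<mu> Lf0 Lf1 Lg1 Lg2 Cf0
    using basic setting by unfold_locales (auto simp: bilevel_setting_def)
  have \<kappa>: "1 \<le> \<kappa>" using B.\<mu>_le_Lg1 B.pos(1) by (simp add: \<kappa>_def kappa_def)
  have T: "cT * \<kappa> \<le> real T" "real T \<le> (cT + 1) * \<kappa>"
  proof -
    have "0 \<le> cT * \<kappa>" using p \<kappa> by simp
    then show "cT * \<kappa> \<le> real T" "real T \<le> (cT + 1) * \<kappa>"
      using \<kappa> unfolding T_def distrib_right by linarith+
  qed
  define good where "good K b X Y U \<longleftrightarrow> batch_sizes_ge c0 c1 c2 1 1 \<kappa> K T b \<and>
      nsbo_run M Dxi Dzeta F G x0 y0 u0 (\<lambda>_. a / \<kappa>^3) (\<lambda>_. \<gamma>) K T b X Y U \<and> moment_assumption M g r K X Y" for K b X Y U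
  have rate: "\<exists>k<K. mean_sq M (\<lambda>\<omega>. grad (Phi f g) (X k \<omega>)) \<le> ennreal (Ctot * \<kappa>^3 / real K)"
    if "1 \<le> K" "good K b X Y U" for K b X Y U
    using nsbo_rate[OF gamma setting basic variance M init gap \<kappa>_def T(1) that(1)] that(2) unfolding good_def by blast
  have up: "x * (\<kappa>^n / e) \<le> Cfin * (\<kappa>^n / e)" if "x \<le> Cfin" "0 < e" for x e :: real and n
    using that \<kappa> by (intro mult_right_mono) auto
  have min: "(MIN k\<in>{..<K}. mean_sq M (\<lambda>\<omega>. grad (Phi f g) (X k \<omega>))) \<le> ennreal (Cfin * (\<kappa>^3 / real K))"
    if K: "1 \<le> K" and run: "good K b X Y U" for K b X Y U
  proof -
    obtain k where k: "k < K" "mean_sq M (\<lambda>\<omega>. grad (Phi f g) (X k \<omega>)) \<le> ennreal (Ctot * \<kappa>^3 / real K)"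
      using rate[OF K run] by blast
    have "(MIN k\<in>{..<K}. mean_sq M (\<lambda>\<omega>. grad (Phi f g) (X k \<omega>))) \<le> mean_sq M (\<lambda>\<omega>. grad (Phi f g) (X k \<omega>))"
      using k(1) by (intro Min_le) auto
    also note k(2)
    also have "ennreal (Ctot * \<kappa>^3 / real K) \<le> ennreal (Cfin * (\<kappa>^3 / real K))"
      using up[OF Cfin_ge(1), of "real K" 3] K by (intro ennreal_leI) simp
    finally show ?thesis .
  qed
  have eps: "\<exists>K\<ge>1. real K \<le> k1 * (\<kappa>^3 / \<epsilon>) \<and> (\<forall>b X Y U. good K b X Y U \<longrightarrow>
      (\<exists>k<K. mean_sq M (\<lambda>\<omega>. grad (Phi f g) (X k \<omega>)) \<le> ennreal \<epsilon>))"
    if \<epsilon>: "0 < \<epsilon>" "\<epsilon> \<le> 1" for \<epsilon> :: real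
  proof -
    obtain K :: nat where K: "1 \<le> K" "Ctot * \<kappa>^3 / real K \<le> \<epsilon>" "real K \<le> k1 * (\<kappa>^3 / \<epsilon>)"
      using iterations[OF \<kappa> \<epsilon>] by blast
    have "\<exists>k<K. mean_sq M (\<lambda>\<omega>. grad (Phi f g) (X k \<omega>)) \<le> ennreal \<epsilon>" if "good K b X Y U" for b X Y U
      using rate[OF K(1) that] ennreal_leI[OF K(2)] by (meson order_trans)
    then show ?thesis using K by blast
  qed
  show ?thesis
  proof (rule exI[of _ "a / \<kappa>^3"], rule exI[of _ T], unfold good_def[symmetric], intro conjI allI impI)
    show "a * (1 / \<kappa>^3) \<le> a / \<kappa>^3" "a / \<kappa>^3 \<le> a * (1 / \<kappa>^3)" by simp_all
    show "cT * \<kappa> \<le> real T" by (rule T)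
    show "(MIN k\<in>{..<K}. mean_sq M (\<lambda>\<omega>. grad (Phi f g) (X k \<omega>))) \<le> ennreal (Cfin * (\<kappa>^3 / real K))"
      if "1 \<le> K" "good K b X Y U" for K b X Y U by (rule min[OF that])
  next
    fix \<epsilon> :: real assume "0 < \<epsilon> \<and> \<epsilon> \<le> 1"
    then have \<epsilon>: "0 < \<epsilon>" "\<epsilon> \<le> 1" by auto
    obtain K where K: "1 \<le> K" "real K \<le> k1 * (\<kappa>^3 / \<epsilon>)"
      and run: "\<And>b X Y U. good K b X Y U \<Longrightarrow> \<exists>k<K. mean_sq M (\<lambda>\<omega>. grad (Phi f g) (X k \<omega>)) \<le> ennreal \<epsilon>"
      using eps[OF \<epsilon>] by blast
    have K': "real K \<le> Cfin * (\<kappa>^3 / \<epsilon>)" by (rule order_trans[OF K(2) up[OF Cfin_ge(2) \<epsilon>(1)]])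
    show "\<exists>K\<ge>1. real K \<le> Cfin * (\<kappa>^3 / \<epsilon>) \<and> (\<forall>b X Y U. good K b X Y U \<longrightarrow>
      (\<exists>k<K. mean_sq M (\<lambda>\<omega>. grad (Phi f g) (X k \<omega>)) \<le> ennreal \<epsilon>))"
      using K(1) K' run by blast
    have run': "\<exists>k<K. mean_sq M (\<lambda>\<omega>. grad (Phi f g) (X k \<omega>)) \<le> ennreal \<epsilon>"
      if "nsbo_run M Dxi Dzeta F G x0 y0 u0 (\<lambda>_. a / \<kappa>^3) (\<lambda>_. \<gamma>) K T (sizes \<kappa> K) X Y U \<and> moment_assumption M g r K X Y" for X Y U
      using run[of "sizes \<kappa> K" X Y U] that sizes_ok[OF \<kappa> \<epsilon>, of K T] unfolding good_def by blast
    show "\<exists>K\<ge>1. \<exists>b. real K \<le> Cfin * (\<kappa>^3 / \<epsilon>) \<and> batch_sizes_ge c0 c1 c2 1 1 \<kappa> K T b \<and>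
              real (grad_complexity_F K b) \<le> Cfin * (\<kappa>^5 / \<epsilon>^2) \<and>
              real (grad_complexity_G K b) \<le> Cfin * (\<kappa>^9 / \<epsilon>^2) \<and>
              real (jacobian_vector_complexity K b) \<le> Cfin * (\<kappa>^5 / \<epsilon>^2) \<and>
              real (hessian_vector_complexity K T b) \<le> Cfin * (\<kappa>^7 / \<epsilon>^2) \<and>
              (\<forall>X Y U. nsbo_run M Dxi Dzeta F G x0 y0 u0 (\<lambda>_. a / \<kappa>^3) (\<lambda>_. \<gamma>) K T b X Y U \<and>
                 moment_assumption M g r K X Y \<longrightarrow>
                 (\<exists>k<K. mean_sq M (\<lambda>\<omega>. grad (Phi f g) (X k \<omega>)) \<le> ennreal \<epsilon>))"
      by (rule exI[of _ K], rule conjI[OF K(1)], rule exI[of _ "sizes \<kappa> K"],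
          intro conjI K' sizes_ok[OF \<kappa> \<epsilon>] complexities[OF \<kappa> \<epsilon> K(2) T(2)] allI impI; rule run'; assumption)
  qed
qed

text \<open>If one of the fixed constants is not positive, the assumptions on the problem cannot hold and any constants will do.\<close>

theorem theorem3p7:
  fixes Lf0 Lf1 Lg1 Lg2 Cf0 \<sigma>f1 \<sigma>g1 \<sigma>g2 r \<gamma> \<Delta> :: real
  assumes "0 < \<gamma>" and "\<gamma> \<le> 1 / Lg1" and "1 \<le> r"
  shows "\<exists>a a' cT c0 c1 c2 c3 c4 C :: real.
    0 < a \<and> 0 < a' \<and> 0 < cT \<and> 0 < c0 \<and> 0 < c1 \<and> 0 < c2 \<and> 0 < c3 \<and> 0 < c4 \<and> 0 < C \<and>
    (\<forall>(\<mu>::real) (f :: real^'m \<Rightarrow> real^'n \<Rightarrow> real) g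
       (F :: 'xi \<Rightarrow> real^'m \<Rightarrow> real^'n \<Rightarrow> real) (G :: 'zeta \<Rightarrow> real^'m \<Rightarrow> real^'n \<Rightarrow> real)
       Dxi Dzeta (M :: 'w measure) x0 y0 u0.
      let \<kappa> = kappa Lf1 Lg1 \<mu> in
      bilevel_setting f g F G Dxi Dzeta \<and>
      basic_assumption f g \<mu> Lf0 Lf1 Lg1 Lg2 Cf0 \<and>
      variance_assumption f g F G Dxi Dzeta \<sigma>f1 \<sigma>g1 \<sigma>g2 \<and>
      prob_space M \<and>
      initial_iterate M f g x0 y0 u0 \<mu> Lf0 Lf1 Lg2 r \<and>
      initial_gap_le M f g x0 \<Delta> \<longrightarrow>
      (\<exists>(\<alpha>::real) (T::nat).
        a * (1 / \<kappa>^3) \<le> \<alpha> \<and> \<alpha> \<le> a' * (1 / \<kappa>^3) \<and> cT * \<kappa> \<le> real T \<and>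
        (\<forall>K\<ge>1. \<forall>b X Y U.
           batch_sizes_ge c0 c1 c2 c3 c4 \<kappa> K T b \<and>
           nsbo_run M Dxi Dzeta F G x0 y0 u0 (\<lambda>_. \<alpha>) (\<lambda>_. \<gamma>) K T b X Y U \<and>
           moment_assumption M g r K X Y \<longrightarrow>
           (MIN k\<in>{..<K}. mean_sq M (\<lambda>\<omega>. grad (Phi f g) (X k \<omega>))) \<le> ennreal (C * (\<kappa>^3 / real K))) \<and>
        (\<forall>\<epsilon>::real. 0 < \<epsilon> \<and> \<epsilon> \<le> 1 \<longrightarrow>
           (\<exists>K\<ge>1. real K \<le> C * (\<kappa>^3 / \<epsilon>) \<and>
              (\<forall>b X Y U.
                 batch_sizes_ge c0 c1 c2 c3 c4 \<kappa> K T b \<and>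
                 nsbo_run M Dxi Dzeta F G x0 y0 u0 (\<lambda>_. \<alpha>) (\<lambda>_. \<gamma>) K T b X Y U \<and>
                 moment_assumption M g r K X Y \<longrightarrow>
                 (\<exists>k<K. mean_sq M (\<lambda>\<omega>. grad (Phi f g) (X k \<omega>)) \<le> ennreal \<epsilon>)))) \<and>
        (\<forall>\<epsilon>::real. 0 < \<epsilon> \<and> \<epsilon> \<le> 1 \<longrightarrow>
           (\<exists>K\<ge>1. \<exists>b.
              real K \<le> C * (\<kappa>^3 / \<epsilon>) \<and>
              batch_sizes_ge c0 c1 c2 c3 c4 \<kappa> K T b \<and>
              real (grad_complexity_F K b) \<le> C * (\<kappa>^5 / \<epsilon>^2) \<and>
              real (grad_complexity_G K b) \<le> C * (\<kappa>^9 / \<epsilon>^2) \<and>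
              real (jacobian_vector_complexity K b) \<le> C * (\<kappa>^5 / \<epsilon>^2) \<and>
              real (hessian_vector_complexity K T b) \<le> C * (\<kappa>^7 / \<epsilon>^2) \<and>
              (\<forall>X Y U.
                 nsbo_run M Dxi Dzeta F G x0 y0 u0 (\<lambda>_. \<alpha>) (\<lambda>_. \<gamma>) K T b X Y U \<and>
                 moment_assumption M g r K X Y \<longrightarrow>
                 (\<exists>k<K. mean_sq M (\<lambda>\<omega>. grad (Phi f g) (X k \<omega>)) \<le> ennreal \<epsilon>))))))"
proof (cases "0 < Lf0 \<and> 0 < Lf1 \<and> 0 < Lg2 \<and> 0 < Cf0 \<and> 0 < \<sigma>f1 \<and> 0 < \<sigma>g1 \<and> 0 < \<sigma>g2")
  case False
  then have no: "\<not> (basic_assumption f g \<mu> Lf0 Lf1 Lg1 Lg2 Cf0 \<and> variance_assumption f g F G Dxi Dzeta \<sigma>f1 \<sigma>g1 \<sigma>g2)"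
    for f g :: "real^'m \<Rightarrow> real^'n \<Rightarrow> real" and \<mu> and F :: "'xi \<Rightarrow> real^'m \<Rightarrow> real^'n \<Rightarrow> real"
      and G :: "'zeta \<Rightarrow> real^'m \<Rightarrow> real^'n \<Rightarrow> real" and Dxi Dzeta
    by (auto simp: basic_assumption_def variance_assumption_def)
  show ?thesis
    by ((rule exI[of _ "1 :: real"])+, intro conjI zero_less_one allI, unfold Let_def, rule impI, elim conjE)
       (rule no[THEN notE], intro conjI, assumption+)
next
  case True
  have "0 < Lg1"
  proof (rule ccontr)
    assume "\<not> 0 < Lg1"
    then have "1 / Lg1 \<le> 0" by simp
    then show False using assms by linarith
  qed
  then interpret R: rate_constants Lf0 Lf1 Lg1 Lg2 Cf0 \<sigma>f1 \<sigma>g1 \<sigma>g2 r \<gamma> \<Delta>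
    using True assms by unfold_locales auto
  show ?thesis
    by (rule exI[of _ R.a], rule exI[of _ R.a], rule exI[of _ R.cT], rule exI[of _ R.c0], rule exI[of _ R.c1],
        rule exI[of _ R.c2], rule exI[of _ 1], rule exI[of _ 1], rule exI[of _ R.Cfin],
        intro conjI R.const_pos zero_less_one R.Cfin_ge allI, unfold Let_def, rule impI, elim conjE,
        rule R.nsbo_complexity[OF assms(2) _ _ _ _ _ _ refl]; assumption)
qed

end
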